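(* Suppose that the class-conditional distributions are $P_r=N_d(\mu_r,\Sigma)$ for $r=0,1$, with $\Sigma$ positive definite and $\mu_0\neq\mu_1$, that the prior probabilities satisfy $\pi_1=1-\pi_0\in(0,1)$, and that the label noise is $\rho$-homogeneous with $\rho\in[0,1/2)$. Let $\Delta>0$ be given by $\Delta^2=(\mu_1-\mu_0)^T\Sigma^{-1}(\mu_1-\mu_0)$. Then the LDA classifier $\tilde C^{\mathrm{LDA}}=\tilde C_n^{\mathrm{LDA}}$ trained with the noisy labels satisfies, almost surely, \[ \lim_{n\to\infty}\tilde C^{\mathrm{LDA}}(x)=\begin{cases}1&\text{if }c_0+\bigl(x-\frac{\mu_1+\mu_0}{2}\bigr)^T\Sigma^{-1}(\mu_1-\mu_0)>0,\\0&\text{if }c_0+\bigl(x-\frac{\mu_1+\mu_0}{2}\bigr)^T\Sigma^{-1}(\mu_1-\mu_0)<0,\end{cases} \] where \[ c_0=\Bigl\{(1-2\rho)+\frac{\rho(1-\rho)(1+\pi_0\pi_1\Delta^2)}{(1-2\rho)\pi_1\pi_0}\Bigr\}\log\Bigl(\frac{(1-2\rho)\pi_1+\rho}{(1-2\rho)\pi_0+\rho}\Bigr)-\frac{(\pi_1-\pi_0)\rho(1-\rho)\Delta^2}{2\{(1-2\rho)^2\pi_1\pi_0+\rho(1-\rho)\}} . \] As a consequence, \[ \lim_{n\to\infty}R(\tilde C^{\mathrm{LDA}})=\pi_0\Phi\Bigl(\frac{c_0}{\Delta}-\frac{\Delta}{2}\Bigr)+\pi_1\Phi\Bigl(-\frac{c_0}{\Delta}-\frac{\Delta}{2}\Bigr)\ge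 R(C^{\mathrm{Bayes}}). \] For each $\rho\in(0,1/2)$ and each $\pi_0\neq\pi_1$, there exists a unique value of $\Delta>0$ for which equality is attained in this last inequality.
   Context: Setting. $(X,Y,\tilde Y),(X_1,Y_1,\tilde Y_1),(X_2,Y_2,\tilde Y_2),\ldots$ are i.i.d. triples in $\mathbb{R}^d\times\{0,1\}\times\{0,1\}$ ($X$ feature, $Y$ true label, $\tilde Y$ noisy label). $\pi_r=\mathbb{P}(Y=r)$, and $P_r$ is the distribution of $X$ given $Y=r$. The noise is $\rho$-homogeneous if $\mathbb{P}(\tilde Y\neq Y\mid X=x,Y=r)=\rho$ for all $x$ and $r=0,1$. For a classifier $C$ (possibly depending on the training data), $R(C)=\mathbb{P}\{C(X)\neq Y\}$, the probability being over training data and $(X,Y)$. With $\eta(x)=\mathbb{P}(Y=1\mid X=x)$, $C^{\mathrm{Bayes}}(x)=1$ if $\eta(x)\ge1/2$ and $0$ otherwise; in the Gaussian setting above, \[ R(C^{\mathrm{Bayes}})=\pi_0\Phi\Bigl(\frac1\Delta\log\Bigl(\frac{\pi_1}{\pi_0}\Bigr)-\frac\Delta2\Bigr)+\pi_1\Phi\Bigl(\frac1\Delta\log\Bigl(\frac{\pi_0}{\pi_1}\Bigr)-\frac\Delta2\Bigr), \] where $\Phi$ is the standard normal distribution function. Corrupted LDA classifier. For $r=0,1$ let $\hat\pi_r=n^{-1}\sum_{i=1}^n\mathbf{1}_{\{\tilde Y_i=r\}}$, $\hat\mu_r=\sum_{i=1}^nX_i\mathbf{1}_{\{\tilde Y_i=r\}}/\sum_{i=1}^n\mathbf{1}_{\{\tilde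 Y_i=r\}}$, and \[ \hat\Sigma=\frac1{n-2}\sum_{i=1}^n\sum_{r=0}^1(X_i-\hat\mu_r)(X_i-\hat\mu_r)^T\mathbf{1}_{\{\tilde Y_i=r\}} . \] Then $\tilde C_n^{\mathrm{LDA}}(x)=1$ if $\log(\hat\pi_1/\hat\pi_0)+\bigl(x-\frac{\hat\mu_1+\hat\mu_0}{2}\bigr)^T\hat\Sigma^{-1}(\hat\mu_1-\hat\mu_0)\ge0$, and $0$ otherwise. *)

theory Defs
  imports "HOL-Probability.Probability"
begin

definition pos_def_matrix :: "real^'d^'d \<Rightarrow> bool" where
  "pos_def_matrix S \<longleftrightarrow> transpose S = S \<and> (\<forall>v. v \<noteq> 0 \<longrightarrow> v \<bullet> (S *v v) > 0)"

text \<open>Density of $N_d(m, S)$ with respect to Lebesgue measure, for positive definite \<open>S\<close>.\<close>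

definition mvn_density :: "real^'d \<Rightarrow> real^'d^'d \<Rightarrow> real^'d \<Rightarrow> real" where
  "mvn_density m S x =
     exp (- ((x - m) \<bullet> (matrix_inv S *v (x - m))) / 2) / sqrt ((2 * pi) ^ CARD('d) * det S)"

text \<open>Labels are natural numbers restricted to \<open>{0, 1}\<close> by the choice of the label space.\<close>

abbreviation labels :: "nat measure" where
  "labels \<equiv> count_space {0, 1}"

text \<open>The joint law of a feature \<open>X\<close> and a true label \<open>Y\<close>: \<open>\<pi>\<^sub>r\<close> is the probability of \<open>Y = r\<close>,
  and \<open>X\<close> has law $N_d(\mu_r, \Sigma)$ under the conditional measure given \<open>Y = r\<close>.\<close>

definition gaussian_classes ::
  "'w measure \<Rightarrow> ('w \<Rightarrow> real^'d) \<Rightarrow> ('w \<Rightarrow> nat) \<Rightarrow> real \<Rightarrow> real \<Rightarrow> real^'d \<Rightarrow> real^'d \<Rightarrow> real^'d^'d \<Rightarrow> bool"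
  where
  "gaussian_classes M X Y \<pi>\<^sub>0 \<pi>\<^sub>1 \<mu>\<^sub>0 \<mu>\<^sub>1 \<Sigma> \<longleftrightarrow>
     prob_space M \<and> X \<in> M \<rightarrow>\<^sub>M borel \<and> Y \<in> M \<rightarrow>\<^sub>M labels \<and>
     measure M {\<omega> \<in> space M. Y \<omega> = 0} = \<pi>\<^sub>0 \<and>
     measure M {\<omega> \<in> space M. Y \<omega> = 1} = \<pi>\<^sub>1 \<and>
     distributed (uniform_measure M {\<omega> \<in> space M. Y \<omega> = 0}) lborel X
       (\<lambda>x. ennreal (mvn_density \<mu>\<^sub>0 \<Sigma> x)) \<and>
     distributed (uniform_measure M {\<omega> \<in> space M. Y \<omega> = 1}) lborel X
       (\<lambda>x. ennreal (mvn_density \<mu>\<^sub>1 \<Sigma> x))"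

text \<open>\<open>P(Yt \<noteq> Y | X = x, Y = r) = \<rho>\<close> for all \<open>x\<close> and \<open>r\<close>, as an identity between versions of the
  conditional probability given the sigma-algebra generated by \<open>(X, Y)\<close>.\<close>

definition homogeneous_noise ::
  "'w measure \<Rightarrow> ('w \<Rightarrow> real^'d) \<Rightarrow> ('w \<Rightarrow> nat) \<Rightarrow> ('w \<Rightarrow> nat) \<Rightarrow> real \<Rightarrow> bool" where
  "homogeneous_noise M X Y Yt \<rho> \<longleftrightarrow>
     (AE \<omega> in M. real_cond_exp M
        (vimage_algebra (space M) (\<lambda>\<omega>. (X \<omega>, Y \<omega>)) (borel \<Otimes>\<^sub>M labels))
        (indicat_real {\<omega> \<in> space M. Yt \<omega> \<noteq> Y \<omega>}) \<omega> = \<rho>)"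

definition iid_triples ::
  "'w measure \<Rightarrow> (nat \<Rightarrow> 'w \<Rightarrow> real^'d) \<Rightarrow> (nat \<Rightarrow> 'w \<Rightarrow> nat) \<Rightarrow> (nat \<Rightarrow> 'w \<Rightarrow> nat) \<Rightarrow> bool" where
  "iid_triples M X Y Yt \<longleftrightarrow>
     prob_space.indep_vars M (\<lambda>_. borel \<Otimes>\<^sub>M (labels \<Otimes>\<^sub>M labels))
       (\<lambda>i \<omega>. (X i \<omega>, Y i \<omega>, Yt i \<omega>)) UNIV \<and>
     (\<forall>i. distr M (borel \<Otimes>\<^sub>M (labels \<Otimes>\<^sub>M labels)) (\<lambda>\<omega>. (X i \<omega>, Y i \<omega>, Yt i \<omega>)) =
          distr M (borel \<Otimes>\<^sub>M (labels \<Otimes>\<^sub>M labels)) (\<lambda>\<omega>. (X 0 \<omega>, Y 0 \<omega>, Yt 0 \<omega>)))"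

text \<open>\<open>\<eta>\<close> is a version of \<open>x \<mapsto> P(Y = 1 | X = x)\<close>.\<close>

definition regression_function ::
  "'w measure \<Rightarrow> ('w \<Rightarrow> real^'d) \<Rightarrow> ('w \<Rightarrow> nat) \<Rightarrow> (real^'d \<Rightarrow> real) \<Rightarrow> bool" where
  "regression_function M X Y \<eta> \<longleftrightarrow>
     \<eta> \<in> borel_measurable borel \<and>
     (AE \<omega> in M. real_cond_exp M (vimage_algebra (space M) X borel)
        (indicat_real {\<omega> \<in> space M. Y \<omega> = 1}) \<omega> = \<eta> (X \<omega>))"

definition bayes_classifier :: "(real^'d \<Rightarrow> real) \<Rightarrow> real^'d \<Rightarrow> nat" where
  "bayes_classifier \<eta> x = (if \<eta> x \<ge> 1 / 2 then 1 else 0)"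

text \<open>The classifier may depend on the training data, hence on \<open>\<omega>\<close>.\<close>

definition risk ::
  "'w measure \<Rightarrow> ('w \<Rightarrow> real^'d) \<Rightarrow> ('w \<Rightarrow> nat) \<Rightarrow> ('w \<Rightarrow> real^'d \<Rightarrow> nat) \<Rightarrow> real" where
  "risk M X Y C = measure M {\<omega> \<in> space M. C \<omega> (X \<omega>) \<noteq> Y \<omega>}"

text \<open>Linear discriminant analysis on the sample \<open>(x\<^sub>1, y\<^sub>1), \<dots>, (x\<^sub>n, y\<^sub>n)\<close>; the entry with
  index 0 is not used. When a class is empty, \<open>n \<le> 2\<close>, or the sample covariance is singular,
  the value is whatever the total functions involved return.\<close>

definition lda_count :: "(nat \<Rightarrow> nat) \<Rightarrow> nat \<Rightarrow> nat \<Rightarrow> real" where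
  "lda_count ys n r = (\<Sum>i = 1..n. of_bool (ys i = r))"

definition lda_prior :: "(nat \<Rightarrow> nat) \<Rightarrow> nat \<Rightarrow> nat \<Rightarrow> real" where
  "lda_prior ys n r = lda_count ys n r / real n"

definition lda_mean :: "(nat \<Rightarrow> real^'d) \<Rightarrow> (nat \<Rightarrow> nat) \<Rightarrow> nat \<Rightarrow> nat \<Rightarrow> real^'d" where
  "lda_mean xs ys n r = (\<Sum>i = 1..n. of_bool (ys i = r) *\<^sub>R xs i) /\<^sub>R lda_count ys n r"

definition outer_square :: "real^'d \<Rightarrow> real^'d^'d" where
  "outer_square v = (\<chi> a b. v $ a * v $ b)"

definition lda_cov :: "(nat \<Rightarrow> real^'d) \<Rightarrow> (nat \<Rightarrow> nat) \<Rightarrow> nat \<Rightarrow> real^'d^'d" where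
  "lda_cov xs ys n =
     (\<Sum>i = 1..n. \<Sum>r\<in>{0, 1}. of_bool (ys i = r) *\<^sub>R outer_square (xs i - lda_mean xs ys n r))
       /\<^sub>R (real n - 2)"

definition lda_classifier ::
  "(nat \<Rightarrow> real^'d) \<Rightarrow> (nat \<Rightarrow> nat) \<Rightarrow> nat \<Rightarrow> real^'d \<Rightarrow> nat" where
  "lda_classifier xs ys n x =
     (if ln (lda_prior ys n 1 / lda_prior ys n 0)
         + (x - (lda_mean xs ys n 1 + lda_mean xs ys n 0) /\<^sub>R 2)
             \<bullet> (matrix_inv (lda_cov xs ys n) *v (lda_mean xs ys n 1 - lda_mean xs ys n 0)) \<ge> 0
      then 1 else 0)"

definition lda_c0 :: "real \<Rightarrow> real \<Rightarrow> real \<Rightarrow> real \<Rightarrow> real" where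
  "lda_c0 \<pi>\<^sub>0 \<pi>\<^sub>1 \<rho> \<Delta> =
     ((1 - 2 * \<rho>) + \<rho> * (1 - \<rho>) * (1 + \<pi>\<^sub>0 * \<pi>\<^sub>1 * \<Delta>\<^sup>2) / ((1 - 2 * \<rho>) * \<pi>\<^sub>1 * \<pi>\<^sub>0))
       * ln (((1 - 2 * \<rho>) * \<pi>\<^sub>1 + \<rho>) / ((1 - 2 * \<rho>) * \<pi>\<^sub>0 + \<rho>))
     - (\<pi>\<^sub>1 - \<pi>\<^sub>0) * \<rho> * (1 - \<rho>) * \<Delta>\<^sup>2 / (2 * ((1 - 2 * \<rho>)\<^sup>2 * \<pi>\<^sub>1 * \<pi>\<^sub>0 + \<rho> * (1 - \<rho>)))"

abbreviation std_normal_cdf :: "real \<Rightarrow> real" ("\<Phi>") where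
  "\<Phi> \<equiv> cdf std_normal_distribution"

definition lda_limit_risk :: "real \<Rightarrow> real \<Rightarrow> real \<Rightarrow> real \<Rightarrow> real" where
  "lda_limit_risk \<pi>\<^sub>0 \<pi>\<^sub>1 \<rho> \<Delta> =
     \<pi>\<^sub>0 * \<Phi> (lda_c0 \<pi>\<^sub>0 \<pi>\<^sub>1 \<rho> \<Delta> / \<Delta> - \<Delta> / 2) + \<pi>\<^sub>1 * \<Phi> (- lda_c0 \<pi>\<^sub>0 \<pi>\<^sub>1 \<rho> \<Delta> / \<Delta> - \<Delta> / 2)"

end

theory Submission
  imports Defs
begin

text \<open>The sample averages entering LDA (frequencies, first and second moments of each noisy class)
  converge almost surely, and the LDA score is a continuous function of them. In the limit the noisy
  class means differ by a positive multiple of $\delta = \mu_1 - \mu_0$, and the pooled noisy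
  covariance is $\Sigma + \kappa\,\delta\delta^T$ with $\kappa \ge 0$. By the Sherman--Morrison
  formula its inverse maps $\delta$ to a positive multiple of $\Sigma^{-1}\delta$, so the noise only
  moves the threshold of the linear rule, to $c_0$. The limit of the risk follows by dominated
  convergence, since the limiting hyperplane has probability zero.

  A rule with threshold $c$ has risk
  $g(c) = \pi_0 \Phi(c/\Delta - \Delta/2) + \pi_1 \Phi(-c/\Delta - \Delta/2)$, and $g'$ has the sign of
  $\pi_0 e^c - \pi_1$; so $g$ has a unique minimum, attained by the Bayes threshold
  $\log(\pi_1/\pi_0)$. Equality therefore means $c_0 = \log(\pi_1/\pi_0)$. As $c_0$ is affine in
  $\Delta^2$, there is at most one solution; that it is positive comes from the monotonicity of
  $u \mapsto (1 - u^2)\,\mathrm{artanh}(u)/u$, with $u = \pi_1 - \pi_0$ before and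
  $u = (1 - 2\rho)(\pi_1 - \pi_0)$ after contamination.\<close>

section \<open>Risk of a linear rule as a function of its threshold\<close>

text \<open>Everything about the Gaussian classes is read off one-dimensional marginals
  \<open>v \<bullet> X\<close>: integrability, first and second moments, and the error probabilities
  of half-spaces. Mixed second moments follow by polarisation. Eighth powers enter because the
  strong law rests on a fourth-moment bound and is applied to products of two coordinates.

  Only finitely many averages have to converge, so one null set serves all \<open>x\<close>. Hence
  the random test point \<open>X 0\<close> may be inserted for \<open>x\<close>; the training sums
  start at index 1.

  The monotonicity quoted above gives F the sign of the difference of the priors. That G has the
  same sign is a second inequality, artanh u < u / (1 - u^2) for 0 < u < 1.

  The equality clause quantifies over all models with given priors and \<Delta>. The Bayes risk
  depends on these data only, but the clause singles out one \<Delta> only because a model exists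
  for each value; hence the explicit construction near the end.\<close>

lemma std_normal_cdf_diff:
  assumes "a \<le> b"
  shows "\<Phi> b - \<Phi> a = integral {a..b} std_normal_density"
proof (cases "a = b")
  case False
  with assms have ab: "a < b" by simp
  interpret real_distribution std_normal_distribution by (rule real_dist_normal_dist)
  have "\<Phi> b - \<Phi> a = measure std_normal_distribution {a<..b}"
    by (rule cdf_diff_eq[OF ab])
  also have "\<dots> = enn2real (\<integral>\<^sup>+x. ennreal (std_normal_density x * indicator {a<..b} x) \<partial>lborel)"
    by (simp add: measure_def emeasure_density ennreal_mult' ennreal_indicator)
  also have "\<dots> = (\<integral>x. std_normal_density x * indicator {a<..b} x \<partial>lborel)"
    by (rule integral_eq_nn_integral[symmetric]) auto
  also have "\<dots> = (LINT x:{a<..b}|lborel. std_normal_density x)"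
    by (simp add: set_lebesgue_integral_def mult.commute)
  also have "\<dots> = integral {a<..b} std_normal_density"
    by (rule set_borel_integral_eq_integral(2))
       (unfold set_integrable_def, intro integrable_mult_indicator, auto)
  also have "\<dots> = integral {a..b} std_normal_density"
  proof (rule integral_spike_set)
    show "negligible {x \<in> {a<..b} - {a..b}. std_normal_density x \<noteq> 0}" 
      by (rule negligible_subset[of "{}"]) auto
    show "negligible {x \<in> {a..b} - {a<..b}. std_normal_density x \<noteq> 0}" 
      by (rule negligible_subset[of "{a}"]) auto
  qed
  finally show ?thesis .
qed simp

text \<open>Up to the constant \<open>\<Phi> (x - 1)\<close>, the distribution function near
  \<open>x\<close> is an integral from the anchor \<open>x - 1\<close>. The fundamental theorem on a
  compact interval then applies, and \<open>x\<close> lies in the interior, so the derivative is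
  two-sided.\<close>

lemma DERIV_std_normal_cdf: "(\<Phi> has_real_derivative std_normal_density x) (at x)"
proof -
  have cont: "continuous_on {x - 1..x + 1} std_normal_density"
    unfolding normal_density_def [abs_def] by (intro continuous_intros) auto
  have "((\<lambda>t. integral {x - 1..t} std_normal_density) has_real_derivative std_normal_density x)
          (at x within {x - 1..x + 1})"
    by (rule integral_has_real_derivative[OF cont]) simp
  moreover have "at x within {x - 1..x + 1} = at x"
    by (rule at_within_Icc_at) auto
  ultimately have "((\<lambda>t. integral {x - 1..t} std_normal_density) has_real_derivative
      std_normal_density x) (at x)"
    by (simp only:)
  from DERIV_add[OF DERIV_const[of "\<Phi> (x - 1)"] this]
  have deriv: "((\<lambda>t. \<Phi> (x - 1) + integral {x - 1..t} std_normal_density) has_real_derivative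
            std_normal_density x) (at x)"
    by (simp only: add_0)
  have "eventually (\<lambda>t. t \<in> {x - 1<..<x + 1}) (nhds x)"
    by (intro eventually_nhds_in_open) auto
  hence "eventually (\<lambda>t. \<Phi> (x - 1) + integral {x - 1..t} std_normal_density = \<Phi> t) (nhds x)"
  proof eventually_elim
    case (elim t)
    thus ?case using std_normal_cdf_diff[of "x - 1" t] by simp
  qed
  from DERIV_cong_ev[OF refl this refl] deriv show ?thesis by (simp only:)
qed

definition threshold_risk :: "real \<Rightarrow> real \<Rightarrow> real \<Rightarrow> real \<Rightarrow> real" where
  "threshold_risk \<pi>\<^sub>0 \<pi>\<^sub>1 D c = \<pi>\<^sub>0 * \<Phi> (c / D - D / 2) + \<pi>\<^sub>1 * \<Phi> (- c / D - D / 2)"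

text \<open>The squares of \<open>c / D + D / 2\<close> and \<open>c / D - D / 2\<close> differ by
  \<open>2 * c\<close>, so the two normal densities in the derivative differ exactly by the factor
  \<open>exp c\<close>. Factoring out the common density isolates the sign in
  \<open>\<pi>\<^sub>0 * exp c - \<pi>\<^sub>1\<close>.\<close>

lemma DERIV_threshold_risk:
  assumes "D > 0"
  shows "(threshold_risk \<pi>\<^sub>0 \<pi>\<^sub>1 D has_real_derivative
           std_normal_density (c / D + D / 2) / D * (\<pi>\<^sub>0 * exp c - \<pi>\<^sub>1)) (at c)"
proof -
  have eq: "std_normal_density (c / D - D / 2) = std_normal_density (c / D + D / 2) * exp c"
           "std_normal_density (- c / D - D / 2) = std_normal_density (c / D + D / 2)"
  proof -
    have "- (c / D - D / 2)\<^sup>2 / 2 = - (c / D + D / 2)\<^sup>2 / 2 + c"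
      using assms by (simp add: power2_eq_square field_simps)
    thus "std_normal_density (c / D - D / 2) = std_normal_density (c / D + D / 2) * exp c"
      unfolding std_normal_density_def by (simp only: exp_add mult.assoc)
    have "(- c / D - D / 2)\<^sup>2 = (c / D + D / 2)\<^sup>2"
      by (simp add: power2_diff power2_sum)
    thus "std_normal_density (- c / D - D / 2) = std_normal_density (c / D + D / 2)"
      unfolding std_normal_density_def by (simp only:)
  qed
  have 1: "((\<lambda>c. c / D - D / 2) has_real_derivative 1 / D) (at c)"
          "((\<lambda>c. - c / D - D / 2) has_real_derivative - 1 / D) (at c)"
    using assms by (auto intro!: derivative_eq_intros)
  have "((\<lambda>c. \<pi>\<^sub>0 * \<Phi> (c / D - D / 2) + \<pi>\<^sub>1 * \<Phi> (- c / D - D / 2)) has_real_derivative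
          \<pi>\<^sub>0 * (std_normal_density (c / D - D / 2) * (1 / D)) +
          \<pi>\<^sub>1 * (std_normal_density (- c / D - D / 2) * (- 1 / D))) (at c)"
    by (intro DERIV_add DERIV_cmult DERIV_chain2[OF DERIV_std_normal_cdf] 1)
  thus ?thesis
    unfolding threshold_risk_def [abs_def] eq by (simp add: algebra_simps diff_divide_distrib)
qed

lemma threshold_risk_strict_min:
  assumes "D > 0" "\<pi>\<^sub>0 > 0" "\<pi>\<^sub>1 > 0" "c \<noteq> ln (\<pi>\<^sub>1 / \<pi>\<^sub>0)"
  shows "threshold_risk \<pi>\<^sub>0 \<pi>\<^sub>1 D (ln (\<pi>\<^sub>1 / \<pi>\<^sub>0)) < threshold_risk \<pi>\<^sub>0 \<pi>\<^sub>1 D c"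
proof -
  let ?L = "ln (\<pi>\<^sub>1 / \<pi>\<^sub>0)" and ?g = "threshold_risk \<pi>\<^sub>0 \<pi>\<^sub>1 D"
  let ?g' = "\<lambda>c. std_normal_density (c / D + D / 2) / D * (\<pi>\<^sub>0 * exp c - \<pi>\<^sub>1)"
  have L: "exp ?L = \<pi>\<^sub>1 / \<pi>\<^sub>0" using assms(2,3) by (intro exp_ln divide_pos_pos)
  have dens: "std_normal_density (t / D + D / 2) / D > 0" for t
    using assms(1) by (simp add: normal_density_pos)
  have cont: "isCont ?g t" for t by (rule DERIV_isCont[OF DERIV_threshold_risk[OF assms(1)]])
  hence cont': "continuous_on S ?g" for S by (simp add: continuous_at_imp_continuous_on)
  consider "c < ?L" | "c > ?L" using assms(4) by (metis linorder_neqE_linordered_idom)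
  thus ?thesis
  proof cases
    case 1
    show ?thesis
    proof (rule DERIV_neg_imp_decreasing_open[OF 1 _ cont'])
      fix t assume "c < t" "t < ?L"
      hence "exp t < exp ?L" by simp
      hence "exp t < \<pi>\<^sub>1 / \<pi>\<^sub>0" unfolding L .
      hence "\<pi>\<^sub>0 * exp t - \<pi>\<^sub>1 < 0" using assms(2) by (simp add: field_simps)
      hence neg: "?g' t < 0" by (rule mult_pos_neg[OF dens])
      thus "\<exists>y. DERIV ?g t :> y \<and> y < 0" using DERIV_threshold_risk[OF assms(1)] neg by (intro exI conjI)
    qed
  next
    case 2
    show ?thesis
    proof (rule DERIV_pos_imp_increasing_open[OF 2 _ cont'])
      fix t assume "?L < t" "t < c"
      hence "exp t > exp ?L" by simp
      hence "exp t > \<pi>\<^sub>1 / \<pi>\<^sub>0" unfolding L .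
      hence "\<pi>\<^sub>0 * exp t - \<pi>\<^sub>1 > 0" using assms(2) by (simp add: field_simps)
      hence neg: "?g' t > 0" by (rule mult_pos_pos[OF dens])
      thus "\<exists>y. DERIV ?g t :> y \<and> y > 0" using DERIV_threshold_risk[OF assms(1)] neg by (intro exI conjI)
    qed
  qed
qed

section \<open>The signal strength at which the limit is optimal\<close>

lemma artanh_gt_self:
  assumes "0 < u" "u < (1::real)"
  shows "u < artanh u"
proof -
  have "artanh 0 - 0 < artanh u - u"
  proof (rule DERIV_pos_imp_increasing_open[OF assms(1)])
    fix x assume x: "0 < x" "x < u"
    have x2: "0 < x\<^sup>2" "x\<^sup>2 < 1" using x assms by (auto simp: abs_square_less_1)
    have "((\<lambda>x. artanh x - x) has_real_derivative 1 / (1 - x\<^sup>2) - 1) (at x)"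
      using x assms by (auto intro!: derivative_eq_intros)
    moreover have "1 / (1 - x\<^sup>2) - 1 > 0" using x2 by (simp add: field_simps)
    ultimately show "\<exists>y. ((\<lambda>x. artanh x - x) has_real_derivative y) (at x) \<and> 0 < y" by blast
  qed (use assms in \<open>auto intro!: continuous_intros\<close>)
  thus ?thesis by simp
qed

text \<open>The difference of the two sides vanishes at 0 and has derivative
  \<open>2 * x\<^sup>2 / (1 - x\<^sup>2)\<^sup>2\<close>. This inequality fixes the sign of the
  coefficient of \<open>D\<^sup>2\<close> in the equation for the optimal signal strength.\<close>

lemma artanh_less:
  assumes "0 < u" "u < (1::real)"
  shows "artanh u < u / (1 - u\<^sup>2)"
proof -
  have "0 / (1 - 0\<^sup>2) - artanh 0 < u / (1 - u\<^sup>2) - artanh u"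
  proof (rule DERIV_pos_imp_increasing_open[OF assms(1)])
    fix x assume x: "0 < x" "x < u"
    have x2: "0 < x\<^sup>2" "x\<^sup>2 < 1" using x assms by (auto simp: abs_square_less_1)
    have "((\<lambda>x. x / (1 - x\<^sup>2) - artanh x) has_real_derivative
            ((1 - x\<^sup>2) + 2 * x\<^sup>2) / (1 - x\<^sup>2)\<^sup>2 - 1 / (1 - x\<^sup>2)) (at x)"
      using x assms x2 by (auto intro!: derivative_eq_intros simp: power2_eq_square)
    moreover have "((1 - x\<^sup>2) + 2 * x\<^sup>2) / (1 - x\<^sup>2)\<^sup>2 - 1 / (1 - x\<^sup>2) = 2 * x\<^sup>2 / (1 - x\<^sup>2)\<^sup>2"
    proof -
      have "(q + y) / q\<^sup>2 - 1 / q = y / q\<^sup>2" if "q \<noteq> 0" for q y :: real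
        using that by (simp add: field_simps power2_eq_square)
      from this[of "1 - x\<^sup>2" "2 * x\<^sup>2"] show ?thesis using x2(2) by simp
    qed
    moreover have "2 * x\<^sup>2 / (1 - x\<^sup>2)\<^sup>2 > 0" using x2 by simp
    ultimately show "\<exists>y. ((\<lambda>x. x / (1 - x\<^sup>2) - artanh x) has_real_derivative y) (at x) \<and> 0 < y" by metis
  next
    have "x\<^sup>2 < 1" if "x \<in> {0..u}" for x using that assms by (simp add: abs_square_less_1)
    hence "1 - x\<^sup>2 \<noteq> 0" if "x \<in> {0..u}" for x using that by force
    thus "continuous_on {0..u} (\<lambda>x. x / (1 - x\<^sup>2) - artanh x)"
      using assms by (intro continuous_intros) auto
  qed
  thus ?thesis by simp
qed

text \<open>The derivative is \<open>1 / x - (1 / x\<^sup>2 + 1) * artanh x\<close>. Replacing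
  \<open>artanh x\<close> by the smaller \<open>x\<close> gives the upper bound \<open>- x\<close>,
  which is negative.\<close>

lemma artanh_weighted_decreasing:
  assumes "0 < u" "u < v" "v < (1::real)"
  shows "(1 / v - v) * artanh v < (1 / u - u) * artanh u"
proof (rule DERIV_neg_imp_decreasing_open[OF assms(2)])
  fix x assume x: "u < x" "x < v"
  have x2: "0 < x" "x < 1" "0 < x\<^sup>2" "x\<^sup>2 < 1"
    using x assms by (auto simp: abs_square_less_1)
  have "((\<lambda>x. (1 / x - x) * artanh x) has_real_derivative
          (- 1 / x\<^sup>2 - 1) * artanh x + (1 / x - x) * (1 / (1 - x\<^sup>2))) (at x)"
    using x assms x2 by (auto intro!: derivative_eq_intros simp: power2_eq_square)
  moreover have "(1 / x - x) * (1 / (1 - x\<^sup>2)) = 1 / x"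
    using x2 by (simp add: field_simps power2_eq_square)
  moreover have "(- 1 / x\<^sup>2 - 1) * artanh x + 1 / x < 0"
  proof -
    have "(1 / x\<^sup>2 + 1) * x < (1 / x\<^sup>2 + 1) * artanh x"
      using artanh_gt_self[of x] x2 by (intro mult_strict_left_mono) (auto intro: add_pos_pos)
    moreover have "(1 / x\<^sup>2 + 1) * x = 1 / x + x" using x2 by (simp add: field_simps power2_eq_square)
    ultimately show ?thesis using x2 by (simp add: algebra_simps)
  qed
  ultimately show "\<exists>y. ((\<lambda>x. (1 / x - x) * artanh x) has_real_derivative y) (at x) \<and> y < 0" by metis
next
  show "continuous_on {u..v} (\<lambda>x. (1 / x - x) * artanh x)"
    using assms by (intro continuous_intros) auto
qed

text \<open>In the centred parameters \<open>\<theta> = 1 - 2 * \<rho>\<close> and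
  \<open>s = p\<^sub>1 - p\<^sub>0\<close>, contamination is the scaling of \<open>s\<close> to
  \<open>u\<close>, and both log odds become twice an artanh. The gap between the LDA threshold and
  the Bayes threshold then splits into a part free of \<open>D\<close> and a multiple of
  \<open>D\<^sup>2\<close>, whose signs can be studied separately.\<close>

lemma lda_c0_artanh:
  fixes s \<theta> :: real
  assumes s: "\<bar>s\<bar> < 1" and \<theta>: "0 < \<theta>" "\<theta> \<le> 1"
  defines "u \<equiv> \<theta> * s" and "\<rho> \<equiv> (1 - \<theta>) / 2" and "p\<^sub>1 \<equiv> (1 + s) / 2" and "p\<^sub>0 \<equiv> (1 - s) / 2"
  shows "lda_c0 p\<^sub>0 p\<^sub>1 \<rho> D - ln (p\<^sub>1 / p\<^sub>0) =
    2 * ((1 - u\<^sup>2) / (\<theta> * (1 - s\<^sup>2)) * artanh u - artanh s)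
    - (1 - \<theta>\<^sup>2) / (2 * \<theta>) * (u / (1 - u\<^sup>2) - artanh u) * D\<^sup>2"
proof -
  have u: "\<bar>u\<bar> < 1"
  proof -
    have "\<bar>u\<bar> \<le> 1 * \<bar>s\<bar>" unfolding u_def abs_mult using \<theta> by (intro mult_right_mono) auto
    thus ?thesis using s by linarith
  qed
  have s2: "1 - s\<^sup>2 > 0" and u2: "1 - u\<^sup>2 > 0" using s u by (auto simp: abs_square_less_1)
  have eqs: "1 - 2 * \<rho> = \<theta>" "\<rho> * (1 - \<rho>) = (1 - \<theta>\<^sup>2) / 4" "p\<^sub>0 * p\<^sub>1 = (1 - s\<^sup>2) / 4" "p\<^sub>1 - p\<^sub>0 = s"
    "\<theta> * p\<^sub>1 + \<rho> = (1 + u) / 2" "\<theta> * p\<^sub>0 + \<rho> = (1 - u) / 2"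
    by (simp_all add: \<rho>_def p\<^sub>1_def p\<^sub>0_def u_def field_simps power2_eq_square)
  have eqs': "\<theta> * p\<^sub>1 * p\<^sub>0 = \<theta> * ((1 - s\<^sup>2) / 4)" "\<theta>\<^sup>2 * p\<^sub>1 * p\<^sub>0 = \<theta>\<^sup>2 * ((1 - s\<^sup>2) / 4)"
    "s * \<rho> * (1 - \<rho>) = s * ((1 - \<theta>\<^sup>2) / 4)"
    unfolding eqs(2,3)[symmetric] by (simp_all add: mult_ac)
  have ln: "ln (p\<^sub>1 / p\<^sub>0) = 2 * artanh s" "ln ((1 + u) / 2 / ((1 - u) / 2)) = 2 * artanh u"
  proof -
    have "a / 2 / (b / 2) = a / b" for a b :: real by simp
    thus "ln (p\<^sub>1 / p\<^sub>0) = 2 * artanh s" "ln ((1 + u) / 2 / ((1 - u) / 2)) = 2 * artanh u"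
      by (simp_all only: artanh_def p\<^sub>0_def p\<^sub>1_def)
  qed
  \<comment> \<open>Both sides are the product of the two noisy priors, \<open>(1 + u) / 2\<close>
    and \<open>(1 - u) / 2\<close>.\<close>
  have den: "\<theta>\<^sup>2 * ((1 - s\<^sup>2) / 4) + (1 - \<theta>\<^sup>2) / 4 = (1 - u\<^sup>2) / 4"
    by (simp add: u_def field_simps power2_eq_square)
  have c0: "lda_c0 p\<^sub>0 p\<^sub>1 \<rho> D =
     (\<theta> + (1 - \<theta>\<^sup>2) / 4 * (1 + (1 - s\<^sup>2) / 4 * D\<^sup>2) / (\<theta> * ((1 - s\<^sup>2) / 4))) * (2 * artanh u)
     - s * ((1 - \<theta>\<^sup>2) / 4) * D\<^sup>2 / (2 * ((1 - u\<^sup>2) / 4))"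
    unfolding lda_c0_def eqs eqs' ln den ..
  have a: "\<theta> + (1 - \<theta>\<^sup>2) / 4 * (1 + (1 - s\<^sup>2) / 4 * D\<^sup>2) / (\<theta> * ((1 - s\<^sup>2) / 4)) =
        (1 - u\<^sup>2) / (\<theta> * (1 - s\<^sup>2)) + (1 - \<theta>\<^sup>2) * D\<^sup>2 / (4 * \<theta>)"
  proof -
    have "\<theta> + (1 - \<theta>\<^sup>2) / 4 * (1 + t / 4 * d) / (\<theta> * (t / 4)) =
          (\<theta>\<^sup>2 * t + (1 - \<theta>\<^sup>2)) / (\<theta> * t) + (1 - \<theta>\<^sup>2) * d / (4 * \<theta>)" if "t > 0" for t d
      using that \<theta> by (simp add: field_simps power2_eq_square)
    moreover have "\<theta>\<^sup>2 * (1 - s\<^sup>2) + (1 - \<theta>\<^sup>2) = 1 - u\<^sup>2"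
      by (simp add: u_def algebra_simps power2_eq_square)
    ultimately show ?thesis using s2 by simp
  qed
  have b: "s * ((1 - \<theta>\<^sup>2) / 4) * D\<^sup>2 / (2 * ((1 - u\<^sup>2) / 4)) = (1 - \<theta>\<^sup>2) / (2 * \<theta>) * (u / (1 - u\<^sup>2)) * D\<^sup>2"
  proof -
    have "s * ((1 - \<theta>\<^sup>2) / 4) * D\<^sup>2 / (2 * (q / 4)) = (1 - \<theta>\<^sup>2) / (2 * \<theta>) * (u / q) * D\<^sup>2" if "q > 0" for q
      using that \<theta> by (simp add: u_def)
    thus ?thesis using u2 by blast
  qed
  show ?thesis unfolding c0 a b ln using \<theta> by (simp add: algebra_simps add_divide_distrib diff_divide_distrib)
qed

text \<open>For the first claim, compare the decreasing function
  \<open>(1 / x - x) * artanh x\<close> at \<open>\<theta> * s\<close> and at \<open>s\<close>, and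
  multiply by \<open>s / (1 - s\<^sup>2)\<close>, the reciprocal of
  \<open>1 / s - s\<close>.\<close>

lemma artanh_attenuated_pos:
  fixes s \<theta> :: real
  assumes "0 < s" "s < 1" "0 < \<theta>" "\<theta> < 1"
  shows "(1 - (\<theta> * s)\<^sup>2) / (\<theta> * (1 - s\<^sup>2)) * artanh (\<theta> * s) - artanh s > 0"
    and "\<theta> * s / (1 - (\<theta> * s)\<^sup>2) - artanh (\<theta> * s) > 0"
proof -
  have u: "0 < \<theta> * s" "\<theta> * s < s"
    using assms mult_strict_right_mono[of \<theta> 1 s] by auto
  have u1: "\<theta> * s < 1" using u(2) assms(2) by linarith
  have s2: "1 - s\<^sup>2 > 0" using assms by (simp add: abs_square_less_1)
  have "(1 / s - s) * artanh s < (1 / (\<theta> * s) - \<theta> * s) * artanh (\<theta> * s)"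
    by (rule artanh_weighted_decreasing[OF u(1,2) assms(2)])
  hence "(1 / s - s) * artanh s * (s / (1 - s\<^sup>2)) <
         (1 / (\<theta> * s) - \<theta> * s) * artanh (\<theta> * s) * (s / (1 - s\<^sup>2))"
    using assms s2 by (intro mult_strict_right_mono) auto
  moreover have "(1 / s - s) * (s / (1 - s\<^sup>2)) = 1"
    using assms s2 by (simp add: field_simps power2_eq_square)
  moreover have "(1 / (\<theta> * s) - \<theta> * s) * (s / (1 - s\<^sup>2)) = (1 - (\<theta> * s)\<^sup>2) / (\<theta> * (1 - s\<^sup>2))"
  proof -
    have "(1 / (\<theta> * s) - \<theta> * s) * s = (1 - (\<theta> * s)\<^sup>2) / \<theta>"
      using assms by (simp add: field_simps power2_eq_square)
    thus ?thesis by (simp add: divide_divide_eq_left)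
  qed
  ultimately show "(1 - (\<theta> * s)\<^sup>2) / (\<theta> * (1 - s\<^sup>2)) * artanh (\<theta> * s) - artanh s > 0"
    by (metis diff_gt_0_iff_gt mult.commute mult.left_commute mult_1)
  show "\<theta> * s / (1 - (\<theta> * s)\<^sup>2) - artanh (\<theta> * s) > 0"
    using artanh_less[OF u(1) u1] by simp
qed

text \<open>The equation is linear in \<open>D\<^sup>2\<close>: it says
  \<open>2 * F = k * G * D\<^sup>2\<close> with \<open>k > 0\<close>. Both \<open>F\<close> and
  \<open>G\<close> are odd in \<open>s\<close>, so the case of positive \<open>s\<close> shows that
  they share a sign whenever \<open>s\<close> is nonzero. The quotient \<open>d\<close> is therefore
  positive, and its square root is the only positive solution.\<close>

lemma lda_c0_eq_log_odds_unique:
  assumes r: "0 < r" "r < 1 / 2" and p: "0 < p\<^sub>1" "p\<^sub>1 < 1" "p\<^sub>1 = 1 - p\<^sub>0" "p\<^sub>0 \<noteq> p\<^sub>1"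
  shows "\<exists>!D. D > 0 \<and> lda_c0 p\<^sub>0 p\<^sub>1 r D = ln (p\<^sub>1 / p\<^sub>0)"
proof -
  define s where "s = p\<^sub>1 - p\<^sub>0"
  define \<theta> where "\<theta> = 1 - 2 * r"
  define F where "F = (1 - (\<theta> * s)\<^sup>2) / (\<theta> * (1 - s\<^sup>2)) * artanh (\<theta> * s) - artanh s"
  define G where "G = \<theta> * s / (1 - (\<theta> * s)\<^sup>2) - artanh (\<theta> * s)"
  define k where "k = (1 - \<theta>\<^sup>2) / (2 * \<theta>)"
  have \<theta>: "0 < \<theta>" "\<theta> < 1" and s: "\<bar>s\<bar> < 1" "s \<noteq> 0" using r p by (auto simp: \<theta>_def s_def)
  have sub: "r = (1 - \<theta>) / 2" "p\<^sub>1 = (1 + s) / 2" "p\<^sub>0 = (1 - s) / 2"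
    using p by (auto simp: \<theta>_def s_def)
  have c0: "lda_c0 p\<^sub>0 p\<^sub>1 r D - ln (p\<^sub>1 / p\<^sub>0) = 2 * F - k * G * D\<^sup>2" for D
    unfolding sub F_def G_def k_def using lda_c0_artanh[of s \<theta> D] \<theta> s by simp
  have k: "k > 0" using \<theta> by (simp add: k_def abs_square_less_1)
  have FG: "F > 0 \<and> G > 0 \<or> F < 0 \<and> G < 0"
  proof (cases "s > 0")
    case True
    thus ?thesis using artanh_attenuated_pos[of s \<theta>] \<theta> s by (auto simp: F_def G_def)
  next
    case False
    have ts: "\<bar>\<theta> * s\<bar> < 1"
      using mult_strict_mono'[of \<theta> 1 "\<bar>s\<bar>" 1] \<theta> s by (simp add: abs_mult)
    have "artanh (\<theta> * (- s)) = - artanh (\<theta> * s)" "artanh (- s) = - artanh s"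
      using artanh_minus_real[OF ts] artanh_minus_real[OF s(1)] by simp_all
    thus ?thesis using False artanh_attenuated_pos[of "- s" \<theta>] \<theta> s by (auto simp: F_def G_def)
  qed
  define d where "d = 2 * F / (k * G)"
  have d: "d > 0"
    unfolding d_def using FG k by (auto simp: zero_less_divide_iff mult_less_0_iff zero_less_mult_iff)
  have iff: "lda_c0 p\<^sub>0 p\<^sub>1 r D = ln (p\<^sub>1 / p\<^sub>0) \<longleftrightarrow> D\<^sup>2 = d" for D
  proof -
    have "k * G \<noteq> 0" using k FG by auto
    hence "2 * F - k * G * D\<^sup>2 = 0 \<longleftrightarrow> D\<^sup>2 = d" by (auto simp: d_def field_simps)
    thus ?thesis using c0[of D] by linarith
  qed
  show ?thesis
  proof (rule ex1I[of _ "sqrt d"])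
    show "sqrt d > 0 \<and> lda_c0 p\<^sub>0 p\<^sub>1 r (sqrt d) = ln (p\<^sub>1 / p\<^sub>0)" using d by (simp add: iff)
    show "D = sqrt d" if "D > 0 \<and> lda_c0 p\<^sub>0 p\<^sub>1 r D = ln (p\<^sub>1 / p\<^sub>0)" for D
      using that by (auto simp: iff)
  qed
qed

section \<open>A strong law of large numbers\<close>

context prob_space
begin

lemma integrable_power_le_power:
  fixes f :: "'a \<Rightarrow> real"
  assumes [measurable]: "f \<in> borel_measurable M" and "integrable M (\<lambda>x. f x ^ n)" and "m \<le> n" "even n"
  shows "integrable M (\<lambda>x. f x ^ m)"
proof (rule Bochner_Integration.integrable_bound)
  show "integrable M (\<lambda>x. 1 + f x ^ n)" using assms(2) by simp
  show "AE x in M. norm (f x ^ m) \<le> norm (1 + f x ^ n)"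
  proof (rule AE_I2)
    fix x
    have n: "f x ^ n = \<bar>f x\<bar> ^ n" using assms(4) by (simp add: power_even_abs)
    have "\<bar>f x\<bar> ^ m \<le> 1 + \<bar>f x\<bar> ^ n"
    proof (cases "\<bar>f x\<bar> \<le> 1")
      case True
      hence "\<bar>f x\<bar> ^ m \<le> 1" by (simp add: power_le_one)
      thus ?thesis by (simp add: add_increasing2)
    next
      case False
      hence "\<bar>f x\<bar> ^ m \<le> \<bar>f x\<bar> ^ n" using assms(3) by (intro power_increasing) auto
      thus ?thesis by simp
    qed
    thus "norm (f x ^ m) \<le> norm (1 + f x ^ n)"
      unfolding n by (simp add: power_abs)
  qed
qed measurable

text \<open>Applying \<open>(a + b)\<^sup>2 \<le> 2 * (a\<^sup>2 + b\<^sup>2)\<close> twice bounds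
  the fourth power of the sum by 8 times the sum of the fourth powers.\<close>

lemma integrable_add_power4:
  fixes f g :: "'a \<Rightarrow> real"
  assumes [measurable]: "f \<in> borel_measurable M" "g \<in> borel_measurable M"
    and "integrable M (\<lambda>x. f x ^ 4)" "integrable M (\<lambda>x. g x ^ 4)"
  shows "integrable M (\<lambda>x. (f x + g x) ^ 4)"
proof (rule Bochner_Integration.integrable_bound)
  show "integrable M (\<lambda>x. 8 * (f x ^ 4 + g x ^ 4))" using assms(3,4) by simp
  show "AE x in M. norm ((f x + g x) ^ 4) \<le> norm (8 * (f x ^ 4 + g x ^ 4))"
  proof (rule AE_I2)
    fix x
    have sq: "(a + b)\<^sup>2 \<le> 2 * (a\<^sup>2 + b\<^sup>2)" for a b :: real
      using sum_squares_bound[of a b] by (simp add: power2_sum)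
    have "((f x + g x)\<^sup>2)\<^sup>2 \<le> (2 * ((f x)\<^sup>2 + (g x)\<^sup>2))\<^sup>2" by (intro power_mono sq) simp
    also have "\<dots> = 4 * ((f x)\<^sup>2 + (g x)\<^sup>2)\<^sup>2" by (simp only: power_mult_distrib) simp
    also have "\<dots> \<le> 4 * (2 * (((f x)\<^sup>2)\<^sup>2 + ((g x)\<^sup>2)\<^sup>2))" by (intro mult_left_mono sq) simp
    finally show "norm ((f x + g x) ^ 4) \<le> norm (8 * (f x ^ 4 + g x ^ 4))"
      by (simp flip: power_mult)
  qed
qed measurable

text \<open>Adding the independent centred summand \<open>V\<close> to \<open>S\<close> and
  expanding the fourth power, the terms with a first power of \<open>V\<close> or of
  \<open>S\<close> have expectation zero. What is left besides the pure fourth powers is six times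
  the product of second moments, at most \<open>6 * K\<^sup>2 * n\<close>, so the fourth moment
  grows only quadratically. The induction carries integrability and the second-moment bound because
  the step consumes both.\<close>

lemma fourth_moment_sum_bound:
  fixes W :: "nat \<Rightarrow> 'a \<Rightarrow> real"
  assumes indep: "indep_vars (\<lambda>_. borel) W UNIV"
    and int: "\<And>i. integrable M (\<lambda>\<omega>. W i \<omega> ^ 4)"
    and mean: "\<And>i. expectation (W i) = 0"
    and bound: "\<And>i. expectation (\<lambda>\<omega>. W i \<omega> ^ 4) \<le> K"
    and bound2: "\<And>i. expectation (\<lambda>\<omega>. W i \<omega> ^ 2) \<le> K"
  shows "integrable M (\<lambda>\<omega>. (\<Sum>i=1..n. W i \<omega>) ^ 4) \<and>
         expectation (\<lambda>\<omega>. (\<Sum>i=1..n. W i \<omega>) ^ 2) \<le> K * n \<and>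
         expectation (\<lambda>\<omega>. (\<Sum>i=1..n. W i \<omega>) ^ 4) \<le> (6 * K\<^sup>2 + K) * (real n)\<^sup>2"
proof (induction n)
  case 0
  thus ?case by simp
next
  case (Suc n)
  define S where "S \<omega> = (\<Sum>i=1..n. W i \<omega>)" for \<omega>
  define V where "V = W (Suc n)"
  have rv [measurable]: "W i \<in> borel_measurable M" for i
    using indep by (auto simp: indep_vars_def2)
  have S [measurable]: "S \<in> borel_measurable M" unfolding S_def by measurable
  have V [measurable]: "V \<in> borel_measurable M" unfolding V_def by measurable
  have K: "K \<ge> 0" using bound2[of 0] by (smt (verit) Bochner_Integration.integral_nonneg zero_le_power2)
  have IS4: "integrable M (\<lambda>\<omega>. S \<omega> ^ 4)" and IV4: "integrable M (\<lambda>\<omega>. V \<omega> ^ 4)"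
    using Suc int by (simp_all add: S_def V_def)
  have ISk: "integrable M (\<lambda>\<omega>. S \<omega> ^ k)" and IVk: "integrable M (\<lambda>\<omega>. V \<omega> ^ k)" if "k \<le> 4" for k
    using that by (auto intro!: integrable_power_le_power[of _ 4] IS4 IV4)
  have IS: "integrable M S" and IV: "integrable M V" using ISk[of 1] IVk[of 1] by simp_all
  have ind: "indep_var borel V borel S"
    unfolding V_def S_def
    by (rule indep_vars_sum) (auto intro: indep_vars_subset[OF indep])
  have prod: "expectation (\<lambda>\<omega>. V \<omega> ^ j * S \<omega> ^ k) = expectation (\<lambda>\<omega>. V \<omega> ^ j) * expectation (\<lambda>\<omega>. S \<omega> ^ k)"
      "integrable M (\<lambda>\<omega>. V \<omega> ^ j * S \<omega> ^ k)" if "j \<le> 4" "k \<le> 4" for j k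
  proof -
    have "indep_var borel ((\<lambda>x. x ^ j) \<circ> V) borel ((\<lambda>x. x ^ k) \<circ> S)"
      by (rule indep_var_compose[OF ind]) auto
    hence i: "indep_var borel (\<lambda>\<omega>. V \<omega> ^ j) borel (\<lambda>\<omega>. S \<omega> ^ k)" by (simp add: o_def)
    show "expectation (\<lambda>\<omega>. V \<omega> ^ j * S \<omega> ^ k) = expectation (\<lambda>\<omega>. V \<omega> ^ j) * expectation (\<lambda>\<omega>. S \<omega> ^ k)"
      "integrable M (\<lambda>\<omega>. V \<omega> ^ j * S \<omega> ^ k)"
      using indep_var_lebesgue_integral[OF i] indep_var_integrable[OF i] that ISk IVk by auto
  qed
  have EV: "expectation V = 0" using mean by (simp add: V_def)
  have ES: "expectation S = 0"
    unfolding S_def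
  proof (subst Bochner_Integration.integral_sum)
    show "integrable M (W i)" for i
      using integrable_power_le_power[of "W i" 4 1] int[of i] by simp
  qed (simp add: mean)
  have eq: "(\<Sum>i=1..Suc n. W i \<omega>) = V \<omega> + S \<omega>" for \<omega> by (simp add: S_def V_def)
  have lin2: "expectation (\<lambda>\<omega>. f \<omega> + (g \<omega> + 2 * h \<omega>)) = expectation f + (expectation g + 2 * expectation h)"
    if "integrable M f" "integrable M g" "integrable M h" for f g h :: "'a \<Rightarrow> real"
    using that by simp
  have lin4: "expectation (\<lambda>\<omega>. f \<omega> + (g \<omega> + (4 * h \<omega> + (6 * h' \<omega> + 4 * h'' \<omega>)))) =
      expectation f + (expectation g + (4 * expectation h + (6 * expectation h' + 4 * expectation h'')))"
    if "integrable M f" "integrable M g" "integrable M h" "integrable M h'" "integrable M h''"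
    for f g h h' h'' :: "'a \<Rightarrow> real"
    using that by simp
  have "expectation (\<lambda>\<omega>. (V \<omega> + S \<omega>) ^ 2) = expectation (\<lambda>\<omega>. V \<omega> ^ 2 + (S \<omega> ^ 2 + 2 * (V \<omega> ^ 1 * S \<omega> ^ 1)))"
    by (simp add: power2_sum algebra_simps)
  also have "\<dots> = expectation (\<lambda>\<omega>. V \<omega> ^ 2) + (expectation (\<lambda>\<omega>. S \<omega> ^ 2) + 2 * expectation (\<lambda>\<omega>. V \<omega> ^ 1 * S \<omega> ^ 1))"
    by (rule lin2[OF IVk ISk prod(2)]; simp)
  also have "expectation (\<lambda>\<omega>. V \<omega> ^ 1 * S \<omega> ^ 1) = 0" by (subst prod(1)) (auto simp: EV)
  also have "expectation (\<lambda>\<omega>. V \<omega> ^ 2) + (expectation (\<lambda>\<omega>. S \<omega> ^ 2) + 2 * 0) \<le> K + K * n"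
    using Suc bound2[of "Suc n"] by (simp add: S_def V_def)
  finally have m2: "expectation (\<lambda>\<omega>. (V \<omega> + S \<omega>) ^ 2) \<le> K * Suc n" by (simp add: algebra_simps)
  have "expectation (\<lambda>\<omega>. (V \<omega> + S \<omega>) ^ 4) = expectation (\<lambda>\<omega>. V \<omega> ^ 4 + (S \<omega> ^ 4 + (4 * (V \<omega> ^ 1 * S \<omega> ^ 3) + 
        (6 * (V \<omega> ^ 2 * S \<omega> ^ 2) + 4 * (V \<omega> ^ 3 * S \<omega> ^ 1)))))"
    by (simp add: power4_eq_xxxx power2_eq_square power3_eq_cube algebra_simps)
  also have "\<dots> = expectation (\<lambda>\<omega>. V \<omega> ^ 4) + (expectation (\<lambda>\<omega>. S \<omega> ^ 4) + (4 * expectation (\<lambda>\<omega>. V \<omega> ^ 1 * S \<omega> ^ 3)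
      + (6 * expectation (\<lambda>\<omega>. V \<omega> ^ 2 * S \<omega> ^ 2) + 4 * expectation (\<lambda>\<omega>. V \<omega> ^ 3 * S \<omega> ^ 1))))"
    by (rule lin4[OF IVk ISk prod(2) prod(2) prod(2)]; simp)
  also have "expectation (\<lambda>\<omega>. V \<omega> ^ 1 * S \<omega> ^ 3) = 0" by (subst prod(1)) (auto simp: EV)
  also have "expectation (\<lambda>\<omega>. V \<omega> ^ 3 * S \<omega> ^ 1) = 0" by (subst prod(1)) (auto simp: ES)
  also have "expectation (\<lambda>\<omega>. V \<omega> ^ 2 * S \<omega> ^ 2) = expectation (\<lambda>\<omega>. V \<omega> ^ 2) * expectation (\<lambda>\<omega>. S \<omega> ^ 2)"
    by (subst prod(1)) auto
  also have "expectation (\<lambda>\<omega>. V \<omega> ^ 2) * expectation (\<lambda>\<omega>. S \<omega> ^ 2) \<le> K * (K * n)"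
    using Suc bound2[of "Suc n"] K by (intro mult_mono) (auto simp: S_def V_def)
  also have "expectation (\<lambda>\<omega>. V \<omega> ^ 4) \<le> K" using bound by (simp add: V_def)
  also have "expectation (\<lambda>\<omega>. S \<omega> ^ 4) \<le> (6 * K\<^sup>2 + K) * (real n)\<^sup>2" using Suc by (simp add: S_def)
  finally have "expectation (\<lambda>\<omega>. (V \<omega> + S \<omega>) ^ 4) \<le> K + ((6 * K\<^sup>2 + K) * (real n)\<^sup>2 + 6 * (K * (K * n)))"
    by simp
  also have "\<dots> \<le> (6 * K\<^sup>2 + K) * (real (Suc n))\<^sup>2"
  proof -
    have "(6 * K\<^sup>2 + K) * (real (Suc n))\<^sup>2 - (K + ((6 * K\<^sup>2 + K) * (real n)\<^sup>2 + 6 * (K * (K * n))))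
          = 6 * K\<^sup>2 * n + 6 * K\<^sup>2 + 2 * K * n"
      by (simp add: algebra_simps power2_eq_square)
    also have "\<dots> \<ge> 0" using K by auto
    finally show ?thesis by simp
  qed
  finally have m4: "expectation (\<lambda>\<omega>. (V \<omega> + S \<omega>) ^ 4) \<le> (6 * K\<^sup>2 + K) * (real (Suc n))\<^sup>2" .
  show ?case unfolding eq using m2 m4 integrable_add_power4[OF V S IV4 IS4] by blast
qed

text \<open>The fourth power \<open>T n\<close> of the centred average has expectation of order
  \<open>1 / n\<^sup>2\<close>, which is summable. Hence the sum of all \<open>T n\<close> is almost
  surely finite, and its terms tend to zero. The only demand on the variables beyond independence
  and a common mean is a uniform fourth-moment bound.\<close>

theorem strong_law_fourth_moment:
  fixes Z :: "nat \<Rightarrow> 'a \<Rightarrow> real"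
  assumes indep: "indep_vars (\<lambda>_. borel) Z UNIV"
    and int: "\<And>i. integrable M (\<lambda>\<omega>. Z i \<omega> ^ 4)"
    and mean: "\<And>i. expectation (Z i) = \<mu>"
    and bound: "\<And>i. expectation (\<lambda>\<omega>. (Z i \<omega> - \<mu>) ^ 4) \<le> K"
  shows "AE \<omega> in M. (\<lambda>n. (\<Sum>i=1..n. Z i \<omega>) / n) \<longlonglongrightarrow> \<mu>"
proof -
  define W where "W i \<omega> = Z i \<omega> - \<mu>" for i \<omega>
  have [measurable]: "Z i \<in> borel_measurable M" for i
    using indep by (auto simp: indep_vars_def2)
  have [measurable]: "W i \<in> borel_measurable M" for i unfolding W_def by measurable
  have W_indep: "indep_vars (\<lambda>_. borel) W UNIV"
    unfolding W_def by (rule indep_vars_compose2[OF indep]) auto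
  have W_int: "integrable M (\<lambda>\<omega>. W i \<omega> ^ 4)" for i
    unfolding W_def using integrable_add_power4[of "Z i" "\<lambda>_. - \<mu>"] int by simp
  have IZ: "integrable M (Z i)" for i
    using integrable_power_le_power[of "Z i" 4 1] int[of i] by simp
  have W_mean: "expectation (W i) = 0" for i
    unfolding W_def using IZ mean by (simp add: prob_space)
  have W_bound: "expectation (\<lambda>\<omega>. W i \<omega> ^ 4) \<le> 1 + K" for i using bound[of i] by (simp add: W_def)
  \<comment> \<open>One constant has to bound the second and the fourth moments. The pointwise
    estimate of the square by 1 plus the fourth power suggests \<open>1 + K\<close>.\<close>
  have W_bound2: "expectation (\<lambda>\<omega>. W i \<omega> ^ 2) \<le> 1 + K" for i
  proof -
    have "expectation (\<lambda>\<omega>. W i \<omega> ^ 2) \<le> expectation (\<lambda>\<omega>. 1 + W i \<omega> ^ 4)"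
    proof (rule integral_mono)
      show "integrable M (\<lambda>\<omega>. W i \<omega> ^ 2)" by (rule integrable_power_le_power[of _ 4]) (use W_int in auto)
      fix \<omega>
      have "2 * 1 * W i \<omega> ^ 2 \<le> 1\<^sup>2 + (W i \<omega> ^ 2)\<^sup>2" by (rule sum_squares_bound)
      also have "(W i \<omega> ^ 2)\<^sup>2 = W i \<omega> ^ 4" by (simp flip: power_mult)
      finally show "W i \<omega> ^ 2 \<le> 1 + W i \<omega> ^ 4"
        using zero_le_power2[of "W i \<omega>"] unfolding power_one by linarith
    qed (use W_int in auto)
    also have "\<dots> \<le> 1 + K" using bound[of i] W_int[of i] by (simp add: W_def prob_space)
    finally show ?thesis .
  qed
  define C where "C = 6 * (1 + K)\<^sup>2 + (1 + K)"
  define T where "T n \<omega> = ((\<Sum>i=1..n. W i \<omega>) / n) ^ 4" for n \<omega>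
  note M4 = fourth_moment_sum_bound[OF W_indep W_int W_mean W_bound W_bound2]
  have T_int: "integrable M (T n)" for n
    unfolding T_def power_divide using M4[of n] by auto
  have T_bound: "expectation (T n) \<le> C / (real n)\<^sup>2" for n
  proof (cases "n = 0")
    case False
    have "expectation (T n) = expectation (\<lambda>\<omega>. (\<Sum>i=1..n. W i \<omega>) ^ 4) / real n ^ 4"
      unfolding T_def power_divide by simp
    also have "\<dots> \<le> (C * (real n)\<^sup>2) / real n ^ 4"
      using M4[of n] by (intro divide_right_mono) (auto simp: C_def)
    also have "\<dots> = C / (real n)\<^sup>2" using False by (simp add: power4_eq_xxxx power2_eq_square)
    finally show ?thesis .
  next
    \<comment> \<open>Both sides are 0 because division by zero yields 0.\<close>
    case True
    hence "T n = (\<lambda>_. 0)" by (simp add: T_def fun_eq_iff)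
    thus ?thesis using True by simp
  qed
  have T_nonneg: "T n \<omega> \<ge> 0" for n \<omega> by (simp add: T_def)
  have [measurable]: "T n \<in> borel_measurable M" for n using T_int by auto
  have "(\<integral>\<^sup>+\<omega>. (\<Sum>n. ennreal (T n \<omega>)) \<partial>M) = (\<Sum>n. \<integral>\<^sup>+\<omega>. ennreal (T n \<omega>) \<partial>M)"
    by (rule nn_integral_suminf) simp
  also have "\<dots> = (\<Sum>n. ennreal (expectation (T n)))"
    by (intro suminf_cong nn_integral_eq_integral T_int) (simp add: T_nonneg)
  also have "\<dots> < \<infinity>"
  proof -
    have "summable (\<lambda>n. C / (real n)\<^sup>2)"
      using summable_mult[OF inverse_power_summable[of 2, where 'a=real], of C] by (simp add: divide_inverse)
    moreover have "norm (expectation (T n)) \<le> C / (real n)\<^sup>2" for n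
      using T_bound[of n] Bochner_Integration.integral_nonneg[of M "T n"] T_nonneg[of n] by simp
    ultimately have "summable (\<lambda>n. expectation (T n))"
      by (rule summable_comparison_test')
    moreover have "0 \<le> expectation (T n)" for n
      by (rule Bochner_Integration.integral_nonneg) (rule T_nonneg)
    ultimately have "(\<Sum>n. ennreal (expectation (T n))) = ennreal (\<Sum>n. expectation (T n))"
      by (intro suminf_ennreal2)
    thus ?thesis by (simp only: ennreal_less_top infinity_ennreal_def)
  qed
  finally have "AE \<omega> in M. (\<Sum>n. ennreal (T n \<omega>)) \<noteq> \<infinity>"
    by (intro nn_integral_PInf_AE) auto
  thus ?thesis
  proof eventually_elim
    case (elim \<omega>)
    have "summable (\<lambda>n. T n \<omega>)" using elim T_nonneg by (intro summable_suminf_not_top) auto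
    hence "(\<lambda>n. T n \<omega>) \<longlonglongrightarrow> 0" by (rule summable_LIMSEQ_zero)
    hence "(\<lambda>n. root 4 (T n \<omega>)) \<longlonglongrightarrow> root 4 0" by (intro tendsto_intros)
    moreover have "root 4 (T n \<omega>) = \<bar>(\<Sum>i=1..n. W i \<omega>) / n\<bar>" for n
      unfolding T_def by (subst power_even_abs[symmetric]) (simp_all add: real_root_power_cancel)
    ultimately have "(\<lambda>n. \<bar>(\<Sum>i=1..n. W i \<omega>) / n\<bar>) \<longlonglongrightarrow> 0" by (simp only: real_root_zero)
    hence "(\<lambda>n. (\<Sum>i=1..n. W i \<omega>) / n) \<longlonglongrightarrow> 0" by (rule tendsto_rabs_zero_cancel)
    hence "(\<lambda>n. (\<Sum>i=1..n. W i \<omega>) / n + \<mu>) \<longlonglongrightarrow> 0 + \<mu>" by (intro tendsto_intros)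
    moreover have "eventually (\<lambda>n. (\<Sum>i=1..n. W i \<omega>) / n + \<mu> = (\<Sum>i=1..n. Z i \<omega>) / n) sequentially"
      using eventually_gt_at_top[of 0]
      by eventually_elim (simp add: W_def sum_subtractf field_simps)
    ultimately have "(\<lambda>n. (\<Sum>i=1..n. Z i \<omega>) / n) \<longlonglongrightarrow> 0 + \<mu>" by (rule Lim_transform_eventually)
    thus ?case by simp
  qed
qed

end

section \<open>Linear functionals of Gaussian vectors\<close>

lemma matrix_inv_inverse:
  fixes A :: "'a::semiring_1^'n^'m"
  assumes "invertible A"
  shows "A ** matrix_inv A = mat 1" "matrix_inv A ** A = mat 1"
  using someI_ex[OF assms[unfolded invertible_def]] by (auto simp: matrix_inv_def)

lemma matrix_inv_unique:
  fixes A :: "'a::field^'n^'n"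
  assumes "A ** B = mat 1"
  shows "matrix_inv A = B"
proof -
  have "invertible A"
    using assms matrix_left_right_inverse invertible_def by blast
  thus ?thesis
    by (metis assms matrix_inv_inverse(2) matrix_mul_assoc matrix_mul_lid matrix_mul_rid)
qed

lemma pos_def_matrix_invertible:
  assumes "pos_def_matrix S"
  shows "invertible S"
proof -
  have "x = 0" if "S *v x = 0" for x
    using assms that unfolding pos_def_matrix_def by (metis inner_zero_right less_irrefl)
  thus ?thesis
    using matrix_left_invertible_ker[of S] matrix_left_right_inverse invertible_def by blast
qed

lemma pos_def_matrix_mult_inv:
  assumes "pos_def_matrix S"
  shows "S *v (matrix_inv S *v x) = x" "matrix_inv S *v (S *v x) = x"
  using matrix_inv_inverse[OF pos_def_matrix_invertible[OF assms]]
  by (simp_all add: matrix_vector_mul_assoc)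

lemma pos_def_matrix_sym:
  "pos_def_matrix S \<Longrightarrow> x \<bullet> (S *v y) = (S *v x) \<bullet> y"
  by (metis dot_lmul_matrix pos_def_matrix_def vector_transpose_matrix)

lemma pos_def_matrix_inv_sym:
  "pos_def_matrix S \<Longrightarrow> x \<bullet> (matrix_inv S *v y) = (matrix_inv S *v x) \<bullet> y"
  by (metis pos_def_matrix_mult_inv(1) pos_def_matrix_sym)

lemma pos_def_matrix_inv_pos:
  assumes "pos_def_matrix S" "x \<noteq> 0"
  shows "x \<bullet> (matrix_inv S *v x) > 0"
proof -
  let ?y = "matrix_inv S *v x"
  have "?y \<noteq> 0" using pos_def_matrix_mult_inv(1)[OF assms(1), of x] assms(2) by auto
  hence "?y \<bullet> (S *v ?y) > 0" using assms(1) by (simp add: pos_def_matrix_def)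
  thus ?thesis by (simp add: pos_def_matrix_mult_inv[OF assms(1)] inner_commute)
qed

text \<open>Gram--Schmidt for the inner product given by \<open>matrix_inv S\<close>, with
  prescribed first vector \<open>u\<close>. The family is indexed by the coordinate type itself, so
  that its members can serve as the columns of a square matrix. The induction adds one index at a
  time to a finite set avoiding \<open>j\<close>.\<close>

lemma gram_schmidt_family:
  fixes S :: "real^'d^'d"
  assumes S: "pos_def_matrix S" and u: "u \<bullet> (matrix_inv S *v u) = 1"
  shows "\<exists>f :: 'd \<Rightarrow> real^'d. f j = u \<and>
    (\<forall>i k. f i \<bullet> (matrix_inv S *v f k) = (if i = k then 1 else 0))"
proof -
  let ?P = "matrix_inv S"
  have "finite I \<Longrightarrow> j \<notin> I \<Longrightarrow> \<exists>f :: 'd \<Rightarrow> real^'d. f j = u \<and>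
    (\<forall>i \<in> insert j I. \<forall>k \<in> insert j I. f i \<bullet> (?P *v f k) = (if i = k then 1 else 0))" for I
  proof (induction I rule: finite_induct)
    case empty
    show ?case using u by (intro exI[of _ "\<lambda>_. u"]) auto
  next
    case (insert l I)
    have "\<exists>f :: 'd \<Rightarrow> real^'d. f j = u \<and>
      (\<forall>i \<in> insert j I. \<forall>k \<in> insert j I. f i \<bullet> (?P *v f k) = (if i = k then 1 else 0))"
      using insert by simp
    then obtain f :: "'d \<Rightarrow> real^'d" where f: "f j = u"
      "\<And>i k. i \<in> insert j I \<Longrightarrow> k \<in> insert j I \<Longrightarrow> f i \<bullet> (?P *v f k) = (if i = k then 1 else 0)"
      by blast
    let ?J = "insert j I"
    have lJ: "l \<notin> ?J" "finite ?J" using insert by auto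
    \<comment> \<open>Since \<open>l\<close> is not yet used, there are fewer vectors than
      coordinates, so some \<open>w\<close> lies outside their span and its orthogonal remainder
      \<open>v\<close> is nonzero.\<close>
    have "dim (f ` ?J) \<le> card (f ` ?J)" by (rule dim_le_card') (use lJ in simp)
    also have "\<dots> \<le> card ?J" by (rule card_image_le) (use lJ in simp)
    also have "\<dots> < card (UNIV :: 'd set)" using lJ by (intro psubset_card_mono) auto
    finally have "dim (f ` ?J) < DIM(real^'d)" by simp
    hence "span (f ` ?J) \<noteq> UNIV" by (metis dim_UNIV dim_span less_irrefl)
    then obtain w where w: "w \<notin> span (f ` ?J)" by blast
    define v where "v = w - (\<Sum>i\<in>?J. (f i \<bullet> (?P *v w)) *\<^sub>R f i)"
    have "(\<Sum>i\<in>?J. (f i \<bullet> (?P *v w)) *\<^sub>R f i) \<in> span (f ` ?J)"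
      by (intro span_sum span_scale span_base) auto
    hence "v \<noteq> 0" using w by (auto simp: v_def)
    hence vpos: "v \<bullet> (?P *v v) > 0" by (rule pos_def_matrix_inv_pos[OF S])
    have orth: "f i \<bullet> (?P *v v) = 0" if "i \<in> ?J" for i
    proof -
      have "f i \<bullet> (?P *v v) = f i \<bullet> (?P *v w) - (\<Sum>k\<in>?J. (f k \<bullet> (?P *v w)) * (f i \<bullet> (?P *v f k)))"
        unfolding v_def matrix_vector_mult_diff_distrib inner_diff_right
        by (simp only: linear_sum[OF matrix_vector_mul_linear] inner_sum_right
            matrix_vector_mult_scaleR inner_scaleR_right)
      also have "(\<Sum>k\<in>?J. (f k \<bullet> (?P *v w)) * (f i \<bullet> (?P *v f k))) =
                 (\<Sum>k\<in>?J. if k = i then f i \<bullet> (?P *v w) else 0)"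
        by (rule sum.cong[OF refl]) (use f(2) that in auto)
      also have "\<dots> = f i \<bullet> (?P *v w)" using that lJ by (simp add: sum.delta)
      finally show ?thesis by simp
    qed
    hence orth': "v \<bullet> (?P *v f i) = 0" if "i \<in> ?J" for i
      using orth[OF that] pos_def_matrix_inv_sym[OF S, of v "f i"] by (metis inner_commute)
    define g where "g = f(l := (1 / sqrt (v \<bullet> (?P *v v))) *\<^sub>R v)"
    have gl: "g l = (1 / sqrt (v \<bullet> (?P *v v))) *\<^sub>R v" by (simp add: g_def)
    have gi: "g i = f i" if "i \<in> ?J" for i using that lJ by (auto simp: g_def)
    have ll: "g l \<bullet> (?P *v g l) = 1"
      unfolding gl using vpos by (simp add: matrix_vector_mult_scaleR)
    show ?case
    proof (intro exI[of _ g] conjI ballI)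
      show "g j = u" using gi f(1) by simp
      fix i k assume ik: "i \<in> insert j (insert l I)" "k \<in> insert j (insert l I)"
      consider "i = l" "k = l" | "i = l" "k \<in> ?J" | "i \<in> ?J" "k = l" | "i \<in> ?J" "k \<in> ?J"
        using ik by auto
      thus "g i \<bullet> (?P *v g k) = (if i = k then 1 else 0)"
      proof cases
        case 2
        thus ?thesis using lJ by (auto simp: gl gi orth' simp del: insert_iff)
      next
        case 3
        thus ?thesis using lJ by (auto simp: gl gi orth matrix_vector_mult_scaleR simp del: insert_iff)
      next
        case 4
        thus ?thesis using f(2) by (simp add: gi)
      qed (use ll in simp)
    qed
  qed
  from this[of "UNIV - {j}"] show ?thesis by (auto simp: insert_UNIV)
qed

text \<open>The substitution \<open>x = m + A *v z\<close> is to turn the quadratic form of the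
  Gaussian density into \<open>z \<bullet> z\<close> and the functional \<open>v\<close> into a
  multiple of one coordinate. Columns orthonormal for \<open>matrix_inv S\<close> achieve the first,
  and a suitable choice of column \<open>j\<close> the second. Taking determinants in
  \<open>transpose A ** (matrix_inv S ** A) = mat 1\<close> gives the last claim.\<close>

lemma gaussian_coordinates:
  fixes S :: "real^'d^'d" and v :: "real^'d" and j :: 'd
  assumes S: "pos_def_matrix S" and v: "v \<noteq> 0"
  obtains A :: "real^'d^'d" where
    "invertible A" "\<And>z. (A *v z) \<bullet> (matrix_inv S *v (A *v z)) = z \<bullet> z"
    "\<And>z. v \<bullet> (A *v z) = sqrt (v \<bullet> (S *v v)) * z $ j" "\<bar>det A\<bar> = sqrt (det S)"
proof -
  let ?P = "matrix_inv S"
  define c where "c = sqrt (v \<bullet> (S *v v))"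
  have c: "c > 0" "c\<^sup>2 = v \<bullet> (S *v v)" using S v by (auto simp: c_def pos_def_matrix_def less_imp_le)
  \<comment> \<open>With this \<open>u\<close>, orthogonality to \<open>u\<close> with respect to
    \<open>matrix_inv S\<close> is Euclidean orthogonality to \<open>v\<close>. The factor
    \<open>1 / c\<close> makes \<open>u\<close> a unit vector; \<open>c\<close> will be the standard
    deviation of the marginal.\<close>
  define u where "u = (1 / c) *\<^sub>R (S *v v)"
  have "u \<bullet> (?P *v u) = 1"
    using c(1) by (simp add: u_def matrix_vector_mult_scaleR pos_def_matrix_mult_inv[OF S]
        inner_commute[of "S *v v"] c(2)[symmetric] power2_eq_square)
  then obtain f :: "'d \<Rightarrow> real^'d" where f: "f j = u"
    "\<And>i k. f i \<bullet> (?P *v f k) = (if i = k then 1 else 0)"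
    using gram_schmidt_family[OF S] by blast
  define A where "A = (\<chi> a b. f b $ a)"
  have col: "column b A = f b" for b by (simp add: A_def column_def vec_eq_iff)
  have Az: "A *v z = (\<Sum>b\<in>UNIV. z $ b *\<^sub>R f b)" for z
    by (simp add: matrix_mult_sum col scalar_mult_eq_scaleR)
  have PA: "transpose A ** (?P ** A) = mat 1"
  proof (simp add: vec_eq_iff, intro allI)
    fix i k
    have "(transpose A ** (?P ** A)) $ i $ k = f i \<bullet> (?P *v f k)"
      by (simp add: matrix_matrix_mult_def transpose_def A_def inner_vec_def matrix_vector_mult_def)
    thus "(transpose A ** (?P ** A)) $ i $ k = (mat 1 :: real^'d^'d) $ i $ k" by (simp add: f(2) mat_def)
  qed
  have SP: "S ** ?P = mat 1" by (rule matrix_inv_inverse[OF pos_def_matrix_invertible[OF S]])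
  have "det A * (det ?P * det A) = 1" using arg_cong[OF PA, of det] by (simp add: det_mul det_transpose)
  moreover have "det S * det ?P = 1" using arg_cong[OF SP, of det] by (simp add: det_mul)
  ultimately have "(det A)\<^sup>2 = det S"
    by (metis (no_types, opaque_lifting) mult.assoc mult.commute mult.right_neutral power2_eq_square)
  hence det: "\<bar>det A\<bar> = sqrt (det S)" by (metis real_sqrt_abs)
  have inv: "invertible A"
    unfolding invertible_def
    by (metis PA matrix_left_right_inverse matrix_mul_assoc)
  have "(A *v z) \<bullet> (?P *v (A *v z)) = z \<bullet> z" for z
  proof -
    have "(A *v z) \<bullet> (?P *v (A *v z)) = z \<bullet> ((transpose A ** (?P ** A)) *v z)"
      unfolding matrix_vector_mul_assoc[symmetric] by (metis dot_lmul_matrix vector_transpose_matrix)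
    thus ?thesis by (simp add: PA)
  qed
  moreover have "v \<bullet> (A *v z) = sqrt (v \<bullet> (S *v v)) * z $ j" for z
  proof -
    have Pu: "v = c *\<^sub>R (?P *v u)"
      using c by (simp add: u_def matrix_vector_mult_scaleR pos_def_matrix_mult_inv[OF S])
    have vf: "v \<bullet> f b = (if b = j then c else 0)" for b
    proof -
      have "v \<bullet> f b = c * (f b \<bullet> (?P *v f j))"
        using Pu f(1) by (metis inner_commute inner_scaleR_right)
      thus ?thesis by (simp add: f(2))
    qed
    show ?thesis
      unfolding Az inner_sum_right inner_scaleR_right vf c_def[symmetric] by (simp add: if_distrib cong: if_cong)
  qed
  ultimately show ?thesis using that inv det by blast
qed

section \<open>Lebesgue measure under affine maps and Gaussian marginals\<close>

lemma borel_measurable_matrix_vector_mult [measurable (raw)]: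
  fixes A :: "real^'n^'m"
  assumes "f \<in> borel_measurable M"
  shows "(\<lambda>x. A *v f x) \<in> borel_measurable M"
proof -
  have "(\<lambda>x. A *v x) \<in> borel_measurable borel"
    by (intro borel_measurable_continuous_onI continuous_intros)
  thus ?thesis using assms by measurable
qed

lemma nn_integral_lborel_translate:
  fixes f :: "'a::euclidean_space \<Rightarrow> ennreal"
  assumes [measurable]: "f \<in> borel_measurable borel"
  shows "(\<integral>\<^sup>+x. f (t + x) \<partial>lborel) = (\<integral>\<^sup>+x. f x \<partial>lborel)"
  by (subst (2) lborel_distr_plus[symmetric, of t]) (simp add: nn_integral_distr)

text \<open>Uniqueness of Haar measure, specialised to the image of Lebesgue measure under a linear map.
  The determinant formula of \<open>HOL-Analysis\<close> is not applicable since it needs a well-ordered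
  index type; the value of the constant is later forced by the normalisation of a density.\<close>

lemma nn_integral_lborel_linear:
  fixes A :: "real^'d^'d"
  assumes "invertible A"
  obtains k where "\<And>f. f \<in> borel_measurable borel \<Longrightarrow>
    (\<integral>\<^sup>+z. f (A *v z) \<partial>lborel) = k * (\<integral>\<^sup>+x. f x \<partial>lborel)"
proof -
  \<comment> \<open>A probe of total integral 1. Inserting it as a factor, translating and
    exchanging the integrals removes \<open>A\<close> from the argument of \<open>f\<close>; the
    remaining factor, the integral of \<open>g (- (A *v z))\<close>, is the constant.\<close>
  define g :: "real^'d \<Rightarrow> ennreal" where "g = indicator (box 0 One)"
  have [measurable]: "g \<in> borel_measurable borel" unfolding g_def by measurable
  have g: "(\<integral>\<^sup>+y. g y \<partial>lborel) = 1"
    by (simp add: g_def emeasure_lborel_box_eq)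
  have AB: "A *v (matrix_inv A *v y) = y" for y
    by (simp add: matrix_vector_mul_assoc matrix_inv_inverse[OF assms])
  have shift: "(\<integral>\<^sup>+z. h (A *v z) \<partial>lborel) = (\<integral>\<^sup>+z. h (y + A *v z) \<partial>lborel)"
    if [measurable]: "h \<in> borel_measurable borel" for h :: "real^'d \<Rightarrow> ennreal" and y
    by (subst nn_integral_lborel_translate[of _ "matrix_inv A *v y", symmetric])
       (simp_all add: matrix_vector_right_distrib AB)
  have "(\<integral>\<^sup>+z. f (A *v z) \<partial>lborel) = (\<integral>\<^sup>+z. g (- (A *v z)) \<partial>lborel) * (\<integral>\<^sup>+x. f x \<partial>lborel)"
    if f [measurable]: "f \<in> borel_measurable borel" for f :: "real^'d \<Rightarrow> ennreal"
  proof -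
    have "(\<integral>\<^sup>+z. f (A *v z) \<partial>lborel) = (\<integral>\<^sup>+y. (\<integral>\<^sup>+z. f (A *v z) \<partial>lborel) * g y \<partial>lborel)"
      by (simp add: nn_integral_cmult g)
    also have "\<dots> = (\<integral>\<^sup>+y. (\<integral>\<^sup>+z. f (y + A *v z) * g y \<partial>lborel) \<partial>lborel)"
    proof (rule nn_integral_cong)
      fix y
      show "(\<integral>\<^sup>+z. f (A *v z) \<partial>lborel) * g y = (\<integral>\<^sup>+z. f (y + A *v z) * g y \<partial>lborel)"
        by (subst shift[OF f, of y]) (simp add: nn_integral_multc)
    qed
    also have "\<dots> = (\<integral>\<^sup>+z. (\<integral>\<^sup>+y. f (y + A *v z) * g y \<partial>lborel) \<partial>lborel)"
      by (rule lborel_pair.Fubini') measurable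
    also have "\<dots> = (\<integral>\<^sup>+z. (\<integral>\<^sup>+y. f y * g (y - A *v z) \<partial>lborel) \<partial>lborel)"
    proof (rule nn_integral_cong)
      fix z
      show "(\<integral>\<^sup>+y. f (y + A *v z) * g y \<partial>lborel) = (\<integral>\<^sup>+y. f y * g (y - A *v z) \<partial>lborel)"
        by (subst (2) nn_integral_lborel_translate[of _ "A *v z", symmetric]) (simp_all add: add.commute)
    qed
    also have "\<dots> = (\<integral>\<^sup>+y. (\<integral>\<^sup>+z. f y * g (y - A *v z) \<partial>lborel) \<partial>lborel)"
      by (rule lborel_pair.Fubini') measurable
    also have "\<dots> = (\<integral>\<^sup>+y. f y * (\<integral>\<^sup>+z. g (- (A *v z)) \<partial>lborel) \<partial>lborel)"
    proof (rule nn_integral_cong)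
      fix y
      show "(\<integral>\<^sup>+z. f y * g (y - A *v z) \<partial>lborel) = f y * (\<integral>\<^sup>+z. g (- (A *v z)) \<partial>lborel)"
        by (subst shift[of "\<lambda>x. g (- x)" "- y"]) (simp_all add: nn_integral_cmult)
    qed
    finally show ?thesis by (simp add: nn_integral_multc mult.commute)
  qed
  thus ?thesis by (rule that)
qed

lemma borel_measurable_mvn_density [measurable]: "mvn_density m S \<in> borel_measurable borel"
  unfolding mvn_density_def [abs_def] by measurable

text \<open>In adapted coordinates the density is a product of standard normal densities and
  \<open>v\<close> sees only coordinate \<open>j\<close>. All other coordinates integrate to 1, and
  the remaining one is rescaled by \<open>c\<close> and shifted by
  \<open>v \<bullet> m\<close>.\<close>

lemma mvn_linear_functional:
  fixes S :: "real^'d^'d"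
  assumes S: "pos_def_matrix S" and v: "v \<noteq> 0"
    and total: "(\<integral>\<^sup>+x. ennreal (mvn_density m S x) \<partial>lborel) = 1"
  shows "distr (density lborel (\<lambda>x. ennreal (mvn_density m S x))) borel (\<lambda>x. v \<bullet> x) =
         density lborel (\<lambda>t. ennreal (normal_density (v \<bullet> m) (sqrt (v \<bullet> (S *v v))) t))"
    (is "?L = ?R")
proof (rule measure_eqI)
  fix B assume "B \<in> sets ?L"
  hence B [measurable]: "B \<in> sets borel" by simp
  fix j :: 'd
  define c where "c = sqrt (v \<bullet> (S *v v))"
  obtain A :: "real^'d^'d" where A: "invertible A" 
    "\<And>z. (A *v z) \<bullet> (matrix_inv S *v (A *v z)) = z \<bullet> z"
    "\<And>z. v \<bullet> (A *v z) = c * z $ j" "\<bar>det A\<bar> = sqrt (det S)"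
    using gaussian_coordinates[OF S v, of j] unfolding c_def by metis
  have c: "c > 0" using S v by (auto simp: c_def pos_def_matrix_def)
  have "det A \<noteq> 0" using A(1) by (simp add: invertible_det_nz)
  hence detS: "sqrt (det S) > 0" unfolding A(4)[symmetric] by simp
  define C where "C = 1 / sqrt (det S)"
  have C: "C > 0" using detS by (simp add: C_def)
  have dens: "mvn_density m S (m + A *v z) = C * (\<Prod>b\<in>Basis. std_normal_density (z \<bullet> b))" for z
  proof -
    have "mvn_density m S (m + A *v z) = C * (exp (- (z \<bullet> z) / 2) / sqrt ((2 * pi) ^ CARD('d)))"
      unfolding mvn_density_def C_def real_sqrt_mult using A(2) by simp
    also have "exp (- (z \<bullet> z) / 2) / sqrt ((2 * pi) ^ CARD('d)) =
        (\<Prod>b\<in>Basis. (1 / sqrt (2 * pi)) * exp (- (z \<bullet> b)\<^sup>2 / 2) :: real)"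
    proof -
      have "z \<bullet> z = (\<Sum>b\<in>Basis. (z \<bullet> b)\<^sup>2)"
        by (subst euclidean_inner) (simp add: power2_eq_square)
      hence "exp (- (z \<bullet> z) / 2) = (\<Prod>b\<in>Basis. exp (- (z \<bullet> b)\<^sup>2 / 2))"
        by (subst exp_sum[symmetric]) (simp_all add: sum_negf sum_divide_distrib)
      thus ?thesis
        unfolding real_sqrt_power by (simp add: prod_dividef)
    qed
    finally show ?thesis by (simp add: std_normal_density_def)
  qed
  \<comment> \<open>The event concerns one coordinate only, so its indicator can be attached to the
    factor of \<open>axis j 1\<close>; the whole integrand stays a product over the basis.\<close>
  define h where "h b = (\<lambda>t. ennreal (std_normal_density t) *
      (if b = axis j 1 then indicator B (v \<bullet> m + c * t) else 1))" for b :: "real^'d"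
  have [measurable]: "h b \<in> borel_measurable borel" for b unfolding h_def by measurable
  have ax: "axis j (1::real) \<in> Basis" by (simp add: axis_in_Basis_iff)
  have one: "(\<integral>\<^sup>+t. ennreal (std_normal_density t) \<partial>lborel) = 1"
    by (subst nn_integral_eq_integral) auto
  obtain k where k: "\<And>f. f \<in> borel_measurable borel \<Longrightarrow>
    (\<integral>\<^sup>+z. f (A *v z) \<partial>lborel) = k * (\<integral>\<^sup>+x. f x \<partial>lborel)"
    using nn_integral_lborel_linear[OF A(1)] by blast
  have change: "(\<integral>\<^sup>+z. f (m + A *v z) \<partial>lborel) = k * (\<integral>\<^sup>+x. f x \<partial>lborel)"
    if [measurable]: "f \<in> borel_measurable borel" for f :: "real^'d \<Rightarrow> ennreal"
    using k[of "\<lambda>x. f (m + x)"] by (simp add: nn_integral_lborel_translate)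
  \<comment> \<open>Testing the change of variables on the density itself determines
    \<open>k\<close>: one side is normalised by \<open>total\<close>, the other factorises into
    standard normal integrals and equals \<open>C\<close>.\<close>
  have "k = (\<integral>\<^sup>+z. ennreal (mvn_density m S (m + A *v z)) \<partial>lborel)"
    by (subst change) (simp_all add: total)
  also have "\<dots> = ennreal C * (\<integral>\<^sup>+z. (\<Prod>b\<in>Basis. ennreal (std_normal_density (z \<bullet> b))) \<partial>(lborel :: (real^'d) measure))"
    using C by (simp add: dens ennreal_mult prod_nonneg prod_ennreal nn_integral_cmult)
  also have "(\<integral>\<^sup>+z. (\<Prod>b\<in>Basis. ennreal (std_normal_density (z \<bullet> b))) \<partial>(lborel :: (real^'d) measure)) = 1"
    by (subst nn_integral_lborel_prod) (simp_all add: one)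
  finally have k': "k = ennreal C" by simp
  have "ennreal C * emeasure ?L B = k * (\<integral>\<^sup>+x. ennreal (mvn_density m S x) * indicator B (v \<bullet> x) \<partial>lborel)"
  proof -
    have "(\<lambda>x. v \<bullet> x) -` B \<in> sets borel"
      using measurable_sets[of "\<lambda>x. v \<bullet> x" borel borel B] by simp
    hence "emeasure ?L B = (\<integral>\<^sup>+x. ennreal (mvn_density m S x) * indicator ((\<lambda>x. v \<bullet> x) -` B) x \<partial>lborel)"
      by (subst emeasure_distr) (auto simp: emeasure_density)
    thus ?thesis by (simp add: k' indicator_def)
  qed
  also have "\<dots> = (\<integral>\<^sup>+z. ennreal (mvn_density m S (m + A *v z)) * indicator B (v \<bullet> (m + A *v z)) \<partial>lborel)"
    by (rule change[symmetric]) measurable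
  also have "\<dots> = (\<integral>\<^sup>+z. ennreal C * (\<Prod>b\<in>Basis. h b (z \<bullet> b)) \<partial>lborel)"
  proof (rule nn_integral_cong)
    fix z :: "real^'d"
    have "(\<Prod>b\<in>Basis. h b (z \<bullet> b)) = (\<Prod>b\<in>Basis. ennreal (std_normal_density (z \<bullet> b))) * indicator B (v \<bullet> m + c * z $ j)"
      unfolding h_def prod.distrib using ax by (simp add: prod.delta cart_eq_inner_axis)
    hence "ennreal C * (\<Prod>b\<in>Basis. h b (z \<bullet> b)) =
        ennreal (mvn_density m S (m + A *v z)) * indicator B (v \<bullet> m + c * z $ j)"
      using C by (simp add: dens ennreal_mult prod_nonneg prod_ennreal mult.assoc)
    thus "ennreal (mvn_density m S (m + A *v z)) * indicator B (v \<bullet> (m + A *v z)) =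
        ennreal C * (\<Prod>b\<in>Basis. h b (z \<bullet> b))"
      by (simp add: inner_add_right A(3))
  qed
  also have "\<dots> = ennreal C * (\<integral>\<^sup>+z. (\<Prod>b\<in>Basis. h b (z \<bullet> b)) \<partial>lborel)"
    by (rule nn_integral_cmult) measurable
  finally have "emeasure ?L B = (\<integral>\<^sup>+z. (\<Prod>b\<in>Basis. h b (z \<bullet> b)) \<partial>lborel)"
    using C by (simp add: ennreal_mult_cancel_left)
  also have "\<dots> = (\<Prod>b\<in>Basis. \<integral>\<^sup>+t. h b t \<partial>lborel)"
    by (rule nn_integral_lborel_prod) auto
  also have "\<dots> = (\<Prod>b\<in>Basis. if b = axis j 1 then \<integral>\<^sup>+t. h b t \<partial>lborel else 1)"
    by (rule prod.cong) (auto simp: h_def one)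
  also have "\<dots> = (\<integral>\<^sup>+t. ennreal (std_normal_density t) * indicator B (v \<bullet> m + c * t) \<partial>lborel)"
    using ax by (simp add: prod.delta h_def)
  also have "\<dots> = (\<integral>\<^sup>+t. ennreal c * (ennreal (normal_density (v \<bullet> m) c (v \<bullet> m + c * t)) * indicator B (v \<bullet> m + c * t)) \<partial>lborel)"
  proof (rule nn_integral_cong)
    fix t
    have "std_normal_density t = c * normal_density (v \<bullet> m) c (v \<bullet> m + c * t)"
      using c by (simp add: normal_density_def real_sqrt_mult power_mult_distrib)
    thus "ennreal (std_normal_density t) * indicator B (v \<bullet> m + c * t) =
      ennreal c * (ennreal (normal_density (v \<bullet> m) c (v \<bullet> m + c * t)) * indicator B (v \<bullet> m + c * t))"
      using c by (simp add: ennreal_mult' mult.assoc)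
  qed
  also have "\<dots> = (\<integral>\<^sup>+t. ennreal (normal_density (v \<bullet> m) c t) * indicator B t \<partial>lborel)"
    using c by (subst (2) nn_integral_real_affine[of _ c "v \<bullet> m"]) (auto simp: nn_integral_cmult)
  also have "\<dots> = emeasure ?R B"
    by (simp add: emeasure_density c_def)
  finally show "emeasure ?L B = emeasure ?R B" .
qed simp

section \<open>Deterministic limit of the LDA score\<close>

definition lda_score :: "(nat \<Rightarrow> real^'d) \<Rightarrow> (nat \<Rightarrow> nat) \<Rightarrow> nat \<Rightarrow> real^'d \<Rightarrow> real" where
  "lda_score xs ys n x = ln (lda_prior ys n 1 / lda_prior ys n 0)
         + (x - (lda_mean xs ys n 1 + lda_mean xs ys n 0) /\<^sub>R 2)
             \<bullet> (matrix_inv (lda_cov xs ys n) *v (lda_mean xs ys n 1 - lda_mean xs ys n 0))"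

lemma lda_classifier_score: "lda_classifier xs ys n x = (if lda_score xs ys n x \<ge> 0 then 1 else 0)"
  by (simp add: lda_classifier_def lda_score_def)

text \<open>Cramer's rule makes the solution a rational function of the entries of \<open>A\<close>
  and \<open>b\<close>. It is the source of both the continuity and the measurability of
  inversion.\<close>

lemma matrix_inv_mult_vec_cramer:
  fixes A :: "'a::field^'n^'n"
  assumes "det A \<noteq> 0"
  shows "matrix_inv A *v b = (\<chi> k. det (\<chi> i j. if j = k then b $ i else A $ i $ j) / det A)"
proof -
  have "A *v (matrix_inv A *v b) = b"
    using assms by (simp add: matrix_vector_mul_assoc matrix_inv_inverse invertible_det_nz)
  thus ?thesis using cramer[OF assms] by blast
qed

lemma tendsto_det:
  fixes A :: "'b \<Rightarrow> real^'n^'n"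
  assumes "(A \<longlongrightarrow> B) F"
  shows "((\<lambda>n. det (A n)) \<longlongrightarrow> det B) F"
  unfolding det_def by (intro tendsto_intros tendsto_vec_nth assms)

text \<open>Some of the \<open>A n\<close> may be singular, but their determinants converge to a
  nonzero limit. Cramer's rule is therefore valid eventually, and its right-hand side is continuous
  at the limit.\<close>

lemma tendsto_matrix_inv_mult_vec:
  fixes A :: "'b \<Rightarrow> real^'n^'n"
  assumes A: "(A \<longlongrightarrow> B) F" and v: "(v \<longlongrightarrow> w) F" and B: "det B \<noteq> 0"
  shows "((\<lambda>n. matrix_inv (A n) *v v n) \<longlongrightarrow> matrix_inv B *v w) F"
proof -
  let ?c = "\<lambda>A b. \<chi> k. det (\<chi> i j. if j = k then b $ i else A $ i $ j) / det A"
  have "((\<lambda>n. ?c (A n) (v n)) \<longlongrightarrow> ?c B w) F"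
  proof (intro tendsto_vec_lambda tendsto_divide tendsto_det A B)
    fix i j k
    show "((\<lambda>n. if j = k then v n $ i else A n $ i $ j) \<longlongrightarrow> (if j = k then w $ i else B $ i $ j)) F"
      using tendsto_vec_nth[OF v] tendsto_vec_nth[OF tendsto_vec_nth[OF A]] by auto
  qed
  moreover have "eventually (\<lambda>n. det (A n) \<noteq> 0) F"
    by (rule tendsto_imp_eventually_ne[OF tendsto_det[OF A] B])
  hence "eventually (\<lambda>n. ?c (A n) (v n) = matrix_inv (A n) *v v n) F"
    by eventually_elim (rule matrix_inv_mult_vec_cramer[symmetric])
  ultimately have "((\<lambda>n. matrix_inv (A n) *v v n) \<longlongrightarrow> ?c B w) F"
    by (rule Lim_transform_eventually)
  thus ?thesis by (simp only: matrix_inv_mult_vec_cramer[OF B])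
qed

lemma pos_def_matrix_add_outer_square:
  assumes S: "pos_def_matrix S" and k: "k \<ge> 0"
  shows "pos_def_matrix (S + k *\<^sub>R outer_square v)"
proof -
  have mult: "(S + k *\<^sub>R outer_square v) *v x = S *v x + (k * (v \<bullet> x)) *\<^sub>R v" for x
    by (simp add: vec_eq_iff matrix_vector_mult_def outer_square_def inner_vec_def sum_distrib_left
        sum.distrib algebra_simps)
  have sym: "S $ i $ j = S $ j $ i" for i j
    using S unfolding pos_def_matrix_def by (metis transpose_def vec_lambda_beta)
  show ?thesis
    unfolding pos_def_matrix_def
  proof (intro conjI allI impI)
    show "transpose (S + k *\<^sub>R outer_square v) = S + k *\<^sub>R outer_square v"
      by (simp add: vec_eq_iff transpose_def outer_square_def sym mult.commute)
    fix x :: "real^'a" assume "x \<noteq> 0"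
    hence "x \<bullet> (S *v x) > 0" using S by (simp add: pos_def_matrix_def)
    moreover have "x \<bullet> ((k * (v \<bullet> x)) *\<^sub>R v) = k * (v \<bullet> x)\<^sup>2"
      by (simp add: power2_eq_square inner_commute)
    moreover have "k * (v \<bullet> x)\<^sup>2 \<ge> 0" using k by simp
    ultimately show "x \<bullet> ((S + k *\<^sub>R outer_square v) *v x) > 0"
      unfolding mult inner_add_right by linarith
  qed
qed

text \<open>The perturbed matrix sends \<open>matrix_inv S *v v\<close> to a positive multiple of
  \<open>v\<close>, so the full inverse need not be known: on the direction \<open>v\<close> it
  suffices to divide by that multiple.\<close>

lemma sherman_morrison_direction:
  assumes S: "pos_def_matrix S" and k: "k \<ge> 0"
  shows "matrix_inv (S + k *\<^sub>R outer_square v) *v v =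
         (1 / (1 + k * (v \<bullet> (matrix_inv S *v v)))) *\<^sub>R (matrix_inv S *v v)"
proof -
  let ?G = "S + k *\<^sub>R outer_square v" and ?c = "1 + k * (v \<bullet> (matrix_inv S *v v))"
  have mult: "?G *v x = S *v x + (k * (v \<bullet> x)) *\<^sub>R v" for x
    by (simp add: vec_eq_iff matrix_vector_mult_def outer_square_def inner_vec_def sum_distrib_left
        sum.distrib algebra_simps)
  have "v \<bullet> (matrix_inv S *v v) \<ge> 0"
    using pos_def_matrix_inv_pos[OF S, of v] by (cases "v = 0") auto
  hence c: "?c > 0" using k by (simp add: add_pos_nonneg)
  have "?G *v (matrix_inv S *v v) = ?c *\<^sub>R v"
    unfolding mult by (simp add: pos_def_matrix_mult_inv[OF S] algebra_simps)
  hence "?G *v ((1 / ?c) *\<^sub>R (matrix_inv S *v v)) = v"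
    using c by (simp add: matrix_vector_mult_scaleR)
  thus ?thesis
    using pos_def_matrix_mult_inv(2)[OF pos_def_matrix_add_outer_square[OF S k, of v]] by metis
qed

text \<open>Deterministic, along one fixed sample. Expanding the squares about the class means
  expresses the pooled covariance through the averages in the hypotheses; since the class mean tends
  to \<open>b r\<close> over \<open>q r\<close>, the mean-dependent terms collapse to
  \<open>outer_square (b r) /\<^sub>R q r\<close>. Normalising by \<open>n - 2\<close> in place of
  \<open>n\<close> costs a factor tending to 1.\<close>

lemma lda_limits:
  fixes xs :: "nat \<Rightarrow> real^'d" and q :: "nat \<Rightarrow> real" and b :: "nat \<Rightarrow> real^'d" and T :: "nat \<Rightarrow> real^'d^'d"
  assumes q: "\<And>r. r \<in> {0, 1} \<Longrightarrow> q r > 0"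
    and count: "\<And>r. r \<in> {0, 1} \<Longrightarrow> (\<lambda>n. (\<Sum>i=1..n. of_bool (ys i = r)) / real n) \<longlonglongrightarrow> q r"
    and first: "\<And>r a. r \<in> {0, 1} \<Longrightarrow>
      (\<lambda>n. (\<Sum>i=1..n. of_bool (ys i = r) * xs i $ a) / real n) \<longlonglongrightarrow> b r $ a"
    and second: "\<And>r a c. r \<in> {0, 1} \<Longrightarrow>
      (\<lambda>n. (\<Sum>i=1..n. of_bool (ys i = r) * (xs i $ a * xs i $ c)) / real n) \<longlonglongrightarrow> T r $ a $ c"
  shows "r \<in> {0, 1} \<Longrightarrow> (\<lambda>n. lda_prior ys n r) \<longlonglongrightarrow> q r"
    and "r \<in> {0, 1} \<Longrightarrow> (\<lambda>n. lda_mean xs ys n r) \<longlonglongrightarrow> b r /\<^sub>R q r"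
    and "(\<lambda>n. lda_cov xs ys n) \<longlonglongrightarrow> (\<Sum>r\<in>{0, 1}. T r - outer_square (b r) /\<^sub>R q r)"
proof -
  show prior: "(\<lambda>n. lda_prior ys n r) \<longlonglongrightarrow> q r" if "r \<in> {0, 1}" for r
    using count[OF that] by (simp add: lda_prior_def lda_count_def)
  show mean: "(\<lambda>n. lda_mean xs ys n r) \<longlonglongrightarrow> b r /\<^sub>R q r" if r: "r \<in> {0, 1}" for r
  proof (rule vec_tendstoI)
    fix a
    have "(\<lambda>n. ((\<Sum>i=1..n. of_bool (ys i = r) * xs i $ a) / real n) / (lda_count ys n r / real n))
            \<longlonglongrightarrow> b r $ a / q r"
      using q[OF r] by (intro tendsto_divide first[OF r] prior[OF r, unfolded lda_prior_def]) auto
    moreover have "eventually (\<lambda>n. ((\<Sum>i=1..n. of_bool (ys i = r) * xs i $ a) / real n) / (lda_count ys n r / real n)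
         = lda_mean xs ys n r $ a) sequentially"
      using eventually_gt_at_top[of 0]
      by eventually_elim (simp add: lda_mean_def field_simps)
    ultimately have "(\<lambda>n. lda_mean xs ys n r $ a) \<longlonglongrightarrow> b r $ a / q r"
      by (rule Lim_transform_eventually)
    thus "(\<lambda>n. lda_mean xs ys n r $ a) \<longlonglongrightarrow> (b r /\<^sub>R q r) $ a" by (simp add: field_simps)
  qed
  show "(\<lambda>n. lda_cov xs ys n) \<longlonglongrightarrow> (\<Sum>r\<in>{0, 1}. T r - outer_square (b r) /\<^sub>R q r)"
  proof (intro vec_tendstoI)
    fix a c
    define m where "m n r = lda_mean xs ys n r" for n r
    define C where "C n r = (\<Sum>i=1..n. of_bool (ys i = r)) / real n" for n r
    define F where "F n r a = (\<Sum>i=1..n. of_bool (ys i = r) * xs i $ a) / real n" for n r a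
    define U where "U n r = (\<Sum>i=1..n. of_bool (ys i = r) * (xs i $ a * xs i $ c)) / real n" for n r
    have expand: "(\<Sum>i=1..n. of_bool (ys i = r) * ((xs i $ a - s) * (xs i $ c - t))) =
        real n * (U n r - s * F n r c - t * F n r a + s * t * C n r)" if "n > 0" for n r s t
    proof -
      have "(\<Sum>i=1..n. of_bool (ys i = r) * ((xs i $ a - s) * (xs i $ c - t))) =
         (\<Sum>i=1..n. of_bool (ys i = r) * (xs i $ a * xs i $ c)) - s * (\<Sum>i=1..n. of_bool (ys i = r) * xs i $ c)
         - t * (\<Sum>i=1..n. of_bool (ys i = r) * xs i $ a) + s * t * (\<Sum>i=1..n. of_bool (ys i = r))"
        by (simp only: sum_distrib_left sum_subtractf[symmetric] sum.distrib[symmetric])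
           (rule sum.cong[OF refl], simp add: algebra_simps)
      thus ?thesis using that by (simp add: U_def F_def C_def algebra_simps)
    qed
    have lim: "(\<lambda>n. U n r - m n r $ a * F n r c - m n r $ c * F n r a + m n r $ a * m n r $ c * C n r)
        \<longlonglongrightarrow> T r $ a $ c - (b r /\<^sub>R q r) $ a * b r $ c - (b r /\<^sub>R q r) $ c * b r $ a
           + (b r /\<^sub>R q r) $ a * (b r /\<^sub>R q r) $ c * q r" if r: "r \<in> {0, 1}" for r
      unfolding U_def F_def C_def m_def
      by (intro tendsto_add tendsto_diff tendsto_mult tendsto_vec_nth mean[OF r] count[OF r] first[OF r] second[OF r])
    have "(\<lambda>n. real n / (real n - 2)) \<longlonglongrightarrow> 1" by real_asymp
    from tendsto_mult[OF this tendsto_add[OF lim[of 0] lim[of 1]]]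
    have "(\<lambda>n. real n / (real n - 2) * (\<Sum>r\<in>{0, 1}. U n r - m n r $ a * F n r c - m n r $ c * F n r a + m n r $ a * m n r $ c * C n r))
       \<longlonglongrightarrow> (\<Sum>r\<in>{0, 1}. T r $ a $ c - (b r /\<^sub>R q r) $ a * b r $ c - (b r /\<^sub>R q r) $ c * b r $ a
           + (b r /\<^sub>R q r) $ a * (b r /\<^sub>R q r) $ c * q r)"
      by simp
    moreover have "eventually (\<lambda>n. real n / (real n - 2) * (\<Sum>r\<in>{0, 1}. U n r - m n r $ a * F n r c - m n r $ c * F n r a + m n r $ a * m n r $ c * C n r)
        = lda_cov xs ys n $ a $ c) sequentially"
      using eventually_gt_at_top[of 2]
    proof eventually_elim
      case (elim n)
      have "lda_cov xs ys n $ a $ c =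
         (\<Sum>i=1..n. \<Sum>r\<in>{0, 1}. of_bool (ys i = r) * ((xs i $ a - m n r $ a) * (xs i $ c - m n r $ c))) / (real n - 2)"
        by (simp add: lda_cov_def outer_square_def m_def field_simps sum_component del: sum.insert)
      also have "\<dots> = (\<Sum>r\<in>{0, 1}. \<Sum>i=1..n. of_bool (ys i = r) * ((xs i $ a - m n r $ a) * (xs i $ c - m n r $ c))) / (real n - 2)"
        by (subst sum.swap) (rule refl)
      finally show ?case using elim by (simp only: expand sum_distrib_left[symmetric]) simp
    qed
    ultimately have "(\<lambda>n. lda_cov xs ys n $ a $ c)
       \<longlonglongrightarrow> (\<Sum>r\<in>{0, 1}. T r $ a $ c - (b r /\<^sub>R q r) $ a * b r $ c - (b r /\<^sub>R q r) $ c * b r $ a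
           + (b r /\<^sub>R q r) $ a * (b r /\<^sub>R q r) $ c * q r)"
      by (rule Lim_transform_eventually)
    moreover have "T r $ a $ c - (b r /\<^sub>R q r) $ a * b r $ c - (b r /\<^sub>R q r) $ c * b r $ a
           + (b r /\<^sub>R q r) $ a * (b r /\<^sub>R q r) $ c * q r = (T r - outer_square (b r) /\<^sub>R q r) $ a $ c"
      if "r \<in> {0, 1}" for r
      using q[OF that] by (simp add: outer_square_def field_simps)
    hence "(\<Sum>r\<in>{0, 1}. T r $ a $ c - (b r /\<^sub>R q r) $ a * b r $ c - (b r /\<^sub>R q r) $ c * b r $ a
           + (b r /\<^sub>R q r) $ a * (b r /\<^sub>R q r) $ c * q r) =
           (\<Sum>r\<in>{0, 1}. (T r - outer_square (b r) /\<^sub>R q r) $ a $ c)"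
      by (rule sum.cong[OF refl])
    ultimately show "(\<lambda>n. lda_cov xs ys n $ a $ c) \<longlonglongrightarrow> (\<Sum>r\<in>{0, 1}. T r - outer_square (b r) /\<^sub>R q r) $ a $ c"
      by (simp only: sum_component)
  qed
qed

text \<open>\<open>w r s\<close> is the limiting joint frequency of noisy label \<open>r\<close> and true label \<open>s\<close>.\<close>

lemma lda_score_limit:
  fixes xs :: "nat \<Rightarrow> real^'d" and \<mu> :: "nat \<Rightarrow> real^'d"
  assumes \<pi>: "\<pi>\<^sub>1 = 1 - \<pi>\<^sub>0" "0 < \<pi>\<^sub>1" "\<pi>\<^sub>1 < 1" and \<rho>: "0 \<le> \<rho>" "\<rho> < 1 / 2"
    and S: "pos_def_matrix S"
    and D: "D\<^sup>2 = (\<mu> 1 - \<mu> 0) \<bullet> (matrix_inv S *v (\<mu> 1 - \<mu> 0))"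
  defines "w \<equiv> \<lambda>r s :: nat. (if s = 1 then \<pi>\<^sub>1 else \<pi>\<^sub>0) * (if r = s then 1 - \<rho> else \<rho>)"
  assumes count: "\<And>r. r \<in> {0, 1} \<Longrightarrow>
      (\<lambda>n. (\<Sum>i=1..n. of_bool (ys i = r)) / real n) \<longlonglongrightarrow> (\<Sum>s\<in>{0, 1}. w r s)"
    and first: "\<And>r a. r \<in> {0, 1} \<Longrightarrow>
      (\<lambda>n. (\<Sum>i=1..n. of_bool (ys i = r) * xs i $ a) / real n) \<longlonglongrightarrow> (\<Sum>s\<in>{0, 1}. w r s * \<mu> s $ a)"
    and second: "\<And>r a c. r \<in> {0, 1} \<Longrightarrow>
      (\<lambda>n. (\<Sum>i=1..n. of_bool (ys i = r) * (xs i $ a * xs i $ c)) / real n)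
        \<longlonglongrightarrow> (\<Sum>s\<in>{0, 1}. w r s * (S $ a $ c + \<mu> s $ a * \<mu> s $ c))"
  shows "\<exists>k>0. \<forall>x. (\<lambda>n. lda_score xs ys n x) \<longlonglongrightarrow>
     k * (lda_c0 \<pi>\<^sub>0 \<pi>\<^sub>1 \<rho> D + (x - (\<mu> 1 + \<mu> 0) /\<^sub>R 2) \<bullet> (matrix_inv S *v (\<mu> 1 - \<mu> 0)))"
proof -
  define \<delta> where "\<delta> = \<mu> 1 - \<mu> 0"
  define q where "q r = (\<Sum>s\<in>{0::nat, 1}. w r s)" for r
  define b where "b r = (\<Sum>s\<in>{0::nat, 1}. w r s *\<^sub>R \<mu> s)" for r
  define T where "T r = (\<Sum>s\<in>{0::nat, 1}. w r s *\<^sub>R (S + outer_square (\<mu> s)))" for r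
  define q\<^sub>0 where "q\<^sub>0 = (1 - 2 * \<rho>) * \<pi>\<^sub>0 + \<rho>"
  define q\<^sub>1 where "q\<^sub>1 = (1 - 2 * \<rho>) * \<pi>\<^sub>1 + \<rho>"
  \<comment> \<open>Each noisy class is a mixture of the two Gaussians. This is the spread between
    their means, summed over both noisy classes; see \<open>kk\<close> below.\<close>
  define \<kappa> where "\<kappa> = \<pi>\<^sub>0 * \<pi>\<^sub>1 * \<rho> * (1 - \<rho>) / (q\<^sub>0 * q\<^sub>1)"
  \<comment> \<open>Factor by which contamination shrinks the difference of the class means; see
    \<open>ml\<close> and \<open>diff\<close> below.\<close>
  define l where "l = (1 - 2 * \<rho>) * \<pi>\<^sub>0 * \<pi>\<^sub>1 / (q\<^sub>0 * q\<^sub>1)"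
  have \<pi>0: "\<pi>\<^sub>0 > 0" using \<pi> by simp
  have pos: "q\<^sub>0 > 0" "q\<^sub>1 > 0" using \<pi> \<rho> \<pi>0 by (auto simp: q\<^sub>0_def q\<^sub>1_def intro!: add_pos_nonneg)
  have q: "q 0 = q\<^sub>0" "q 1 = q\<^sub>1"
    unfolding q_def w_def q\<^sub>0_def q\<^sub>1_def \<pi>(1) by (simp_all add: algebra_simps)
  have w: "w 0 0 = \<pi>\<^sub>0 * (1 - \<rho>)" "w 0 1 = \<pi>\<^sub>1 * \<rho>" "w 1 0 = \<pi>\<^sub>0 * \<rho>" "w 1 1 = \<pi>\<^sub>1 * (1 - \<rho>)"
    by (simp_all add: w_def)
  have qsum: "q\<^sub>0 + q\<^sub>1 = 1" unfolding q\<^sub>0_def q\<^sub>1_def \<pi>(1) by (simp add: algebra_simps)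
  have \<kappa>: "\<kappa> \<ge> 0" unfolding \<kappa>_def using pos \<pi> \<pi>0 \<rho> by simp
  have l: "l > 0" unfolding l_def using pos \<pi> \<pi>0 \<rho> by simp
  have lims: "\<And>r. r \<in> {0, 1} \<Longrightarrow> (\<lambda>n. lda_prior ys n r) \<longlonglongrightarrow> q r"
    "\<And>r. r \<in> {0, 1} \<Longrightarrow> (\<lambda>n. lda_mean xs ys n r) \<longlonglongrightarrow> b r /\<^sub>R q r"
    "(\<lambda>n. lda_cov xs ys n) \<longlonglongrightarrow> (\<Sum>r\<in>{0, 1}. T r - outer_square (b r) /\<^sub>R q r)"
  proof -
    have 1: "q r > 0" if "r \<in> {0, 1}" for r using that q pos by auto
    have 2: "(\<lambda>n. (\<Sum>i=1..n. of_bool (ys i = r)) / real n) \<longlonglongrightarrow> q r" if "r \<in> {0, 1}" for r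
      using count[OF that] by (simp add: q_def)
    have 3: "(\<lambda>n. (\<Sum>i=1..n. of_bool (ys i = r) * xs i $ a) / real n) \<longlonglongrightarrow> b r $ a" if "r \<in> {0, 1}" for r a
      using first[OF that, of a] by (simp add: b_def)
    have 4: "(\<lambda>n. (\<Sum>i=1..n. of_bool (ys i = r) * (xs i $ a * xs i $ c)) / real n) \<longlonglongrightarrow> T r $ a $ c"
      if "r \<in> {0, 1}" for r a c
      using second[OF that, of a c] by (simp add: T_def outer_square_def)
    note L = lda_limits[of q ys xs b T, OF 1 2 3 4]
    show "\<And>r. r \<in> {0, 1} \<Longrightarrow> (\<lambda>n. lda_prior ys n r) \<longlonglongrightarrow> q r" by (rule L(1))
    show "\<And>r. r \<in> {0, 1} \<Longrightarrow> (\<lambda>n. lda_mean xs ys n r) \<longlonglongrightarrow> b r /\<^sub>R q r" by (rule L(2))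
    show "(\<lambda>n. lda_cov xs ys n) \<longlonglongrightarrow> (\<Sum>r\<in>{0, 1}. T r - outer_square (b r) /\<^sub>R q r)" by (rule L(3))
  qed
  define G where "G = S + \<kappa> *\<^sub>R outer_square \<delta>"
  have cov: "(\<Sum>r\<in>{0, 1}. T r - outer_square (b r) /\<^sub>R q r) = G"
  proof -
    \<comment> \<open>The law of total covariance for a two-component mixture with weights
      \<open>u\<close> and \<open>v\<close>: the within-component part plus the part caused by the
      distance of the means.\<close>
    have mix: "u * s + v * t - (u * x + v * y) * (u * x' + v * y') / (u + v) =
        u * (s - x * x') + v * (t - y * y') + u * v / (u + v) * ((x - y) * (x' - y'))"
      if "u + v > 0" for u v s t x y x' y' :: real
    proof -
      have "u * x * x' + v * y * y' - (u * x + v * y) * (u * x' + v * y') / (u + v) =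
         u * v / (u + v) * ((x - y) * (x' - y'))"
        using that by (simp add: field_simps)
      thus ?thesis by (simp add: algebra_simps)
    qed
    have qs: "w 0 1 + w 0 0 > 0" "w 1 1 + w 1 0 > 0" "w 0 1 + w 0 0 = q\<^sub>0" "w 1 1 + w 1 0 = q\<^sub>1"
      using q pos by (auto simp: q_def add.commute)
    have kk: "w 0 1 * w 0 0 / q\<^sub>0 + w 1 1 * w 1 0 / q\<^sub>1 = \<kappa>"
    proof -
      have "w 0 1 * w 0 0 / q\<^sub>0 + w 1 1 * w 1 0 / q\<^sub>1 = \<pi>\<^sub>0 * \<pi>\<^sub>1 * \<rho> * (1 - \<rho>) * (q\<^sub>0 + q\<^sub>1) / (q\<^sub>0 * q\<^sub>1)"
        unfolding w using pos by (simp add: field_simps)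
      thus ?thesis by (simp add: qsum \<kappa>_def)
    qed
    show ?thesis
    proof (simp only: vec_eq_iff, intro allI)
      fix a c
      have comp: "(T r - outer_square (b r) /\<^sub>R (w r 1 + w r 0)) $ a $ c = (w r 1 + w r 0) * S $ a $ c
         + w r 1 * w r 0 / (w r 1 + w r 0) * (\<delta> $ a * \<delta> $ c)" if "w r 1 + w r 0 > 0" for r
      proof -
        have "(T r - outer_square (b r) /\<^sub>R (w r 1 + w r 0)) $ a $ c =
          w r 1 * (S $ a $ c + \<mu> 1 $ a * \<mu> 1 $ c) + w r 0 * (S $ a $ c + \<mu> 0 $ a * \<mu> 0 $ c)
          - (w r 1 * \<mu> 1 $ a + w r 0 * \<mu> 0 $ a) * (w r 1 * \<mu> 1 $ c + w r 0 * \<mu> 0 $ c) / (w r 1 + w r 0)"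
          by (simp add: T_def b_def outer_square_def divide_inverse algebra_simps)
        also note mix[OF that]
        finally show ?thesis by (simp add: \<delta>_def algebra_simps)
      qed
      have "(T 0 - outer_square (b 0) /\<^sub>R q 0) $ a $ c =
          q\<^sub>0 * S $ a $ c + w 0 1 * w 0 0 / q\<^sub>0 * (\<delta> $ a * \<delta> $ c)"
        using comp[of 0, OF qs(1)] unfolding qs(3) q(1) .
      moreover have "(T 1 - outer_square (b 1) /\<^sub>R q 1) $ a $ c =
          q\<^sub>1 * S $ a $ c + w 1 1 * w 1 0 / q\<^sub>1 * (\<delta> $ a * \<delta> $ c)"
        using comp[of 1, OF qs(2)] unfolding qs(4) q(2) .
      ultimately have "(\<Sum>r\<in>{0, 1}. T r - outer_square (b r) /\<^sub>R q r) $ a $ c =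
         (q\<^sub>0 + q\<^sub>1) * S $ a $ c
         + (w 0 1 * w 0 0 / q\<^sub>0 + w 1 1 * w 1 0 / q\<^sub>1) * (\<delta> $ a * \<delta> $ c)"
        unfolding distrib_right by simp
      thus "(\<Sum>r\<in>{0, 1}. T r - outer_square (b r) /\<^sub>R q r) $ a $ c = G $ a $ c"
        unfolding kk qsum by (simp add: G_def outer_square_def)
    qed
  qed
  have detG: "det G \<noteq> 0"
    using pos_def_matrix_invertible[OF pos_def_matrix_add_outer_square[OF S \<kappa>]]
    by (simp add: G_def invertible_det_nz)
  \<comment> \<open>Displacement of the midpoint between the class means, in units of
    \<open>\<delta>\<close>; see \<open>mid\<close> below.\<close>
  define m where "m = (\<pi>\<^sub>1 - \<pi>\<^sub>0) * \<rho> * (1 - \<rho>) / (2 * (q\<^sub>0 * q\<^sub>1))"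
  have m0: "b 0 /\<^sub>R q 0 = \<mu> 0 + (\<pi>\<^sub>1 * \<rho> / q\<^sub>0) *\<^sub>R \<delta>"
  proof -
    have "b 0 = q\<^sub>0 *\<^sub>R \<mu> 0 + (\<pi>\<^sub>1 * \<rho>) *\<^sub>R \<delta>"
    proof -
      have "w 0 0 + w 0 1 = q\<^sub>0" using q(1) by (simp add: q_def)
      moreover have "b 0 = (w 0 0 + w 0 1) *\<^sub>R \<mu> 0 + w 0 1 *\<^sub>R \<delta>"
        by (simp add: b_def \<delta>_def algebra_simps)
      ultimately show ?thesis by (simp only: w(2))
    qed
    thus ?thesis using pos q by (simp add: scaleR_add_right divide_inverse mult.commute)
  qed
  have m1: "b 1 /\<^sub>R q 1 = \<mu> 1 - (\<pi>\<^sub>0 * \<rho> / q\<^sub>1) *\<^sub>R \<delta>"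
  proof -
    have "b 1 = q\<^sub>1 *\<^sub>R \<mu> 1 - (\<pi>\<^sub>0 * \<rho>) *\<^sub>R \<delta>"
    proof -
      have "w 1 0 + w 1 1 = q\<^sub>1" using q(2) by (simp add: q_def)
      moreover have "b 1 = (w 1 0 + w 1 1) *\<^sub>R \<mu> 1 - w 1 0 *\<^sub>R \<delta>"
        by (simp add: b_def \<delta>_def algebra_simps)
      ultimately show ?thesis by (simp only: w(3))
    qed
    thus ?thesis using pos q by (simp add: scaleR_diff_right divide_inverse mult.commute)
  qed
  have ml: "1 - \<pi>\<^sub>0 * \<rho> / q\<^sub>1 - \<pi>\<^sub>1 * \<rho> / q\<^sub>0 = l"
  proof -
    have "q\<^sub>0 * q\<^sub>1 - \<pi>\<^sub>0 * \<rho> * q\<^sub>0 - \<pi>\<^sub>1 * \<rho> * q\<^sub>1 = (1 - 2 * \<rho>) * \<pi>\<^sub>0 * \<pi>\<^sub>1"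
      unfolding q\<^sub>0_def q\<^sub>1_def \<pi>(1) by (simp add: algebra_simps)
    thus ?thesis using pos by (simp add: l_def field_simps)
  qed
  have mm: "(\<pi>\<^sub>1 * \<rho> / q\<^sub>0 - \<pi>\<^sub>0 * \<rho> / q\<^sub>1) / 2 = m"
  proof -
    have "\<pi>\<^sub>1 * \<rho> * q\<^sub>1 - \<pi>\<^sub>0 * \<rho> * q\<^sub>0 = (\<pi>\<^sub>1 - \<pi>\<^sub>0) * \<rho> * (1 - \<rho>)"
      unfolding q\<^sub>0_def q\<^sub>1_def \<pi>(1) by (simp add: algebra_simps)
    thus ?thesis using pos by (simp add: m_def field_simps)
  qed
  have diff: "b 1 /\<^sub>R q 1 - b 0 /\<^sub>R q 0 = l *\<^sub>R \<delta>"
    unfolding m0 m1 ml[symmetric] by (simp add: \<delta>_def algebra_simps)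
  have mid: "(b 1 /\<^sub>R q 1 + b 0 /\<^sub>R q 0) /\<^sub>R 2 = (\<mu> 1 + \<mu> 0) /\<^sub>R 2 + m *\<^sub>R \<delta>"
    unfolding m0 m1 mm[symmetric] by (simp add: algebra_simps diff_divide_distrib)
  \<comment> \<open>The Sherman--Morrison denominator. Together with \<open>l\<close> it yields the
    common positive factor \<open>l / e\<close> of the limiting score.\<close>
  define e where "e = 1 + \<kappa> * D\<^sup>2"
  have e: "e > 0" using \<kappa> by (simp add: e_def add_pos_nonneg)
  have dir: "matrix_inv G *v (l *\<^sub>R \<delta>) = (l / e) *\<^sub>R (matrix_inv S *v \<delta>)"
    unfolding matrix_vector_mult_scaleR G_def sherman_morrison_direction[OF S \<kappa>] D[folded \<delta>_def, symmetric] e_def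
    by simp
  \<comment> \<open>Dividing the limiting score by \<open>l / e\<close> turns the noisy log odds
    into \<open>e / l * ln (q\<^sub>1 / q\<^sub>0)\<close>, while the shifted midpoint contributes
    \<open>- m * D\<^sup>2\<close>. These are the two summands of the threshold.\<close>
  have c0: "lda_c0 \<pi>\<^sub>0 \<pi>\<^sub>1 \<rho> D = e / l * ln (q\<^sub>1 / q\<^sub>0) - m * D\<^sup>2"
  proof -
    have qq: "q\<^sub>0 * q\<^sub>1 = (1 - 2 * \<rho>)\<^sup>2 * \<pi>\<^sub>1 * \<pi>\<^sub>0 + \<rho> * (1 - \<rho>)"
      unfolding q\<^sub>0_def q\<^sub>1_def \<pi>(1) by (simp add: algebra_simps power2_eq_square)
    have nz: "q\<^sub>0 * q\<^sub>1 \<noteq> 0" "(1 - 2 * \<rho>) * \<pi>\<^sub>1 * \<pi>\<^sub>0 \<noteq> 0" using pos \<pi> \<pi>0 \<rho> by auto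
    have "e / l = (q\<^sub>0 * q\<^sub>1 + \<pi>\<^sub>0 * \<pi>\<^sub>1 * \<rho> * (1 - \<rho>) * D\<^sup>2) / ((1 - 2 * \<rho>) * \<pi>\<^sub>0 * \<pi>\<^sub>1)"
      unfolding e_def l_def \<kappa>_def using nz by (simp add: add_divide_distrib distrib_right)
    also have "\<dots> = (1 - 2 * \<rho>) + \<rho> * (1 - \<rho>) * (1 + \<pi>\<^sub>0 * \<pi>\<^sub>1 * D\<^sup>2) / ((1 - 2 * \<rho>) * \<pi>\<^sub>1 * \<pi>\<^sub>0)"
    proof -
      have "q\<^sub>0 * q\<^sub>1 + \<pi>\<^sub>0 * \<pi>\<^sub>1 * \<rho> * (1 - \<rho>) * D\<^sup>2 =
          (1 - 2 * \<rho>) * ((1 - 2 * \<rho>) * \<pi>\<^sub>1 * \<pi>\<^sub>0) + \<rho> * (1 - \<rho>) * (1 + \<pi>\<^sub>0 * \<pi>\<^sub>1 * D\<^sup>2)"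
        unfolding qq by (simp add: algebra_simps power2_eq_square)
      thus ?thesis using nz by (simp add: add_divide_distrib mult_ac)
    qed
    finally have el: "e / l = (1 - 2 * \<rho>) + \<rho> * (1 - \<rho>) * (1 + \<pi>\<^sub>0 * \<pi>\<^sub>1 * D\<^sup>2) / ((1 - 2 * \<rho>) * \<pi>\<^sub>1 * \<pi>\<^sub>0)" .
    show ?thesis unfolding lda_c0_def el m_def qq by (simp add: q\<^sub>0_def q\<^sub>1_def)
  qed
  have "(\<lambda>n. lda_score xs ys n x) \<longlonglongrightarrow>
     l / e * (lda_c0 \<pi>\<^sub>0 \<pi>\<^sub>1 \<rho> D + (x - (\<mu> 1 + \<mu> 0) /\<^sub>R 2) \<bullet> (matrix_inv S *v (\<mu> 1 - \<mu> 0)))" for x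
  proof -
    have "(\<lambda>n. lda_score xs ys n x) \<longlonglongrightarrow> ln (q 1 / q 0) +
        (x - (b 1 /\<^sub>R q 1 + b 0 /\<^sub>R q 0) /\<^sub>R 2) \<bullet> (matrix_inv G *v (b 1 /\<^sub>R q 1 - b 0 /\<^sub>R q 0))"
      unfolding lda_score_def
      by (intro tendsto_intros lims tendsto_matrix_inv_mult_vec lims(3)[unfolded cov] detG)
         (use q pos in auto)
    also have "ln (q 1 / q 0) + (x - (b 1 /\<^sub>R q 1 + b 0 /\<^sub>R q 0) /\<^sub>R 2) \<bullet> (matrix_inv G *v (b 1 /\<^sub>R q 1 - b 0 /\<^sub>R q 0))
        = ln (q\<^sub>1 / q\<^sub>0) + l / e * ((x - (\<mu> 1 + \<mu> 0) /\<^sub>R 2) \<bullet> (matrix_inv S *v \<delta>) - m * D\<^sup>2)"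
      unfolding diff mid dir unfolding q D[folded \<delta>_def] by (simp add: inner_diff_left inner_add_left algebra_simps)
    also have "\<dots> = l / e * (lda_c0 \<pi>\<^sub>0 \<pi>\<^sub>1 \<rho> D + (x - (\<mu> 1 + \<mu> 0) /\<^sub>R 2) \<bullet> (matrix_inv S *v (\<mu> 1 - \<mu> 0)))"
      unfolding c0 \<delta>_def using l e by (simp add: algebra_simps)
    finally show ?thesis .
  qed
  thus ?thesis using l e by (intro exI[of _ "l / e"]) simp
qed

lemma lda_classifier_limit:
  assumes "(\<lambda>n. lda_score xs ys n x) \<longlonglongrightarrow> k * s" "k > 0"
  shows "s > 0 \<Longrightarrow> (\<lambda>n. lda_classifier xs ys n x) \<longlonglongrightarrow> 1"
    and "s < 0 \<Longrightarrow> (\<lambda>n. lda_classifier xs ys n x) \<longlonglongrightarrow> 0"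
proof -
  assume "s > 0"
  hence "k * s > 0" using assms(2) by simp
  hence "eventually (\<lambda>n. lda_score xs ys n x > 0) sequentially"
    using order_tendstoD(1)[OF assms(1)] by blast
  hence "eventually (\<lambda>n. lda_classifier xs ys n x = 1) sequentially"
    by eventually_elim (simp add: lda_classifier_score)
  thus "(\<lambda>n. lda_classifier xs ys n x) \<longlonglongrightarrow> 1" by (rule tendsto_eventually)
next
  assume "s < 0"
  hence "k * s < 0" using assms(2) by (simp add: mult_pos_neg)
  hence "eventually (\<lambda>n. lda_score xs ys n x < 0) sequentially"
    using order_tendstoD(2)[OF assms(1)] by blast
  hence "eventually (\<lambda>n. lda_classifier xs ys n x = 0) sequentially"
    by eventually_elim (simp add: lda_classifier_score)
  thus "(\<lambda>n. lda_classifier xs ys n x) \<longlonglongrightarrow> 0" by (rule tendsto_eventually)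
qed

section \<open>Gaussian class-conditional model\<close>

lemma measurable_labels_count_space: "f \<in> M \<rightarrow>\<^sub>M labels \<Longrightarrow> f \<in> M \<rightarrow>\<^sub>M count_space UNIV"
  using measurable_compose[of f M labels "\<lambda>x. x" "count_space UNIV"] by (simp add: measurable_count_space_eq1)

text \<open>The parameters are functions of the label, so that each fact about a class is proved
  once for both labels. Strict positivity of the priors lets conditional statements be multiplied
  back to statements about \<open>M\<close>.\<close>

locale gaussian_model = prob_space M for M :: "'w measure" +
  fixes X :: "'w \<Rightarrow> real^'d" and Y :: "'w \<Rightarrow> nat" and p :: "nat \<Rightarrow> real"
    and \<mu> :: "nat \<Rightarrow> real^'d" and S :: "real^'d^'d"
  assumes X_measurable [measurable]: "X \<in> borel_measurable M"
    and Y_labels [measurable]: "Y \<in> M \<rightarrow>\<^sub>M labels"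
    and p_pos: "\<And>r. r \<in> {0, 1} \<Longrightarrow> p r > 0"
    and prior: "\<And>r. r \<in> {0, 1} \<Longrightarrow> measure M {\<omega> \<in> space M. Y \<omega> = r} = p r"
    and law: "\<And>r. r \<in> {0, 1} \<Longrightarrow> distributed (uniform_measure M {\<omega> \<in> space M. Y \<omega> = r}) lborel X
       (\<lambda>x. ennreal (mvn_density (\<mu> r) S x))"
    and S: "pos_def_matrix S"
begin

lemma Y_cases: "\<omega> \<in> space M \<Longrightarrow> Y \<omega> = 0 \<or> Y \<omega> = 1"
  using measurable_space[OF Y_labels] by auto

lemma Y_measurable [measurable]: "Y \<in> M \<rightarrow>\<^sub>M count_space UNIV"
  by (rule measurable_labels_count_space[OF Y_labels])

text \<open>Conditioning divides by the class probability; multiplying by \<open>p r\<close> undoes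
  this. The result lives on \<open>M\<close> itself, where the contributions of the two classes can
  be added.\<close>

lemma nn_integral_class:
  assumes r: "r \<in> {0, 1}" and [measurable]: "g \<in> borel_measurable borel"
  shows "(\<integral>\<^sup>+\<omega>. g (X \<omega>) * indicator {\<omega> \<in> space M. Y \<omega> = r} \<omega> \<partial>M) =
         ennreal (p r) * (\<integral>\<^sup>+x. ennreal (mvn_density (\<mu> r) S x) * g x \<partial>lborel)"
proof -
  let ?A = "{\<omega> \<in> space M. Y \<omega> = r}"
  have A [measurable]: "?A \<in> sets M" by measurable
  have e: "emeasure M ?A = ennreal (p r)" using prior[OF r] by (simp add: emeasure_eq_measure)
  have "(\<integral>\<^sup>+x. ennreal (mvn_density (\<mu> r) S x) * g x \<partial>lborel) = (\<integral>\<^sup>+\<omega>. g (X \<omega>) \<partial>uniform_measure M ?A)"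
    by (rule distributed_nn_integral[OF law[OF r]]) simp
  also have "\<dots> = (\<integral>\<^sup>+\<omega>. g (X \<omega>) * indicator ?A \<omega> \<partial>M) / emeasure M ?A"
    by (rule nn_integral_uniform_measure) measurable
  finally have eq: "(\<integral>\<^sup>+x. ennreal (mvn_density (\<mu> r) S x) * g x \<partial>lborel) =
      (\<integral>\<^sup>+\<omega>. g (X \<omega>) * indicator ?A \<omega> \<partial>M) / ennreal (p r)" unfolding e .
  show ?thesis
    unfolding eq using p_pos[OF r] by (simp add: ennreal_times_divide ennreal_mult_divide_eq mult.commute[of "ennreal (p r)"])
qed

text \<open>The normalisation is inherited rather than computed: the density is that of a law under
  a conditional probability, so the constant function 1 gives the claim.\<close>

lemma mvn_total:
  assumes r: "r \<in> {0, 1}"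
  shows "(\<integral>\<^sup>+x. ennreal (mvn_density (\<mu> r) S x) \<partial>lborel) = 1"
proof -
  have "ennreal (p r) * (\<integral>\<^sup>+x. ennreal (mvn_density (\<mu> r) S x) \<partial>lborel) = ennreal (p r) * 1"
    using nn_integral_class[OF r, of "\<lambda>_. 1"] prior[OF r] by (simp add: emeasure_eq_measure)
  thus ?thesis using p_pos[OF r] by (subst (asm) ennreal_mult_cancel_left) auto
qed

text \<open>The restriction of \<open>M\<close> to a class is kept unnormalised, with mass
  \<open>p r\<close>. In this form the moments and error probabilities of the two classes simply add
  up.\<close>

lemma distr_linear_functional_class:
  assumes r: "r \<in> {0, 1}" and v: "v \<noteq> 0"
  shows "distr (density M (indicator {\<omega> \<in> space M. Y \<omega> = r})) borel (\<lambda>\<omega>. v \<bullet> X \<omega>) =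
         density lborel (\<lambda>t. ennreal (p r * normal_density (v \<bullet> \<mu> r) (sqrt (v \<bullet> (S *v v))) t))"
    (is "?L = ?R")
proof (rule measure_eqI)
  fix B assume "B \<in> sets ?L"
  hence B [measurable]: "B \<in> sets borel" by simp
  let ?A = "{\<omega> \<in> space M. Y \<omega> = r}"
  have "emeasure ?L B = (\<integral>\<^sup>+t. indicator B t \<partial>?L)" by simp
  also have "\<dots> = (\<integral>\<^sup>+\<omega>. indicator B (v \<bullet> X \<omega>) \<partial>density M (indicator ?A))"
    by (rule nn_integral_distr) measurable
  also have "\<dots> = (\<integral>\<^sup>+\<omega>. indicator B (v \<bullet> X \<omega>) * indicator ?A \<omega> \<partial>M)"
    by (subst nn_integral_density) (auto simp: mult.commute)
  also have "\<dots> = ennreal (p r) * (\<integral>\<^sup>+x. ennreal (mvn_density (\<mu> r) S x) * indicator B (v \<bullet> x) \<partial>lborel)"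
    by (rule nn_integral_class[OF r]) measurable
  also have "(\<integral>\<^sup>+x. ennreal (mvn_density (\<mu> r) S x) * indicator B (v \<bullet> x) \<partial>lborel) =
     (\<integral>\<^sup>+x. indicator B (v \<bullet> x) \<partial>density lborel (\<lambda>x. ennreal (mvn_density (\<mu> r) S x)))"
    by (rule nn_integral_density[symmetric]) measurable
  also have "\<dots> = (\<integral>\<^sup>+t. indicator B t \<partial>distr (density lborel (\<lambda>x. ennreal (mvn_density (\<mu> r) S x))) borel (\<lambda>x. v \<bullet> x))"
    by (rule nn_integral_distr[symmetric]) measurable
  also have "\<dots> = (\<integral>\<^sup>+t. ennreal (normal_density (v \<bullet> \<mu> r) (sqrt (v \<bullet> (S *v v))) t) * indicator B t \<partial>lborel)"
    unfolding mvn_linear_functional[OF S v mvn_total[OF r]] by (rule nn_integral_density) measurable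
  also have "ennreal (p r) * \<dots> = emeasure ?R B"
    using p_pos[OF r] by (simp add: emeasure_density nn_integral_cmult[symmetric] ennreal_mult' mult.assoc)
  finally show "emeasure ?L B = emeasure ?R B" .
qed simp

lemma
  fixes g :: "real \<Rightarrow> real"
  assumes r: "r \<in> {0, 1}" and v: "v \<noteq> 0" and g [measurable]: "g \<in> borel_measurable borel"
    and int: "integrable lborel (\<lambda>t. normal_density (v \<bullet> \<mu> r) (sqrt (v \<bullet> (S *v v))) t * g t)"
  shows integrable_linear_functional_class: "integrable M (\<lambda>\<omega>. of_bool (Y \<omega> = r) * g (v \<bullet> X \<omega>))"
    and expectation_linear_functional_class: "expectation (\<lambda>\<omega>. of_bool (Y \<omega> = r) * g (v \<bullet> X \<omega>)) =
      p r * (\<integral>t. normal_density (v \<bullet> \<mu> r) (sqrt (v \<bullet> (S *v v))) t * g t \<partial>lborel)"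
proof -
  let ?A = "{\<omega> \<in> space M. Y \<omega> = r}"
  let ?n = "normal_density (v \<bullet> \<mu> r) (sqrt (v \<bullet> (S *v v)))"
  let ?D = "density M (\<lambda>\<omega>. ennreal (indicator ?A \<omega>))"
  have D: "density M (indicator ?A) = ?D" by (simp add: ennreal_indicator)
  note d = distr_linear_functional_class[OF r v, unfolded D]
  have "integrable (density lborel (\<lambda>t. ennreal (p r * ?n t))) g"
    using int p_pos[OF r] by (subst integrable_real_density) (auto simp: mult.assoc)
  hence "integrable ?D (\<lambda>\<omega>. g (v \<bullet> X \<omega>))"
    unfolding d[symmetric] by (subst (asm) integrable_distr_eq) auto
  hence i: "integrable M (\<lambda>\<omega>. indicator ?A \<omega> * g (v \<bullet> X \<omega>))"
    by (subst (asm) integrable_real_density) auto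
  have cong: "indicator ?A \<omega> * g (v \<bullet> X \<omega>) = of_bool (Y \<omega> = r) * g (v \<bullet> X \<omega>)" if "\<omega> \<in> space M" for \<omega>
    using that by (simp add: indicator_def)
  show "integrable M (\<lambda>\<omega>. of_bool (Y \<omega> = r) * g (v \<bullet> X \<omega>))"
    using i by (subst (asm) Bochner_Integration.integrable_cong[OF refl cong]) auto
  have "expectation (\<lambda>\<omega>. of_bool (Y \<omega> = r) * g (v \<bullet> X \<omega>)) = expectation (\<lambda>\<omega>. indicator ?A \<omega> * g (v \<bullet> X \<omega>))"
    by (rule Bochner_Integration.integral_cong[OF refl cong[symmetric]])
  also have "\<dots> = (\<integral>\<omega>. g (v \<bullet> X \<omega>) \<partial>?D)"
    by (subst integral_real_density) auto
  also have "\<dots> = (\<integral>t. g t \<partial>distr ?D borel (\<lambda>\<omega>. v \<bullet> X \<omega>))"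
    by (subst integral_distr) auto
  also have "\<dots> = (\<integral>t. p r * ?n t * g t \<partial>lborel)"
    unfolding d using p_pos[OF r] by (subst integral_real_density) auto
  also have "\<dots> = p r * (\<integral>t. ?n t * g t \<partial>lborel)" by (simp add: mult.assoc)
  finally show "expectation (\<lambda>\<omega>. of_bool (Y \<omega> = r) * g (v \<bullet> X \<omega>)) = p r * (\<integral>t. ?n t * g t \<partial>lborel)" .
qed

lemma variance_pos: "v \<noteq> 0 \<Longrightarrow> sqrt (v \<bullet> (S *v v)) > 0"
  using S by (simp add: pos_def_matrix_def)

text \<open>The strong law will be applied to products of two coordinates and asks for their fourth
  powers, hence order 8. Each class has known central moments; the bound on
  \<open>(a + b) ^ 8\<close> moves from the class mean to the origin.\<close>

lemma integrable_linear_functional_power8: "integrable M (\<lambda>\<omega>. (v \<bullet> X \<omega>) ^ 8)"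
proof (cases "v = 0")
  case False
  have bound: "(a + b) ^ 8 \<le> 128 * (a ^ 8 + b ^ 8)" for a b :: real
  proof -
    have sq: "(a + b)\<^sup>2 \<le> 2 * (a\<^sup>2 + b\<^sup>2)" for a b :: real
      using sum_squares_bound[of a b] by (simp add: power2_sum)
    \<comment> \<open>Squaring a bound doubles the exponent and squares the constant, and
      \<open>sq\<close> then contributes another factor 2; the constants therefore run 2, 8,
      128.\<close>
    have step: "(x + y) ^ (2 * k) \<le> c * (x ^ k + y ^ k)\<^sup>2" if "(x + y) ^ k \<le> d * (x ^ k + y ^ k)" "0 \<le> (x + y) ^ k" "c = d\<^sup>2" for x y c d :: real and k
    proof -
      have "((x + y) ^ k)\<^sup>2 \<le> (d * (x ^ k + y ^ k))\<^sup>2" using that by (intro power_mono) auto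
      thus ?thesis using that(3) by (simp add: power_mult_distrib mult.commute[of 2 k] flip: power_mult)
    qed
    have "(a + b) ^ 4 \<le> 4 * (a\<^sup>2 + b\<^sup>2)\<^sup>2" using step[of a b 2 2 4] sq[of a b] by simp
    also have "\<dots> \<le> 4 * (2 * ((a\<^sup>2)\<^sup>2 + (b\<^sup>2)\<^sup>2))" by (intro mult_left_mono sq) simp
    finally have 4: "(a + b) ^ 4 \<le> 8 * (a ^ 4 + b ^ 4)" by (simp flip: power_mult)
    have "(a + b) ^ 8 \<le> 64 * (a ^ 4 + b ^ 4)\<^sup>2" using step[of a b 4 8 64] 4 by simp
    also have "\<dots> \<le> 64 * (2 * ((a ^ 4)\<^sup>2 + (b ^ 4)\<^sup>2))" by (intro mult_left_mono sq) simp
    finally show ?thesis by (simp flip: power_mult)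
  qed
  have cl: "integrable M (\<lambda>\<omega>. of_bool (Y \<omega> = r) * (v \<bullet> X \<omega>) ^ 8)" if r: "r \<in> {0, 1}" for r
  proof (rule integrable_linear_functional_class[OF r False, where g = "\<lambda>t. t ^ 8"])
    let ?n = "normal_density (v \<bullet> \<mu> r) (sqrt (v \<bullet> (S *v v)))" and ?m = "v \<bullet> \<mu> r"
    show "integrable lborel (\<lambda>t. ?n t * t ^ 8)"
    proof (rule Bochner_Integration.integrable_bound)
      show "integrable lborel (\<lambda>t. 128 * (?n t * (t - ?m) ^ 8 + ?n t * ?m ^ 8))"
        using integrable_normal_moment[OF variance_pos[OF False], of ?m 8] variance_pos[OF False]
        by (intro integrable_mult_right Bochner_Integration.integrable_add) auto
      show "AE t in lborel. norm (?n t * t ^ 8) \<le> norm (128 * (?n t * (t - ?m) ^ 8 + ?n t * ?m ^ 8))"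
      proof (rule AE_I2)
        fix t
        have "?n t * t ^ 8 \<le> ?n t * (128 * ((t - ?m) ^ 8 + ?m ^ 8))"
          using bound[of "t - ?m" ?m] by (intro mult_left_mono) auto
        also have "\<dots> = 128 * (?n t * (t - ?m) ^ 8 + ?n t * ?m ^ 8)" by (simp add: algebra_simps)
        finally show "norm (?n t * t ^ 8) \<le> norm (128 * (?n t * (t - ?m) ^ 8 + ?n t * ?m ^ 8))"
          by simp
      qed
    qed measurable
  qed simp
  have "integrable M (\<lambda>\<omega>. of_bool (Y \<omega> = 0) * (v \<bullet> X \<omega>) ^ 8 + of_bool (Y \<omega> = 1) * (v \<bullet> X \<omega>) ^ 8)"
    by (intro Bochner_Integration.integrable_add cl) auto
  moreover have "of_bool (Y \<omega> = 0) * (v \<bullet> X \<omega>) ^ 8 + of_bool (Y \<omega> = 1) * (v \<bullet> X \<omega>) ^ 8 = (v \<bullet> X \<omega>) ^ 8"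
    if "\<omega> \<in> space M" for \<omega>
    using Y_cases[OF that] by auto
  ultimately show ?thesis by (subst (asm) Bochner_Integration.integrable_cong[OF refl]) auto
qed simp

lemma expectation_linear_functional:
  assumes r: "r \<in> {0, 1}"
  shows "expectation (\<lambda>\<omega>. of_bool (Y \<omega> = r) * (v \<bullet> X \<omega>)) = p r * (v \<bullet> \<mu> r)"
proof (cases "v = 0")
  case False
  show ?thesis
    using expectation_linear_functional_class[OF r False, of "\<lambda>t. t"]
      integrable_normal_moment_nz_1[OF variance_pos[OF False]]
      integral_normal_moment_nz_1[OF variance_pos[OF False]] by simp
qed simp

lemma expectation_linear_functional_square:
  assumes r: "r \<in> {0, 1}" and v: "v \<noteq> 0"
  shows "expectation (\<lambda>\<omega>. of_bool (Y \<omega> = r) * (v \<bullet> X \<omega>)\<^sup>2) = p r * (v \<bullet> (S *v v) + (v \<bullet> \<mu> r)\<^sup>2)"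
proof -
  let ?n = "normal_density (v \<bullet> \<mu> r) (sqrt (v \<bullet> (S *v v)))" and ?m = "v \<bullet> \<mu> r"
  note pos = variance_pos[OF v]
  have sq: "has_bochner_integral lborel (\<lambda>t. ?n t * (t - ?m)\<^sup>2) (v \<bullet> (S *v v))"
  proof -
    have "has_bochner_integral lborel (\<lambda>t. ?n t * (t - ?m) ^ (2 * 1))
      (fact (2 * 1) / ((2 / (sqrt (v \<bullet> (S *v v)))\<^sup>2) ^ 1 * fact 1))"
      by (rule normal_moment_even[OF pos])
    moreover have "fact (2 * 1) / ((2 / (sqrt (v \<bullet> (S *v v)))\<^sup>2) ^ 1 * fact 1) = v \<bullet> (S *v v)"
      using pos by simp
    ultimately show ?thesis by simp
  qed
  \<comment> \<open>The square is expanded about the mean, so only the variance, the mean and the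
    total mass of the normal law enter.\<close>
  have "has_bochner_integral lborel (\<lambda>t. ?n t * (t - ?m)\<^sup>2 + (2 * ?m * (?n t * t) - ?m\<^sup>2 * ?n t))
     (v \<bullet> (S *v v) + (2 * ?m * ?m - ?m\<^sup>2 * 1))"
    using normal_moment_nz_1[OF pos, of ?m] integrable_normal_density[OF pos, of ?m] integral_normal_density[OF pos, of ?m]
    by (intro has_bochner_integral_add has_bochner_integral_diff has_bochner_integral_mult_right sq)
       (auto simp: has_bochner_integral_iff)
  moreover have "?n t * (t - ?m)\<^sup>2 + (2 * ?m * (?n t * t) - ?m\<^sup>2 * ?n t) = ?n t * t\<^sup>2" for t
    by (simp add: power2_eq_square algebra_simps)
  ultimately have "has_bochner_integral lborel (\<lambda>t. ?n t * t\<^sup>2) (v \<bullet> (S *v v) + ?m\<^sup>2)"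
    by (simp add: power2_eq_square)
  thus ?thesis
    using expectation_linear_functional_class[OF r v, of "\<lambda>t. t\<^sup>2"] by (simp add: has_bochner_integral_iff)
qed

lemma integrable_coordinates:
  shows "integrable M (\<lambda>\<omega>. X \<omega> $ a)" "integrable M (\<lambda>\<omega>. X \<omega> $ a * X \<omega> $ c)"
    "integrable M (\<lambda>\<omega>. (X \<omega> $ a) ^ 4)" "integrable M (\<lambda>\<omega>. (X \<omega> $ a * X \<omega> $ c) ^ 4)"
proof -
  have 8: "integrable M (\<lambda>\<omega>. (X \<omega> $ a) ^ 8)" for a
    using integrable_linear_functional_power8[of "axis a 1"] by (simp add: inner_axis')
  have [measurable]: "(\<lambda>\<omega>. X \<omega> $ a) \<in> borel_measurable M" for a
    unfolding cart_eq_inner_axis by measurable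
  \<comment> \<open>A single integrable majorant serves all four claims, with \<open>c = a\<close>
    when only one coordinate occurs.\<close>
  have dom: "integrable M f" if [measurable]: "f \<in> borel_measurable M"
    and "\<And>\<omega>. \<bar>f \<omega>\<bar> \<le> 1 + (X \<omega> $ a) ^ 8 + (X \<omega> $ c) ^ 8" for f :: "'w \<Rightarrow> real" and a c
    by (rule Bochner_Integration.integrable_bound[of _ "\<lambda>\<omega>. 1 + (X \<omega> $ a) ^ 8 + (X \<omega> $ c) ^ 8"])
       (use that 8 in auto)
  have pw: "\<bar>x\<bar> ^ k \<le> 1 + x ^ 8" if "k \<le> 8" for x :: real and k
  proof (cases "\<bar>x\<bar> \<le> 1")
    case True
    hence "\<bar>x\<bar> ^ k \<le> 1" by (simp add: power_le_one)
    thus ?thesis by (simp add: add_increasing2)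
  next
    case False
    hence "\<bar>x\<bar> ^ k \<le> \<bar>x\<bar> ^ 8" using that by (intro power_increasing) auto
    thus ?thesis by simp
  qed
  have prod: "\<bar>x * y\<bar> ^ k \<le> 1 + x ^ 8 + y ^ 8" if "k \<le> 4" for x y :: real and k
  proof -
    have "2 * \<bar>x\<bar> ^ k * \<bar>y\<bar> ^ k \<le> (\<bar>x\<bar> ^ k)\<^sup>2 + (\<bar>y\<bar> ^ k)\<^sup>2" by (rule sum_squares_bound)
    also have "\<dots> = \<bar>x\<bar> ^ (k * 2) + \<bar>y\<bar> ^ (k * 2)" by (simp only: power_mult)
    also have "\<dots> \<le> (1 + x ^ 8) + (1 + y ^ 8)" using that by (intro add_mono pw) auto
    finally have "2 * (\<bar>x\<bar> ^ k * \<bar>y\<bar> ^ k) \<le> 2 + (x ^ 8 + y ^ 8)" by simp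
    moreover have "0 \<le> x ^ 8" "0 \<le> y ^ 8" by simp_all
    ultimately have "\<bar>x\<bar> ^ k * \<bar>y\<bar> ^ k \<le> 1 + x ^ 8 + y ^ 8" by linarith
    thus ?thesis by (simp only: abs_mult power_mult_distrib)
  qed
  have pw2: "\<bar>x\<bar> ^ k \<le> 1 + x ^ 8 + x ^ 8" if "k \<le> 8" for x :: real and k
  proof -
    have "0 \<le> x ^ 8" by simp
    thus ?thesis using pw[OF that, of x] by linarith
  qed
  show "integrable M (\<lambda>\<omega>. X \<omega> $ a)"
  proof (rule dom)
    show "\<bar>X \<omega> $ a\<bar> \<le> 1 + (X \<omega> $ a) ^ 8 + (X \<omega> $ a) ^ 8" for \<omega>
      using pw2[of 1 "X \<omega> $ a"] by simp
  qed measurable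
  show "integrable M (\<lambda>\<omega>. (X \<omega> $ a) ^ 4)"
  proof (rule dom)
    show "\<bar>(X \<omega> $ a) ^ 4\<bar> \<le> 1 + (X \<omega> $ a) ^ 8 + (X \<omega> $ a) ^ 8" for \<omega>
      using pw2[of 4 "X \<omega> $ a"] by (simp add: power_abs)
  qed measurable
  show "integrable M (\<lambda>\<omega>. X \<omega> $ a * X \<omega> $ c)"
  proof (rule dom)
    show "\<bar>X \<omega> $ a * X \<omega> $ c\<bar> \<le> 1 + (X \<omega> $ a) ^ 8 + (X \<omega> $ c) ^ 8" for \<omega>
      using prod[of 1 "X \<omega> $ a" "X \<omega> $ c"] by simp
  qed measurable
  show "integrable M (\<lambda>\<omega>. (X \<omega> $ a * X \<omega> $ c) ^ 4)"
  proof (rule dom)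
    show "\<bar>(X \<omega> $ a * X \<omega> $ c) ^ 4\<bar> \<le> 1 + (X \<omega> $ a) ^ 8 + (X \<omega> $ c) ^ 8" for \<omega>
      using prod[of 4 "X \<omega> $ a" "X \<omega> $ c"] by (simp add: power_abs)
  qed measurable
qed

lemma integrable_class:
  fixes f :: "'w \<Rightarrow> real"
  assumes "integrable M f"
  shows "integrable M (\<lambda>\<omega>. of_bool (Y \<omega> = r) * f \<omega>)"
proof (rule Bochner_Integration.integrable_bound[OF assms])
  have [measurable]: "f \<in> borel_measurable M" using assms by auto
  show "(\<lambda>\<omega>. of_bool (Y \<omega> = r) * f \<omega>) \<in> borel_measurable M" by measurable
qed auto

text \<open>Only squares of linear functionals are available, so the mixed moment is obtained by
  polarisation with \<open>v = axis a 1 + axis c 1\<close>. This vector is nonzero even for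
  \<open>a = c\<close>, so no case distinction is needed.\<close>

lemma class_moments:
  assumes r: "r \<in> {0, 1}"
  shows "expectation (\<lambda>\<omega>. of_bool (Y \<omega> = r)) = p r"
    and "expectation (\<lambda>\<omega>. of_bool (Y \<omega> = r) * X \<omega> $ a) = p r * \<mu> r $ a"
    and "expectation (\<lambda>\<omega>. of_bool (Y \<omega> = r) * (X \<omega> $ a * X \<omega> $ c)) = p r * (S $ a $ c + \<mu> r $ a * \<mu> r $ c)"
proof -
  have "expectation (\<lambda>\<omega>. of_bool (Y \<omega> = r)) = expectation (indicator {\<omega> \<in> space M. Y \<omega> = r})"
    by (rule Bochner_Integration.integral_cong) (auto simp: indicator_def)
  also have "\<dots> = p r"
    using prior[OF r] by simp
  finally show "expectation (\<lambda>\<omega>. of_bool (Y \<omega> = r)) = p r" .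
  show "expectation (\<lambda>\<omega>. of_bool (Y \<omega> = r) * X \<omega> $ a) = p r * \<mu> r $ a"
    using expectation_linear_functional[OF r, of "axis a 1"] by (simp add: inner_axis')
  define v where "v = axis a 1 + axis c (1::real)"
  have v: "v \<noteq> 0"
  proof
    assume "v = 0"
    hence "v $ a = 0" by simp
    thus False by (simp add: v_def axis_def split: if_splits)
  qed
  have ax: "axis a (1::real) \<noteq> 0" for a :: 'd by (simp add: axis_eq_0_iff)
  have Sax: "axis a 1 \<bullet> (S *v axis c 1) = S $ a $ c" for a c
    by (simp add: inner_axis' matrix_vector_mul_component inner_axis)
  have sym: "S $ a $ c = S $ c $ a"
  proof -
    have "transpose S $ a $ c = S $ c $ a" by (simp add: transpose_def)
    thus ?thesis using S by (simp add: pos_def_matrix_def)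
  qed
  have vx: "v \<bullet> x = x $ a + x $ c" for x by (simp add: v_def inner_add_left inner_axis')
  have vSv: "v \<bullet> (S *v v) = S $ a $ a + S $ c $ c + 2 * S $ a $ c"
    by (simp add: v_def matrix_vector_right_distrib inner_add_left inner_add_right Sax sym)
  have sq: "expectation (\<lambda>\<omega>. of_bool (Y \<omega> = r) * (X \<omega> $ a)\<^sup>2) = p r * (S $ a $ a + (\<mu> r $ a)\<^sup>2)" for a
    using expectation_linear_functional_square[OF r ax[of a]] by (simp add: inner_axis' Sax matrix_vector_mul_component inner_axis)
  have int: "integrable M (\<lambda>\<omega>. of_bool (Y \<omega> = r) * (X \<omega> $ a * X \<omega> $ c))" for a c
    by (intro integrable_class integrable_coordinates)
  have "p r * (v \<bullet> (S *v v) + (v \<bullet> \<mu> r)\<^sup>2) = expectation (\<lambda>\<omega>. of_bool (Y \<omega> = r) * (v \<bullet> X \<omega>)\<^sup>2)"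
    by (rule expectation_linear_functional_square[OF r v, symmetric])
  also have "\<dots> = expectation (\<lambda>\<omega>. of_bool (Y \<omega> = r) * (X \<omega> $ a + X \<omega> $ c)\<^sup>2)"
    by (simp only: vx)
  also have "\<dots> = expectation (\<lambda>\<omega>. of_bool (Y \<omega> = r) * (X \<omega> $ a)\<^sup>2 + (of_bool (Y \<omega> = r) * (X \<omega> $ c)\<^sup>2
      + 2 * (of_bool (Y \<omega> = r) * (X \<omega> $ a * X \<omega> $ c))))"
    by (simp add: power2_sum algebra_simps)
  also have "\<dots> = expectation (\<lambda>\<omega>. of_bool (Y \<omega> = r) * (X \<omega> $ a)\<^sup>2) + (expectation (\<lambda>\<omega>. of_bool (Y \<omega> = r) * (X \<omega> $ c)\<^sup>2)
      + 2 * expectation (\<lambda>\<omega>. of_bool (Y \<omega> = r) * (X \<omega> $ a * X \<omega> $ c)))"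
    using int[of a c] int[of a a] int[of c c] by (simp add: power2_eq_square)
  finally show "expectation (\<lambda>\<omega>. of_bool (Y \<omega> = r) * (X \<omega> $ a * X \<omega> $ c)) = p r * (S $ a $ c + \<mu> r $ a * \<mu> r $ c)"
    unfolding sq vSv vx[of "\<mu> r"] by (simp add: power2_sum algebra_simps)
qed

end

section \<open>Homogeneous label noise\<close>

text \<open>A function of \<open>(X, Y)\<close> can be pulled out of the conditional expectation
  given \<open>(X, Y)\<close>, and the conditional probability of a flip is the constant
  \<open>\<rho>\<close>. A flip thus acts on such integrals as multiplication by
  \<open>\<rho>\<close>.\<close>

lemma homogeneous_noise_expectation:
  fixes f :: "(real^'d) \<times> nat \<Rightarrow> real"
  assumes "prob_space M" and X [measurable]: "X \<in> borel_measurable M"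
    and Y: "Y \<in> M \<rightarrow>\<^sub>M labels" and Yt: "Yt \<in> M \<rightarrow>\<^sub>M labels"
    and noise: "homogeneous_noise M X Y Yt \<rho>"
    and f [measurable]: "f \<in> borel_measurable (borel \<Otimes>\<^sub>M labels)"
    and int: "integrable M (\<lambda>\<omega>. f (X \<omega>, Y \<omega>))"
  shows "(\<integral>\<omega>. f (X \<omega>, Y \<omega>) * of_bool (Yt \<omega> \<noteq> Y \<omega>) \<partial>M) = \<rho> * (\<integral>\<omega>. f (X \<omega>, Y \<omega>) \<partial>M)"
    and "integrable M (\<lambda>\<omega>. f (X \<omega>, Y \<omega>) * of_bool (Yt \<omega> \<noteq> Y \<omega>))"
proof -
  interpret prob_space M by fact
  define F where "F = vimage_algebra (space M) (\<lambda>\<omega>. (X \<omega>, Y \<omega>)) (borel \<Otimes>\<^sub>M labels)"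
  have XY: "(\<lambda>\<omega>. (X \<omega>, Y \<omega>)) \<in> M \<rightarrow>\<^sub>M borel \<Otimes>\<^sub>M labels"
    by (rule measurable_Pair[OF X Y])
  have sub: "subalgebra M F"
    unfolding subalgebra_def F_def using measurable_iff_sets[THEN iffD1, OF XY] by auto
  interpret finite_measure_subalgebra M F by standard (rule sub)
  have fF: "(\<lambda>\<omega>. f (X \<omega>, Y \<omega>)) \<in> borel_measurable F"
    unfolding F_def
    by (rule measurable_compose[OF measurable_vimage_algebra1[OF measurable_space[OF XY, THEN funcsetI]] f])
  have "(\<lambda>\<omega>. real (Yt \<omega>)) \<in> borel_measurable M" "(\<lambda>\<omega>. real (Y \<omega>)) \<in> borel_measurable M"
    by (rule measurable_compose[OF Yt], simp, rule measurable_compose[OF Y], simp)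
  from borel_measurable_neq[OF this] have Nm [measurable]: "{\<omega> \<in> space M. Yt \<omega> \<noteq> Y \<omega>} \<in> sets M"
    by simp
  let ?I = "indicat_real {\<omega> \<in> space M. Yt \<omega> \<noteq> Y \<omega>}"
  have intI: "integrable M (\<lambda>\<omega>. f (X \<omega>, Y \<omega>) * ?I \<omega>)"
    by (rule integrable_real_mult_indicator[OF Nm int])
  have cong: "f (X \<omega>, Y \<omega>) * ?I \<omega> = f (X \<omega>, Y \<omega>) * of_bool (Yt \<omega> \<noteq> Y \<omega>)" if "\<omega> \<in> space M" for \<omega>
    using that by (simp add: indicator_def)
  show "integrable M (\<lambda>\<omega>. f (X \<omega>, Y \<omega>) * of_bool (Yt \<omega> \<noteq> Y \<omega>))"
    using intI by (subst (asm) Bochner_Integration.integrable_cong[OF refl cong]) auto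
  have "(\<integral>\<omega>. f (X \<omega>, Y \<omega>) * of_bool (Yt \<omega> \<noteq> Y \<omega>) \<partial>M) = (\<integral>\<omega>. f (X \<omega>, Y \<omega>) * ?I \<omega> \<partial>M)"
    by (rule Bochner_Integration.integral_cong[OF refl cong[symmetric]])
  also have "\<dots> = (\<integral>\<omega>. f (X \<omega>, Y \<omega>) * real_cond_exp M F ?I \<omega> \<partial>M)"
    by (rule real_cond_exp_intg(2)[OF intI fF, symmetric]) measurable
  also have "\<dots> = (\<integral>\<omega>. f (X \<omega>, Y \<omega>) * \<rho> \<partial>M)"
  proof (rule integral_cong_AE)
    have [measurable]: "real_cond_exp M F ?I \<in> borel_measurable M"
      by (rule measurable_from_subalg[OF sub]) simp
    have [measurable]: "(\<lambda>\<omega>. f (X \<omega>, Y \<omega>)) \<in> borel_measurable M" by (rule measurable_from_subalg[OF sub fF])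
    show "(\<lambda>\<omega>. f (X \<omega>, Y \<omega>) * real_cond_exp M F ?I \<omega>) \<in> borel_measurable M"
      "(\<lambda>\<omega>. f (X \<omega>, Y \<omega>) * \<rho>) \<in> borel_measurable M" by measurable
    show "AE \<omega> in M. f (X \<omega>, Y \<omega>) * real_cond_exp M F ?I \<omega> = f (X \<omega>, Y \<omega>) * \<rho>"
      using noise unfolding homogeneous_noise_def F_def[symmetric] by eventually_elim simp
  qed
  also have "\<dots> = \<rho> * (\<integral>\<omega>. f (X \<omega>, Y \<omega>) \<partial>M)" by (simp add: mult.commute)
  finally show "(\<integral>\<omega>. f (X \<omega>, Y \<omega>) * of_bool (Yt \<omega> \<noteq> Y \<omega>) \<partial>M) = \<rho> * (\<integral>\<omega>. f (X \<omega>, Y \<omega>) \<partial>M)" .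
qed

context gaussian_model
begin

lemma noisy_class_expectation:
  fixes g :: "real^'d \<Rightarrow> real"
  assumes Yt [measurable]: "Yt \<in> M \<rightarrow>\<^sub>M labels" and noise: "homogeneous_noise M X Y Yt \<rho>"
    and g [measurable]: "g \<in> borel_measurable borel" and int: "integrable M (\<lambda>\<omega>. g (X \<omega>))"
    and r: "r \<in> {0, 1}"
  shows "expectation (\<lambda>\<omega>. of_bool (Yt \<omega> = r) * g (X \<omega>)) =
    (\<Sum>s\<in>{0, 1}. (if r = s then 1 - \<rho> else \<rho>) * expectation (\<lambda>\<omega>. of_bool (Y \<omega> = s) * g (X \<omega>)))"
proof -
  have Yt_cases: "Yt \<omega> = 0 \<or> Yt \<omega> = 1" if "\<omega> \<in> space M" for \<omega>
    using measurable_space[OF Yt that] by auto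
  define f where "f s = (\<lambda>(x, y). of_bool (y = s) * g x)" for s :: nat
  have f [measurable]: "f s \<in> borel_measurable (borel \<Otimes>\<^sub>M labels)" for s
  proof -
    have "(\<lambda>y. of_bool (y = s) :: real) \<in> borel_measurable labels" by simp
    hence "(\<lambda>z. of_bool (snd z = s) * g (fst z)) \<in> borel_measurable (borel \<Otimes>\<^sub>M labels)"
      by (intro borel_measurable_times measurable_compose[OF measurable_snd] measurable_compose[OF measurable_fst g])
    thus ?thesis by (simp add: f_def case_prod_beta)
  qed
  have ints: "integrable M (\<lambda>\<omega>. f s (X \<omega>, Y \<omega>))" for s
    using integrable_class[OF int, of s] by (simp add: f_def)
  note N = homogeneous_noise_expectation[OF prob_space_axioms X_measurable Y_labels Yt noise f ints]
  let ?N = "\<lambda>\<omega>. of_bool (Yt \<omega> \<noteq> Y \<omega>) :: real"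
  define o' where "o' = 1 - r"
  have o': "o' \<in> {0, 1}" "o' \<noteq> r" "{0, 1} = {r, o'}" using r by (auto simp: o'_def)
  \<comment> \<open>Noisy label \<open>r\<close> arises either from true label \<open>r\<close>
    without a flip or from the other label \<open>o'\<close> with a flip. This form contains only
    functions of \<open>(X, Y)\<close> and their products with the flip indicator.\<close>
  have pt: "of_bool (Yt \<omega> = r) * g (X \<omega>) =
      (f r (X \<omega>, Y \<omega>) - f r (X \<omega>, Y \<omega>) * ?N \<omega>) + f o' (X \<omega>, Y \<omega>) * ?N \<omega>" if "\<omega> \<in> space M" for \<omega>
    using Yt_cases[OF that] Y_cases[OF that] r by (auto simp: f_def o'_def)
  have "expectation (\<lambda>\<omega>. of_bool (Yt \<omega> = r) * g (X \<omega>)) =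
     expectation (\<lambda>\<omega>. (f r (X \<omega>, Y \<omega>) - f r (X \<omega>, Y \<omega>) * ?N \<omega>) + f o' (X \<omega>, Y \<omega>) * ?N \<omega>)"
    by (rule Bochner_Integration.integral_cong[OF refl pt])
  also have "\<dots> = (expectation (\<lambda>\<omega>. f r (X \<omega>, Y \<omega>)) - expectation (\<lambda>\<omega>. f r (X \<omega>, Y \<omega>) * ?N \<omega>))
      + expectation (\<lambda>\<omega>. f o' (X \<omega>, Y \<omega>) * ?N \<omega>)"
    by (subst Bochner_Integration.integral_add Bochner_Integration.integral_diff;
        (intro Bochner_Integration.integrable_diff N(2) ints)?)+ simp
  also have "\<dots> = (1 - \<rho>) * expectation (\<lambda>\<omega>. f r (X \<omega>, Y \<omega>)) + \<rho> * expectation (\<lambda>\<omega>. f o' (X \<omega>, Y \<omega>))"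
    unfolding N(1) by (simp add: algebra_simps)
  finally show ?thesis
    unfolding o'(3) using o'(2) by (simp add: f_def)
qed

lemma noisy_class_moments:
  assumes Yt: "Yt \<in> M \<rightarrow>\<^sub>M labels" and noise: "homogeneous_noise M X Y Yt \<rho>" and r: "r \<in> {0, 1}"
  defines "w \<equiv> \<lambda>s. p s * (if r = s then 1 - \<rho> else \<rho>)"
  shows "expectation (\<lambda>\<omega>. of_bool (Yt \<omega> = r)) = (\<Sum>s\<in>{0, 1}. w s)"
    and "expectation (\<lambda>\<omega>. of_bool (Yt \<omega> = r) * X \<omega> $ a) = (\<Sum>s\<in>{0, 1}. w s * \<mu> s $ a)"
    and "expectation (\<lambda>\<omega>. of_bool (Yt \<omega> = r) * (X \<omega> $ a * X \<omega> $ c)) =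
      (\<Sum>s\<in>{0, 1}. w s * (S $ a $ c + \<mu> s $ a * \<mu> s $ c))"
proof -
  have [measurable]: "(\<lambda>x :: real^'d. x $ a) \<in> borel_measurable borel" for a
    unfolding cart_eq_inner_axis by measurable
  have gen: "expectation (\<lambda>\<omega>. of_bool (Yt \<omega> = r) * g (X \<omega>)) = (\<Sum>s\<in>{0, 1}. w s * m s)"
    if "g \<in> borel_measurable borel" "integrable M (\<lambda>\<omega>. g (X \<omega>))"
      "\<And>s. s \<in> {0, 1} \<Longrightarrow> expectation (\<lambda>\<omega>. of_bool (Y \<omega> = s) * g (X \<omega>)) = p s * m s" for g m
  proof -
    have "expectation (\<lambda>\<omega>. of_bool (Yt \<omega> = r) * g (X \<omega>)) =
      (\<Sum>s\<in>{0, 1}. (if r = s then 1 - \<rho> else \<rho>) * expectation (\<lambda>\<omega>. of_bool (Y \<omega> = s) * g (X \<omega>)))"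
      by (rule noisy_class_expectation[OF Yt noise that(1,2) r])
    also have "\<dots> = (\<Sum>s\<in>{0, 1}. w s * m s)"
      by (rule sum.cong[OF refl], subst that(3)) (simp_all add: w_def)
    finally show ?thesis .
  qed
  have one: "expectation (\<lambda>\<omega>. of_bool (Y \<omega> = s) * 1) = p s * 1" if "s \<in> {0, 1}" for s
    using class_moments(1)[OF that] by (simp only: mult_1_right)
  have "expectation (\<lambda>\<omega>. of_bool (Yt \<omega> = r) * 1) = (\<Sum>s\<in>{0, 1}. w s * 1)"
    by (rule gen[OF _ _ one]) simp_all
  thus "expectation (\<lambda>\<omega>. of_bool (Yt \<omega> = r)) = (\<Sum>s\<in>{0, 1}. w s)" by (simp only: mult_1_right)
  show "expectation (\<lambda>\<omega>. of_bool (Yt \<omega> = r) * X \<omega> $ a) = (\<Sum>s\<in>{0, 1}. w s * \<mu> s $ a)"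
    by (rule gen[OF _ integrable_coordinates(1) class_moments(2)]) measurable
  show "expectation (\<lambda>\<omega>. of_bool (Yt \<omega> = r) * (X \<omega> $ a * X \<omega> $ c)) =
      (\<Sum>s\<in>{0, 1}. w s * (S $ a $ c + \<mu> s $ a * \<mu> s $ c))"
    by (rule gen[OF _ integrable_coordinates(2) class_moments(3)]) measurable
qed

end

text \<open>The sums run over the training indices, the expectation is taken at index 0, that of the
  test triple. Equality of the laws transfers means and moment bounds between them.\<close>

lemma iid_triples_strong_law:
  fixes h :: "(real^'d) \<times> nat \<times> nat \<Rightarrow> real"
  assumes "prob_space M" and iid: "iid_triples M X Y Yt"
    and h [measurable]: "h \<in> borel_measurable (borel \<Otimes>\<^sub>M (labels \<Otimes>\<^sub>M labels))"
    and int: "integrable M (\<lambda>\<omega>. h (X 0 \<omega>, Y 0 \<omega>, Yt 0 \<omega>) ^ 4)"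
  shows "AE \<omega> in M. (\<lambda>n. (\<Sum>i=1..n. h (X i \<omega>, Y i \<omega>, Yt i \<omega>)) / real n)
    \<longlonglongrightarrow> (\<integral>\<omega>. h (X 0 \<omega>, Y 0 \<omega>, Yt 0 \<omega>) \<partial>M)"
proof -
  interpret prob_space M by fact
  let ?P = "borel \<Otimes>\<^sub>M (labels \<Otimes>\<^sub>M labels) :: ((real^'d) \<times> nat \<times> nat) measure"
  define V where "V i = (\<lambda>\<omega>. (X i \<omega>, Y i \<omega>, Yt i \<omega>))" for i
  have indep: "indep_vars (\<lambda>_. ?P) V UNIV"
    and id: "distr M ?P (V i) = distr M ?P (V 0)" for i
    using iid unfolding iid_triples_def V_def by auto
  have V [measurable]: "V i \<in> M \<rightarrow>\<^sub>M ?P" for i using indep by (auto simp: indep_vars_def2)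
  have transfer: "(\<integral>\<omega>. g (V i \<omega>) \<partial>M) = (\<integral>\<omega>. g (V 0 \<omega>) \<partial>M)"
    "integrable M (\<lambda>\<omega>. g (V i \<omega>)) = integrable M (\<lambda>\<omega>. g (V 0 \<omega>))"
    if g: "g \<in> borel_measurable ?P" for g :: "_ \<Rightarrow> real" and i
  proof -
    show "(\<integral>\<omega>. g (V i \<omega>) \<partial>M) = (\<integral>\<omega>. g (V 0 \<omega>) \<partial>M)"
      using integral_distr[OF V[of i] g] integral_distr[OF V[of 0] g] id[of i] by simp
    show "integrable M (\<lambda>\<omega>. g (V i \<omega>)) = integrable M (\<lambda>\<omega>. g (V 0 \<omega>))"
      using integrable_distr_eq[OF V[of i] g] integrable_distr_eq[OF V[of 0] g] id[of i] by simp
  qed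
  have "AE \<omega> in M. (\<lambda>n. (\<Sum>i=1..n. h (V i \<omega>)) / real n) \<longlonglongrightarrow> (\<integral>\<omega>. h (V 0 \<omega>) \<partial>M)"
  proof (rule strong_law_fourth_moment)
    show "indep_vars (\<lambda>_. borel) (\<lambda>i \<omega>. h (V i \<omega>)) UNIV"
      by (rule indep_vars_compose2[OF indep h])
    have h4: "(\<lambda>z. (h z - c) ^ 4) \<in> borel_measurable ?P" for c by measurable
    show "integrable M (\<lambda>\<omega>. h (V i \<omega>) ^ 4)" for i
      using transfer(2)[OF h4[of 0], of i] int by (simp add: V_def)
    show "expectation (\<lambda>\<omega>. h (V i \<omega>)) = expectation (\<lambda>\<omega>. h (V 0 \<omega>))" for i
      by (rule transfer(1)[OF h])
    show "expectation (\<lambda>\<omega>. (h (V i \<omega>) - expectation (\<lambda>\<omega>. h (V 0 \<omega>))) ^ 4) \<le>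
      expectation (\<lambda>\<omega>. (h (V 0 \<omega>) - expectation (\<lambda>\<omega>. h (V 0 \<omega>))) ^ 4)" for i
      by (rule eq_refl[OF transfer(1)[OF h4]])
  qed
  thus ?thesis by (simp add: V_def)
qed

text \<open>The label \<open>r\<close> and the coordinates \<open>a\<close>, \<open>c\<close> range
  over finite sets, so the exceptional null sets unite to a single one. It involves no evaluation
  point of the classifier.\<close>

lemma lda_averages_AE:
  fixes X :: "nat \<Rightarrow> 'w \<Rightarrow> real^'d"
  assumes "prob_space M" and iid: "iid_triples M X Y Yt"
    and G: "gaussian_model M (X 0) (Y 0) p \<mu> S"
    and noise: "homogeneous_noise M (X 0) (Y 0) (Yt 0) \<rho>"
  defines "w \<equiv> \<lambda>r s :: nat. p s * (if r = s then 1 - \<rho> else \<rho>)"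
  shows "AE \<omega> in M. \<forall>r \<in> {0, 1}.
     (\<lambda>n. (\<Sum>i=1..n. of_bool (Yt i \<omega> = r)) / real n) \<longlonglongrightarrow> (\<Sum>s\<in>{0, 1}. w r s)
    \<and> (\<forall>a. (\<lambda>n. (\<Sum>i=1..n. of_bool (Yt i \<omega> = r) * X i \<omega> $ a) / real n) \<longlonglongrightarrow> (\<Sum>s\<in>{0, 1}. w r s * \<mu> s $ a))
    \<and> (\<forall>a c. (\<lambda>n. (\<Sum>i=1..n. of_bool (Yt i \<omega> = r) * (X i \<omega> $ a * X i \<omega> $ c)) / real n)
        \<longlonglongrightarrow> (\<Sum>s\<in>{0, 1}. w r s * (S $ a $ c + \<mu> s $ a * \<mu> s $ c)))"
proof -
  interpret gaussian_model M "X 0" "Y 0" p \<mu> S by fact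
  let ?P = "borel \<Otimes>\<^sub>M (labels \<Otimes>\<^sub>M labels) :: ((real^'d) \<times> nat \<times> nat) measure"
  have V: "(\<lambda>\<omega>. (X i \<omega>, Y i \<omega>, Yt i \<omega>)) \<in> M \<rightarrow>\<^sub>M ?P" for i
    using iid unfolding iid_triples_def indep_vars_def2 by auto
  have Yt [measurable]: "Yt i \<in> M \<rightarrow>\<^sub>M labels" for i
    using measurable_compose[OF V measurable_compose[OF measurable_snd measurable_snd], of i] by simp
  have Yt' [measurable]: "Yt i \<in> M \<rightarrow>\<^sub>M count_space UNIV" for i
    by (rule measurable_labels_count_space[OF Yt])
  have [measurable]: "(\<lambda>x :: real^'d. x $ a) \<in> borel_measurable borel" for a
    unfolding cart_eq_inner_axis by measurable
  have law: "AE \<omega> in M. (\<lambda>n. (\<Sum>i=1..n. of_bool (Yt i \<omega> = r) * g (X i \<omega>)) / real n)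
      \<longlonglongrightarrow> expectation (\<lambda>\<omega>. of_bool (Yt 0 \<omega> = r) * g (X 0 \<omega>))"
    if g [measurable]: "g \<in> borel_measurable borel" and int: "integrable M (\<lambda>\<omega>. g (X 0 \<omega>) ^ 4)"
    for g :: "real^'d \<Rightarrow> real" and r
  proof -
    have "(\<lambda>y. of_bool (y = r) :: real) \<in> borel_measurable labels" by simp
    hence m: "(\<lambda>z. of_bool (snd (snd z) = r) * g (fst z)) \<in> borel_measurable ?P"
      by (intro borel_measurable_times measurable_compose[OF measurable_compose[OF measurable_snd measurable_snd]]
          measurable_compose[OF measurable_fst g])
    have "integrable M (\<lambda>\<omega>. (of_bool (Yt 0 \<omega> = r) * g (X 0 \<omega>)) ^ 4)"
      by (rule Bochner_Integration.integrable_bound[OF int]) auto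
    from iid_triples_strong_law[OF prob_space_axioms iid m] this show ?thesis by simp
  qed
  have moments: "AE \<omega> in M. (\<lambda>n. (\<Sum>i=1..n. of_bool (Yt i \<omega> = r)) / real n) \<longlonglongrightarrow> (\<Sum>s\<in>{0, 1}. w r s)"
    "AE \<omega> in M. (\<lambda>n. (\<Sum>i=1..n. of_bool (Yt i \<omega> = r) * X i \<omega> $ a) / real n) \<longlonglongrightarrow> (\<Sum>s\<in>{0, 1}. w r s * \<mu> s $ a)"
    "AE \<omega> in M. (\<lambda>n. (\<Sum>i=1..n. of_bool (Yt i \<omega> = r) * (X i \<omega> $ a * X i \<omega> $ c)) / real n)
        \<longlonglongrightarrow> (\<Sum>s\<in>{0, 1}. w r s * (S $ a $ c + \<mu> s $ a * \<mu> s $ c))"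
    if r: "r \<in> {0, 1}" for r a c
  proof -
    note m = noisy_class_moments[OF Yt noise r]
    have one: "(\<lambda>_. 1 :: real) \<in> borel_measurable (borel :: (real^'d) measure)"
      and one': "integrable M (\<lambda>\<omega>. (1::real) ^ 4)" by simp_all
    show "AE \<omega> in M. (\<lambda>n. (\<Sum>i=1..n. of_bool (Yt i \<omega> = r)) / real n) \<longlonglongrightarrow> (\<Sum>s\<in>{0, 1}. w r s)"
      using law[OF one one', of r] unfolding mult_1_right m(1) w_def .
    have nth: "(\<lambda>x :: real^'d. x $ a) \<in> borel_measurable borel" by measurable
    show "AE \<omega> in M. (\<lambda>n. (\<Sum>i=1..n. of_bool (Yt i \<omega> = r) * X i \<omega> $ a) / real n) \<longlonglongrightarrow> (\<Sum>s\<in>{0, 1}. w r s * \<mu> s $ a)"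
      using law[OF nth integrable_coordinates(3), of r] unfolding m(2) w_def .
    have nth2: "(\<lambda>x :: real^'d. x $ a * x $ c) \<in> borel_measurable borel" by measurable
    show "AE \<omega> in M. (\<lambda>n. (\<Sum>i=1..n. of_bool (Yt i \<omega> = r) * (X i \<omega> $ a * X i \<omega> $ c)) / real n)
        \<longlonglongrightarrow> (\<Sum>s\<in>{0, 1}. w r s * (S $ a $ c + \<mu> s $ a * \<mu> s $ c))"
      using law[OF nth2 integrable_coordinates(4), of r] unfolding m(3) w_def .
  qed
  show ?thesis
    by (intro AE_ball_countable[THEN iffD2] ballI AE_conjI AE_all_countable[THEN iffD2] allI moments) auto
qed

section \<open>Convergence of the risk\<close>

lemma borel_measurable_det:
  fixes A :: "'w \<Rightarrow> real^'n^'n"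
  assumes "\<And>i j. (\<lambda>\<omega>. A \<omega> $ i $ j) \<in> borel_measurable M"
  shows "(\<lambda>\<omega>. det (A \<omega>)) \<in> borel_measurable M"
  unfolding det_def
  by (intro borel_measurable_sum borel_measurable_times borel_measurable_prod borel_measurable_const assms)

text \<open>On singular matrices \<open>matrix_inv\<close> is a constant, since there it picks an element
  satisfying a contradictory predicate.\<close>

lemma matrix_inv_singular:
  fixes A :: "'a::field^'n^'n"
  assumes "det A = 0"
  shows "matrix_inv A = (SOME A'. False)"
proof -
  have "(A ** A' = mat 1 \<and> A' ** A = mat 1) = False" for A'
    using assms invertible_det_nz[of A] by (auto simp: invertible_def)
  thus ?thesis by (simp only: matrix_inv_def)
qed

text \<open>A sample covariance can be singular, so the domain is split at
  \<open>det (A \<omega>) = 0\<close>. There the inverse is one fixed matrix \<open>K\<close> and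
  the product is linear in \<open>v\<close>; elsewhere Cramer's rule gives a quotient of measurable
  functions.\<close>

lemma borel_measurable_matrix_inv_mult_vec:
  fixes A :: "'w \<Rightarrow> real^'n^'n"
  assumes A: "\<And>i j. (\<lambda>\<omega>. A \<omega> $ i $ j) \<in> borel_measurable M"
    and v: "\<And>i. (\<lambda>\<omega>. v \<omega> $ i) \<in> borel_measurable M"
  shows "(\<lambda>\<omega>. (matrix_inv (A \<omega>) *v v \<omega>) $ k) \<in> borel_measurable M"
proof -
  define K :: "real^'n^'n" where "K = (SOME A'. False)"
  note [measurable] = borel_measurable_det[of A M, OF A]
  have [measurable]: "(\<lambda>\<omega>. det (\<chi> i j. if j = k then v \<omega> $ i else A \<omega> $ i $ j)) \<in> borel_measurable M"
  proof (rule borel_measurable_det)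
    fix i j
    show "(\<lambda>\<omega>. (\<chi> i j. if j = k then v \<omega> $ i else A \<omega> $ i $ j) $ i $ j) \<in> borel_measurable M"
      using A[of i j] v[of i] by (cases "j = k") simp_all
  qed
  have [measurable]: "(\<lambda>\<omega>. (K *v v \<omega>) $ k) \<in> borel_measurable M"
    unfolding matrix_vector_mult_def by (simp, intro borel_measurable_sum borel_measurable_times borel_measurable_const v)
  have "(\<lambda>\<omega>. (matrix_inv (A \<omega>) *v v \<omega>) $ k) = (\<lambda>\<omega>. if det (A \<omega>) = 0 then (K *v v \<omega>) $ k
      else det (\<chi> i j. if j = k then v \<omega> $ i else A \<omega> $ i $ j) / det (A \<omega>))"
  proof
    fix \<omega>
    show "(matrix_inv (A \<omega>) *v v \<omega>) $ k = (if det (A \<omega>) = 0 then (K *v v \<omega>) $ k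
      else det (\<chi> i j. if j = k then v \<omega> $ i else A \<omega> $ i $ j) / det (A \<omega>))"
      by (cases "det (A \<omega>) = 0") (simp_all add: matrix_inv_singular K_def matrix_inv_mult_vec_cramer)
  qed
  thus ?thesis by simp
qed

lemma borel_measurable_lda_score:
  fixes xs :: "nat \<Rightarrow> 'w \<Rightarrow> real^'d"
  assumes xs: "\<And>i. xs i \<in> borel_measurable M" and x: "x \<in> borel_measurable M"
    and ys [measurable]: "\<And>i. ys i \<in> M \<rightarrow>\<^sub>M count_space UNIV"
  shows "(\<lambda>\<omega>. lda_score (\<lambda>i. xs i \<omega>) (\<lambda>i. ys i \<omega>) n (x \<omega>)) \<in> borel_measurable M"
proof -
  have [measurable]: "(\<lambda>\<omega>. xs i \<omega> $ a) \<in> borel_measurable M" for i a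
    unfolding cart_eq_inner_axis using xs[of i] by measurable
  have [measurable]: "(\<lambda>\<omega>. x \<omega> $ a) \<in> borel_measurable M" for a
    unfolding cart_eq_inner_axis using x by measurable
  have ind [measurable]: "(\<lambda>\<omega>. of_bool (ys i \<omega> = r) :: real) \<in> borel_measurable M" for i r
    by measurable
  have [measurable]: "(\<lambda>\<omega>. lda_count (\<lambda>i. ys i \<omega>) n r) \<in> borel_measurable M" for r
    unfolding lda_count_def by measurable
  have [measurable]: "(\<lambda>\<omega>. lda_prior (\<lambda>i. ys i \<omega>) n r) \<in> borel_measurable M" for r
    unfolding lda_prior_def by measurable
  have mean [measurable]: "(\<lambda>\<omega>. lda_mean (\<lambda>i. xs i \<omega>) (\<lambda>i. ys i \<omega>) n r $ a) \<in> borel_measurable M" for r a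
    unfolding lda_mean_def vector_scaleR_component sum_component by measurable
  have cov: "(\<lambda>\<omega>. lda_cov (\<lambda>i. xs i \<omega>) (\<lambda>i. ys i \<omega>) n $ a $ c) \<in> borel_measurable M" for a c
    unfolding lda_cov_def vector_scaleR_component sum_component outer_square_def vec_lambda_beta
      vector_minus_component by measurable
  have [measurable]: "(\<lambda>\<omega>. (matrix_inv (lda_cov (\<lambda>i. xs i \<omega>) (\<lambda>i. ys i \<omega>) n) *v
     (lda_mean (\<lambda>i. xs i \<omega>) (\<lambda>i. ys i \<omega>) n 1 - lda_mean (\<lambda>i. xs i \<omega>) (\<lambda>i. ys i \<omega>) n 0)) $ k)
     \<in> borel_measurable M" for k
    by (rule borel_measurable_matrix_inv_mult_vec[OF cov]) (simp only: vector_minus_component, measurable)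
  show ?thesis
    unfolding lda_score_def inner_vec_def inner_real_def vector_minus_component vector_scaleR_component
      vector_add_component by measurable
qed

lemma emeasure_normal_affine:
  assumes c: "c \<noteq> 0" and B [measurable]: "B \<in> sets borel"
  shows "emeasure (density lborel (normal_density m \<bar>c\<bar>)) B =
         emeasure std_normal_distribution ((\<lambda>t. m + c * t) -` B)"
proof -
  have [measurable]: "(\<lambda>t. m + c * t) -` B \<in> sets borel"
    using measurable_sets[of "\<lambda>t. m + c * t" borel borel B] by simp
  have "emeasure (density lborel (normal_density m \<bar>c\<bar>)) B =
      (\<integral>\<^sup>+t. ennreal (normal_density m \<bar>c\<bar> t) * indicator B t \<partial>lborel)"
    by (simp add: emeasure_density)
  also have "\<dots> = ennreal \<bar>c\<bar> * (\<integral>\<^sup>+t. ennreal (normal_density m \<bar>c\<bar> (m + c * t)) * indicator B (m + c * t) \<partial>lborel)"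
    by (rule nn_integral_real_affine) (use c in measurable)
  also have "\<dots> = (\<integral>\<^sup>+t. ennreal \<bar>c\<bar> * (ennreal (normal_density m \<bar>c\<bar> (m + c * t)) * indicator B (m + c * t)) \<partial>lborel)"
    by (rule nn_integral_cmult[symmetric]) measurable
  also have "\<dots> = (\<integral>\<^sup>+t. ennreal (std_normal_density t) * indicator ((\<lambda>t. m + c * t) -` B) t \<partial>lborel)"
  proof (rule nn_integral_cong)
    fix t
    have "std_normal_density t = \<bar>c\<bar> * normal_density m \<bar>c\<bar> (m + c * t)"
      using c by (simp add: normal_density_def real_sqrt_mult power_mult_distrib)
    thus "ennreal \<bar>c\<bar> * (ennreal (normal_density m \<bar>c\<bar> (m + c * t)) * indicator B (m + c * t)) =
      ennreal (std_normal_density t) * indicator ((\<lambda>t. m + c * t) -` B) t"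
      by (simp add: ennreal_mult' mult.assoc indicator_def)
  qed
  also have "\<dots> = emeasure std_normal_distribution ((\<lambda>t. m + c * t) -` B)"
    by (simp add: emeasure_density)
  finally show ?thesis .
qed

lemma emeasure_std_normal_singleton: "emeasure std_normal_distribution {x} = 0"
proof -
  have "AE t in lborel. t \<noteq> x" by (rule AE_lborel_singleton)
  hence "AE t in lborel. ennreal (std_normal_density t) * indicator {x} t = 0"
    by eventually_elim simp
  hence "(\<integral>\<^sup>+t. ennreal (std_normal_density t) * indicator {x} t \<partial>lborel) = 0"
    by (subst nn_integral_0_iff_AE) auto
  thus ?thesis by (simp add: emeasure_density)
qed

lemma measure_std_normal_lessThan: "measure std_normal_distribution {..<x} = \<Phi> x"
proof -
  interpret real_distribution std_normal_distribution by (rule real_dist_normal_dist)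
  have "measure std_normal_distribution ({..<x} \<union> {x}) = measure std_normal_distribution {..<x} + measure std_normal_distribution {x}"
    by (rule finite_measure_Union) auto
  moreover have "{..<x} \<union> {x} = {..x}" by auto
  moreover have "measure std_normal_distribution {x} = 0"
    using emeasure_std_normal_singleton[of x] by (simp add: measure_def)
  ultimately show ?thesis by (simp add: cdf_def)
qed

section \<open>Error probabilities of linear rules\<close>

context gaussian_model
begin

lemma prob_class_linear_functional:
  assumes r: "r \<in> {0, 1}" and v: "v \<noteq> 0" and c: "\<bar>c\<bar> = sqrt (v \<bullet> (S *v v))"
    and B [measurable]: "B \<in> sets borel"
  shows "prob {\<omega> \<in> space M. Y \<omega> = r \<and> v \<bullet> X \<omega> \<in> B} =
         p r * measure std_normal_distribution ((\<lambda>t. v \<bullet> \<mu> r + c * t) -` B)"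
proof -
  have c0: "c \<noteq> 0" using variance_pos[OF v] c by auto
  let ?A = "{\<omega> \<in> space M. Y \<omega> = r}"
  have "emeasure M {\<omega> \<in> space M. Y \<omega> = r \<and> v \<bullet> X \<omega> \<in> B} =
        (\<integral>\<^sup>+\<omega>. indicator {\<omega> \<in> space M. Y \<omega> = r \<and> v \<bullet> X \<omega> \<in> B} \<omega> \<partial>M)"
    by (rule nn_integral_indicator[symmetric]) measurable
  also have "\<dots> = (\<integral>\<^sup>+\<omega>. indicator ?A \<omega> * indicator ((\<lambda>\<omega>. v \<bullet> X \<omega>) -` B \<inter> space M) \<omega> \<partial>M)"
    by (rule nn_integral_cong) (auto simp: indicator_def)
  also have "\<dots> = emeasure (density M (indicator ?A)) ((\<lambda>\<omega>. v \<bullet> X \<omega>) -` B \<inter> space M)"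
    by (rule emeasure_density[symmetric]) measurable
  also have "\<dots> = emeasure (distr (density M (indicator ?A)) borel (\<lambda>\<omega>. v \<bullet> X \<omega>)) B"
    by (subst emeasure_distr) auto
  also have "\<dots> = (\<integral>\<^sup>+t. ennreal (p r * normal_density (v \<bullet> \<mu> r) \<bar>c\<bar> t) * indicator B t \<partial>lborel)"
    unfolding distr_linear_functional_class[OF r v] c by (rule emeasure_density) measurable
  also have "\<dots> = (\<integral>\<^sup>+t. ennreal (p r) * (ennreal (normal_density (v \<bullet> \<mu> r) \<bar>c\<bar> t) * indicator B t) \<partial>lborel)"
    using p_pos[OF r] by (simp add: ennreal_mult' mult.assoc)
  also have "\<dots> = ennreal (p r) * emeasure (density lborel (normal_density (v \<bullet> \<mu> r) \<bar>c\<bar>)) B"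
    by (simp add: nn_integral_cmult emeasure_density)
  also have "\<dots> = ennreal (p r) * emeasure std_normal_distribution ((\<lambda>t. v \<bullet> \<mu> r + c * t) -` B)"
    by (simp only: emeasure_normal_affine[OF c0 B])
  finally show ?thesis
    unfolding measure_def using p_pos[OF r] by (simp add: enn2real_mult)
qed

text \<open>A family of parallel hyperplanes shifted by \<open>c\<close>. The Bayes rule is the
  member with \<open>c = ln (p 1 / p 0)\<close>, the limit of noisy LDA the one with
  \<open>lda_c0\<close>.\<close>

definition discriminant :: "real \<Rightarrow> real^'d \<Rightarrow> real" where
  "discriminant c x = c + (x - (\<mu> 1 + \<mu> 0) /\<^sub>R 2) \<bullet> (matrix_inv S *v (\<mu> 1 - \<mu> 0))"

lemma borel_measurable_discriminant [measurable]: "discriminant c \<in> borel_measurable borel"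
  unfolding discriminant_def [abs_def] by measurable

context
  fixes D :: real
  assumes D: "D > 0" "D\<^sup>2 = (\<mu> 1 - \<mu> 0) \<bullet> (matrix_inv S *v (\<mu> 1 - \<mu> 0))"
begin

abbreviation (input) "dir \<equiv> matrix_inv S *v (\<mu> 1 - \<mu> 0)"

lemma dir_nonzero: "dir \<noteq> 0" using D by auto

lemma dir_variance: "sqrt (dir \<bullet> (S *v dir)) = D"
proof -
  have "dir \<bullet> (S *v dir) = D\<^sup>2"
    unfolding pos_def_matrix_mult_inv[OF S] D(2) by (rule inner_commute)
  thus ?thesis using D(1) by simp
qed

text \<open>Along \<open>dir\<close> the class means lie \<open>D\<^sup>2\<close> apart while the
  standard deviation is \<open>D\<close>, so the standardised separation is
  \<open>D\<close>.\<close>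

lemma dir_means: "dir \<bullet> \<mu> 1 - dir \<bullet> \<mu> 0 = D\<^sup>2"
  unfolding D(2) inner_diff_left by (simp add: inner_commute)

lemma discriminant_dir: "discriminant c x = dir \<bullet> x - (dir \<bullet> \<mu> 1 + dir \<bullet> \<mu> 0) / 2 + c"
  unfolding discriminant_def inner_commute[of _ dir] by (simp add: inner_diff_right inner_add_right)

lemma discriminant_null: "prob {\<omega> \<in> space M. discriminant c (X \<omega>) = 0} = 0"
proof -
  define a where "a = (dir \<bullet> \<mu> 1 + dir \<bullet> \<mu> 0) / 2 - c"
  have null: "prob {\<omega> \<in> space M. Y \<omega> = r \<and> dir \<bullet> X \<omega> \<in> {a}} = 0" if r: "r \<in> {0, 1}" for r
  proof -
    have "(\<lambda>t. dir \<bullet> \<mu> r + D * t) -` {a} = {(a - dir \<bullet> \<mu> r) / D}"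
      using D(1) by (auto simp: field_simps)
    thus ?thesis
      using prob_class_linear_functional[OF r dir_nonzero, of D "{a}"] D(1) dir_variance
        emeasure_std_normal_singleton by (simp add: measure_def)
  qed
  have "prob {\<omega> \<in> space M. discriminant c (X \<omega>) = 0} \<le>
     prob ({\<omega> \<in> space M. Y \<omega> = 0 \<and> dir \<bullet> X \<omega> \<in> {a}} \<union> {\<omega> \<in> space M. Y \<omega> = 1 \<and> dir \<bullet> X \<omega> \<in> {a}})"
    by (rule finite_measure_mono) (use Y_cases in \<open>auto simp: discriminant_dir a_def\<close>)
  also have "\<dots> \<le> prob {\<omega> \<in> space M. Y \<omega> = 0 \<and> dir \<bullet> X \<omega> \<in> {a}} + prob {\<omega> \<in> space M. Y \<omega> = 1 \<and> dir \<bullet> X \<omega> \<in> {a}}"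
    by (rule measure_Un_le) measurable
  also have "\<dots> = 0" by (simp only: null insertI1 insertI2 add_0)
  finally show ?thesis using measure_nonneg[of M] by (simp add: order_antisym)
qed

text \<open>Class 0 is misclassified when \<open>dir \<bullet> X\<close> is at least
  \<open>a\<close>, class 1 when it is below \<open>a\<close>. Measured from the respective class
  mean in units of \<open>D\<close>, the cut lies at the two arguments of \<open>\<Phi>\<close>, up
  to a reflection for class 0.\<close>

lemma discriminant_risk:
  "prob {\<omega> \<in> space M. (if discriminant c (X \<omega>) \<ge> 0 then 1 else 0) \<noteq> Y \<omega>} = threshold_risk (p 0) (p 1) D c"
proof -
  define a where "a = (dir \<bullet> \<mu> 1 + dir \<bullet> \<mu> 0) / 2 - c"
  have nn: "discriminant c x \<ge> 0 \<longleftrightarrow> dir \<bullet> x \<in> {a..}" for x by (auto simp: discriminant_dir a_def)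
  have "{\<omega> \<in> space M. (if discriminant c (X \<omega>) \<ge> 0 then 1 else 0) \<noteq> Y \<omega>} =
     {\<omega> \<in> space M. Y \<omega> = 0 \<and> dir \<bullet> X \<omega> \<in> {a..}} \<union> {\<omega> \<in> space M. Y \<omega> = 1 \<and> dir \<bullet> X \<omega> \<in> {..<a}}"
  proof (rule set_eqI)
    fix \<omega>
    have "dir \<bullet> X \<omega> \<in> {..<a} \<longleftrightarrow> \<not> dir \<bullet> X \<omega> \<in> {a..}" by auto
    thus "\<omega> \<in> {\<omega> \<in> space M. (if discriminant c (X \<omega>) \<ge> 0 then 1 else 0) \<noteq> Y \<omega>} \<longleftrightarrow>
      \<omega> \<in> {\<omega> \<in> space M. Y \<omega> = 0 \<and> dir \<bullet> X \<omega> \<in> {a..}} \<union> {\<omega> \<in> space M. Y \<omega> = 1 \<and> dir \<bullet> X \<omega> \<in> {..<a}}"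
      unfolding nn using Y_cases[of \<omega>] by (cases "dir \<bullet> X \<omega> \<in> {a..}") (auto simp del: atLeast_iff lessThan_iff)
  qed
  hence "prob {\<omega> \<in> space M. (if discriminant c (X \<omega>) \<ge> 0 then 1 else 0) \<noteq> Y \<omega>} =
     prob {\<omega> \<in> space M. Y \<omega> = 0 \<and> dir \<bullet> X \<omega> \<in> {a..}} + prob {\<omega> \<in> space M. Y \<omega> = 1 \<and> dir \<bullet> X \<omega> \<in> {..<a}}"
  proof (simp only:, intro finite_measure_Union)
    show "{\<omega> \<in> space M. Y \<omega> = 0 \<and> dir \<bullet> X \<omega> \<in> {a..}} \<in> events"
      "{\<omega> \<in> space M. Y \<omega> = 1 \<and> dir \<bullet> X \<omega> \<in> {..<a}} \<in> events" by measurable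
    show "{\<omega> \<in> space M. Y \<omega> = 0 \<and> dir \<bullet> X \<omega> \<in> {a..}} \<inter>
      {\<omega> \<in> space M. Y \<omega> = 1 \<and> dir \<bullet> X \<omega> \<in> {..<a}} = {}" by auto
  qed
  also have "prob {\<omega> \<in> space M. Y \<omega> = 0 \<and> dir \<bullet> X \<omega> \<in> {a..}} = p 0 * \<Phi> (c / D - D / 2)"
  proof -
    \<comment> \<open>The scale \<open>- D\<close> has the same modulus as the standard deviation
      and maps the upper half-line to a lower one.\<close>
    have "(\<lambda>t. dir \<bullet> \<mu> 0 + - D * t) -` {a..} = {..(dir \<bullet> \<mu> 0 - a) / D}"
      using D(1) by (auto simp: field_simps)
    moreover have "(dir \<bullet> \<mu> 0 - a) / D = c / D - D / 2"
    proof -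
      have "dir \<bullet> \<mu> 0 - a = c - D\<^sup>2 / 2" unfolding a_def dir_means[symmetric] by (simp add: field_simps)
      thus ?thesis using D(1) by (simp only: diff_divide_distrib) (simp add: power2_eq_square)
    qed
    ultimately show ?thesis
      using prob_class_linear_functional[of 0 dir "- D" "{a..}"] dir_nonzero dir_variance D(1)
      by (simp add: cdf_def)
  qed
  also have "prob {\<omega> \<in> space M. Y \<omega> = 1 \<and> dir \<bullet> X \<omega> \<in> {..<a}} = p 1 * \<Phi> (- c / D - D / 2)"
  proof -
    have "(\<lambda>t. dir \<bullet> \<mu> 1 + D * t) -` {..<a} = {..<(a - dir \<bullet> \<mu> 1) / D}"
      using D(1) by (auto simp: field_simps)
    moreover have "(a - dir \<bullet> \<mu> 1) / D = - c / D - D / 2"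
    proof -
      have "a - dir \<bullet> \<mu> 1 = - c - D\<^sup>2 / 2" unfolding a_def dir_means[symmetric] by (simp add: field_simps)
      thus ?thesis using D(1) by (simp only: diff_divide_distrib) (simp add: power2_eq_square)
    qed
    ultimately show ?thesis
      using prob_class_linear_functional[of 1 dir D "{..<a}"] dir_nonzero dir_variance D(1)
      by (simp add: measure_std_normal_lessThan)
  qed
  finally show ?thesis by (simp add: threshold_risk_def)
qed

text \<open>The predictions \<open>C n\<close> already contain the test point, so the argument is
  pure dominated convergence of the 0-1 loss, with majorant 1, and is independent of how the rule
  was trained.\<close>

lemma risk_tendsto:
  assumes C: "\<And>n. C n \<in> M \<rightarrow>\<^sub>M count_space UNIV"
    and lim: "AE \<omega> in M. (discriminant c (X \<omega>) > 0 \<longrightarrow> (\<lambda>n. C n \<omega>) \<longlonglongrightarrow> (1::nat)) \<and>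
       (discriminant c (X \<omega>) < 0 \<longrightarrow> (\<lambda>n. C n \<omega>) \<longlonglongrightarrow> 0)"
  shows "(\<lambda>n. prob {\<omega> \<in> space M. C n \<omega> \<noteq> Y \<omega>}) \<longlonglongrightarrow> threshold_risk (p 0) (p 1) D c"
proof -
  let ?C = "\<lambda>\<omega>. if discriminant c (X \<omega>) \<ge> 0 then 1 else 0 :: nat"
  let ?e = "\<lambda>C \<omega>. of_bool (C \<omega> \<noteq> Y \<omega>) :: real"
  have Cl: "?C \<in> M \<rightarrow>\<^sub>M count_space UNIV" by measurable
  have sets: "{\<omega> \<in> space M. C \<omega> \<noteq> Y \<omega>} \<in> sets M" if C: "C \<in> M \<rightarrow>\<^sub>M count_space UNIV" for C
  proof -
    have "(\<lambda>\<omega>. real (C \<omega>)) \<in> borel_measurable M" "(\<lambda>\<omega>. real (Y \<omega>)) \<in> borel_measurable M"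
      by (rule measurable_compose[OF C], simp, rule measurable_compose[OF Y_measurable], simp)
    from borel_measurable_neq[OF this] show ?thesis by simp
  qed
  have eq: "prob {\<omega> \<in> space M. C \<omega> \<noteq> Y \<omega>} = expectation (?e C)" "?e C \<in> borel_measurable M"
    if C: "C \<in> M \<rightarrow>\<^sub>M count_space UNIV" for C
  proof -
    have i: "indicator {\<omega> \<in> space M. C \<omega> \<noteq> Y \<omega>} \<omega> = ?e C \<omega>" if "\<omega> \<in> space M" for \<omega>
      using that by (simp add: indicator_def)
    have "prob {\<omega> \<in> space M. C \<omega> \<noteq> Y \<omega>} = expectation (indicator {\<omega> \<in> space M. C \<omega> \<noteq> Y \<omega>})"
      using sets[OF C] by simp
    also have "\<dots> = expectation (?e C)" by (rule Bochner_Integration.integral_cong[OF refl i])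
    finally show "prob {\<omega> \<in> space M. C \<omega> \<noteq> Y \<omega>} = expectation (?e C)" .
    show "?e C \<in> borel_measurable M"
      using borel_measurable_indicator[OF sets[OF C]] by (rule measurable_cong[THEN iffD1, rotated]) (rule i)
  qed
  have "AE \<omega> in M. discriminant c (X \<omega>) \<noteq> 0"
    using discriminant_null[of c] by (subst (asm) prob_eq_0) auto
  hence conv: "AE \<omega> in M. (\<lambda>n. ?e (C n) \<omega>) \<longlonglongrightarrow> ?e ?C \<omega>"
    using lim
  proof eventually_elim
    case (elim \<omega>)
    hence "(\<lambda>n. C n \<omega>) \<longlonglongrightarrow> ?C \<omega>" by (cases "discriminant c (X \<omega>) > 0") auto
    \<comment> \<open>Predictions are natural numbers, so convergence means being eventually
      constant; this carries over to the discontinuous 0-1 loss.\<close>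
    hence "eventually (\<lambda>n. C n \<omega> = ?C \<omega>) sequentially" by (simp only: tendsto_discrete)
    hence "eventually (\<lambda>n. ?e (C n) \<omega> = ?e ?C \<omega>) sequentially" by eventually_elim simp
    thus ?case by (rule tendsto_eventually)
  qed
  have "(\<lambda>n. expectation (?e (C n))) \<longlonglongrightarrow> expectation (?e ?C)"
    by (rule integral_dominated_convergence[OF eq(2)[OF Cl] eq(2)[OF C] _ conv, of "\<lambda>_. 1"]) auto
  thus ?thesis
    unfolding eq(1)[OF C, symmetric] eq(1)[OF Cl, symmetric] discriminant_risk .
qed

end

end

section \<open>The Bayes classifier\<close>

text \<open>The adapted coordinates give \<open>sqrt (det S) = \<bar>det A\<bar>\<close> with
  \<open>A\<close> invertible, and a positive \<open>sqrt\<close> forces a positive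
  argument.\<close>

lemma pos_def_matrix_det_pos:
  fixes S :: "real^'d^'d"
  assumes S: "pos_def_matrix S"
  shows "det S > 0"
proof -
  have "axis undefined (1::real) \<noteq> (0 :: real^'d)" by (simp add: axis_eq_0_iff)
  from gaussian_coordinates[OF S this] obtain A :: "real^'d^'d" where A: "invertible A" "\<bar>det A\<bar> = sqrt (det S)"
    by metis
  hence "det A \<noteq> 0" by (simp add: invertible_det_nz)
  hence "sqrt (det S) > 0" unfolding A(2)[symmetric] by simp
  thus ?thesis by simp
qed

lemma mvn_density_pos: "pos_def_matrix S \<Longrightarrow> mvn_density m S x > 0"
  by (simp add: mvn_density_def pos_def_matrix_det_pos)

lemma regression_function_AE_unique:
  assumes "regression_function M X Y e" "regression_function M X Y e'"
  shows "AE \<omega> in M. e (X \<omega>) = e' (X \<omega>)"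
proof -
  have "AE \<omega> in M. real_cond_exp M (vimage_algebra (space M) X borel) (indicat_real {\<omega> \<in> space M. Y \<omega> = 1}) \<omega> = e (X \<omega>)"
    "AE \<omega> in M. real_cond_exp M (vimage_algebra (space M) X borel) (indicat_real {\<omega> \<in> space M. Y \<omega> = 1}) \<omega> = e' (X \<omega>)"
    using assms by (auto simp: regression_function_def)
  thus ?thesis by eventually_elim simp
qed

context gaussian_model
begin

definition posterior :: "real^'d \<Rightarrow> real" where
  "posterior x = p 1 * mvn_density (\<mu> 1) S x / (p 0 * mvn_density (\<mu> 0) S x + p 1 * mvn_density (\<mu> 1) S x)"

lemma weighted_density_pos: "r \<in> {0, 1} \<Longrightarrow> p r * mvn_density (\<mu> r) S x > 0"
  by (intro mult_pos_pos p_pos mvn_density_pos S)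

lemma posterior_bounds: "0 \<le> posterior x" "posterior x \<le> 1"
proof -
  have "p 0 * mvn_density (\<mu> 0) S x > 0" "p 1 * mvn_density (\<mu> 1) S x > 0"
    by (rule weighted_density_pos; simp)+
  thus "0 \<le> posterior x" "posterior x \<le> 1" unfolding posterior_def by (auto simp: divide_le_eq_1)
qed

lemma borel_measurable_posterior [measurable]: "posterior \<in> borel_measurable borel"
  unfolding posterior_def [abs_def] by measurable

text \<open>This is the defining identity of the conditional probability on the events
  \<open>X \<in> B\<close>. The denominator of \<open>posterior\<close> is the mixture density of
  \<open>X\<close>, so it cancels and leaves the contribution of class 1.\<close>

lemma nn_integral_posterior:
  assumes B [measurable]: "B \<in> sets borel"
  shows "(\<integral>\<^sup>+\<omega>. ennreal (posterior (X \<omega>)) * indicator B (X \<omega>) \<partial>M) =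
         (\<integral>\<^sup>+\<omega>. indicator B (X \<omega>) * indicator {\<omega> \<in> space M. Y \<omega> = 1} \<omega> \<partial>M)"
proof -
  let ?g = "\<lambda>x. ennreal (posterior x) * indicator B x :: ennreal"
  let ?f = "\<lambda>r x. ennreal (mvn_density (\<mu> r) S x)"
  have "(\<integral>\<^sup>+\<omega>. ?g (X \<omega>) \<partial>M) = (\<integral>\<^sup>+\<omega>. ?g (X \<omega>) * indicator {\<omega> \<in> space M. Y \<omega> = 0} \<omega> +
      ?g (X \<omega>) * indicator {\<omega> \<in> space M. Y \<omega> = 1} \<omega> \<partial>M)"
  proof (rule nn_integral_cong)
    fix \<omega> assume "\<omega> \<in> space M"
    with Y_cases[OF this] show "?g (X \<omega>) = ?g (X \<omega>) * indicator {\<omega> \<in> space M. Y \<omega> = 0} \<omega> +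
      ?g (X \<omega>) * indicator {\<omega> \<in> space M. Y \<omega> = 1} \<omega>"
      by (elim disjE) simp_all
  qed
  also have "\<dots> = (\<integral>\<^sup>+\<omega>. ?g (X \<omega>) * indicator {\<omega> \<in> space M. Y \<omega> = 0} \<omega> \<partial>M) +
      (\<integral>\<^sup>+\<omega>. ?g (X \<omega>) * indicator {\<omega> \<in> space M. Y \<omega> = 1} \<omega> \<partial>M)"
    by (rule nn_integral_add) measurable
  also have "\<dots> = ennreal (p 0) * (\<integral>\<^sup>+x. ?f 0 x * ?g x \<partial>lborel) + ennreal (p 1) * (\<integral>\<^sup>+x. ?f 1 x * ?g x \<partial>lborel)"
    by (intro arg_cong2[where f = plus] nn_integral_class) (simp_all, measurable)
  also have "\<dots> = (\<integral>\<^sup>+x. ennreal (p 0) * (?f 0 x * ?g x) + ennreal (p 1) * (?f 1 x * ?g x) \<partial>lborel)"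
    by (subst nn_integral_add) (simp_all add: nn_integral_cmult)
  also have "\<dots> = (\<integral>\<^sup>+x. ennreal (p 1) * (?f 1 x * indicator B x) \<partial>lborel)"
  proof (rule nn_integral_cong)
    fix x
    have pos: "p 0 * mvn_density (\<mu> 0) S x > 0" "p 1 * mvn_density (\<mu> 1) S x > 0"
      "p 0 > 0" "p 1 > 0" "mvn_density (\<mu> 0) S x > 0" "mvn_density (\<mu> 1) S x > 0"
      by (rule weighted_density_pos p_pos mvn_density_pos[OF S]; simp)+
    have "p 0 * mvn_density (\<mu> 0) S x * posterior x + p 1 * mvn_density (\<mu> 1) S x * posterior x = p 1 * mvn_density (\<mu> 1) S x"
    proof -
      have "p 0 * mvn_density (\<mu> 0) S x + p 1 * mvn_density (\<mu> 1) S x \<noteq> 0" using pos(1,2) by linarith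
      moreover have "t * (u / t) = u" if "t \<noteq> 0" for t u :: real using that by simp
      ultimately show ?thesis
        unfolding distrib_right[symmetric] posterior_def by blast
    qed
    hence "ennreal (p 0 * mvn_density (\<mu> 0) S x * posterior x) + ennreal (p 1 * mvn_density (\<mu> 1) S x * posterior x)
        = ennreal (p 1 * mvn_density (\<mu> 1) S x)"
      using pos posterior_bounds(1) by (subst ennreal_plus[symmetric]) auto
    thus "ennreal (p 0) * (?f 0 x * ?g x) + ennreal (p 1) * (?f 1 x * ?g x) = ennreal (p 1) * (?f 1 x * indicator B x)"
      using pos posterior_bounds(1)
      by (cases "x \<in> B") (simp_all add: ennreal_mult mult.assoc)
  qed
  also have "\<dots> = ennreal (p 1) * (\<integral>\<^sup>+x. ?f 1 x * indicator B x \<partial>lborel)"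
    by (rule nn_integral_cmult) measurable
  also have "\<dots> = (\<integral>\<^sup>+\<omega>. indicator B (X \<omega>) * indicator {\<omega> \<in> space M. Y \<omega> = 1} \<omega> \<partial>M)"
    by (rule nn_integral_class[symmetric]) (simp, measurable)
  finally show ?thesis .
qed

text \<open>An explicit version serves two purposes: any other version agrees with it almost surely
  at \<open>X\<close>, so the Bayes risk may be computed from it, and it supplies a witness when the
  equality clause is instantiated.\<close>

lemma regression_function_posterior: "regression_function M X Y posterior"
  unfolding regression_function_def
proof
  let ?F = "vimage_algebra (space M) X borel"
  let ?A1 = "{\<omega> \<in> space M. Y \<omega> = 1}"
  have sub: "subalgebra M ?F"
    unfolding subalgebra_def using measurable_iff_sets[THEN iffD1, OF X_measurable] by auto
  interpret finite_measure_subalgebra M ?F by standard (rule sub)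
  have A1 [measurable]: "?A1 \<in> sets M" by measurable
  show "AE \<omega> in M. real_cond_exp M ?F (indicat_real ?A1) \<omega> = posterior (X \<omega>)"
  proof (rule real_cond_exp_charact)
    show "integrable M (indicat_real ?A1)" by (simp add: integrable_indicator_iff emeasure_eq_measure)
    show "integrable M (\<lambda>\<omega>. posterior (X \<omega>))"
      by (rule integrable_const_bound[of _ 1]) (use posterior_bounds in auto)
    show "(\<lambda>\<omega>. posterior (X \<omega>)) \<in> borel_measurable ?F"
      by (rule measurable_compose[OF measurable_vimage_algebra1 borel_measurable_posterior]) simp
    fix A assume "A \<in> sets ?F"
    then obtain B where B [measurable]: "B \<in> sets borel" and A: "A = X -` B \<inter> space M"
      by (subst (asm) sets_vimage_algebra2) auto
    have [measurable]: "A \<in> sets M" unfolding A by measurable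
    have "(LINT \<omega>:A|M. indicat_real ?A1 \<omega>) = enn2real (\<integral>\<^sup>+\<omega>. ennreal (indicator A \<omega> * indicator ?A1 \<omega>) \<partial>M)"
      unfolding set_lebesgue_integral_def real_scaleR_def by (rule integral_eq_nn_integral) auto
    also have "(\<integral>\<^sup>+\<omega>. ennreal (indicator A \<omega> * indicator ?A1 \<omega>) \<partial>M) = (\<integral>\<^sup>+\<omega>. indicator B (X \<omega>) * indicator ?A1 \<omega> \<partial>M)"
      by (rule nn_integral_cong) (simp add: A indicator_def)
    also have "\<dots> = (\<integral>\<^sup>+\<omega>. ennreal (posterior (X \<omega>)) * indicator B (X \<omega>) \<partial>M)"
      by (rule nn_integral_posterior[OF B, symmetric])
    also have "\<dots> = (\<integral>\<^sup>+\<omega>. ennreal (indicator A \<omega> * posterior (X \<omega>)) \<partial>M)"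
      by (rule nn_integral_cong) (simp add: A indicator_def)
    also have "enn2real \<dots> = (LINT \<omega>:A|M. posterior (X \<omega>))"
      unfolding set_lebesgue_integral_def real_scaleR_def
      by (rule integral_eq_nn_integral[symmetric]) (use posterior_bounds in auto)
    finally show "(LINT \<omega>:A|M. indicat_real ?A1 \<omega>) = (LINT \<omega>:A|M. posterior (X \<omega>))" .
  qed
qed measurable

text \<open>With a common covariance the normalising constants and the quadratic terms in
  \<open>x\<close> cancel from the likelihood ratio, leaving a linear condition whose offset is the
  log odds.\<close>

lemma posterior_ge_half: "posterior x \<ge> 1 / 2 \<longleftrightarrow> discriminant (ln (p 1 / p 0)) x \<ge> 0"
proof -
  let ?P = "matrix_inv S"
  let ?q = "\<lambda>r. (x - \<mu> r) \<bullet> (?P *v (x - \<mu> r))"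
  let ?c = "sqrt ((2 * pi) ^ CARD('d) * det S)"
  have c: "?c > 0" using pos_def_matrix_det_pos[OF S] by simp
  have p: "p 0 > 0" "p 1 > 0" by (rule p_pos; simp)+
  have pos: "p 0 * mvn_density (\<mu> 0) S x > 0" "p 1 * mvn_density (\<mu> 1) S x > 0"
    by (rule weighted_density_pos; simp)+
  have "posterior x \<ge> 1 / 2 \<longleftrightarrow> p 0 * mvn_density (\<mu> 0) S x \<le> p 1 * mvn_density (\<mu> 1) S x"
    unfolding posterior_def using pos by (simp add: le_divide_eq)
  also have "\<dots> \<longleftrightarrow> p 0 * exp (- ?q 0 / 2) \<le> p 1 * exp (- ?q 1 / 2)"
    unfolding mvn_density_def times_divide_eq_right using c by (simp only: divide_le_cancel) auto
  also have "\<dots> \<longleftrightarrow> exp (ln (p 0) + - ?q 0 / 2) \<le> exp (ln (p 1) + - ?q 1 / 2)"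
    using p by (simp only: exp_add exp_ln)
  also have "\<dots> \<longleftrightarrow> 0 \<le> ln (p 1 / p 0) + (?q 0 - ?q 1) / 2"
  proof -
    have "ln (p 1 / p 0) = ln (p 1) - ln (p 0)" using p by (simp add: ln_div)
    moreover have "(a + - u / 2 \<le> b + - v / 2) = (0 \<le> l + (u - v) / 2)" if "l = b - a" for a b u v l :: real
      using that by (simp add: diff_divide_distrib) linarith
    ultimately show ?thesis unfolding exp_le_cancel_iff by blast
  qed
  also have "(?q 0 - ?q 1) / 2 = (x - (\<mu> 1 + \<mu> 0) /\<^sub>R 2) \<bullet> (?P *v (\<mu> 1 - \<mu> 0))"
  proof -
    \<comment> \<open>The factorisation of a difference of squares, valid for the symmetric form of
      \<open>matrix_inv S\<close>.\<close>
    have bil: "a \<bullet> (?P *v a) - b \<bullet> (?P *v b) = (a + b) \<bullet> (?P *v (a - b))" for a b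
      using pos_def_matrix_inv_sym[OF S, of a b]
      by (simp add: matrix_vector_mult_diff_distrib inner_diff_right inner_add_left inner_commute[of b])
    have "?q 0 - ?q 1 = ((x - \<mu> 0) + (x - \<mu> 1)) \<bullet> (?P *v (\<mu> 1 - \<mu> 0))"
      unfolding bil by simp
    moreover have "(x - \<mu> 0) + (x - \<mu> 1) = 2 *\<^sub>R (x - (\<mu> 1 + \<mu> 0) /\<^sub>R 2)"
      by (simp add: algebra_simps scaleR_2)
    ultimately show ?thesis by simp
  qed
  finally show ?thesis unfolding discriminant_def .
qed

text \<open>The value depends on the model only through the priors and \<open>D\<close>, and not on
  the version \<open>e\<close>. This is what lets one equation in \<open>D\<close> express equality
  for all models at once.\<close>

lemma bayes_risk:
  assumes D: "D > 0" "D\<^sup>2 = (\<mu> 1 - \<mu> 0) \<bullet> (matrix_inv S *v (\<mu> 1 - \<mu> 0))"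
    and e: "regression_function M X Y e"
  shows "risk M X Y (\<lambda>_. bayes_classifier e) = threshold_risk (p 0) (p 1) D (ln (p 1 / p 0))"
proof -
  have [measurable]: "e \<in> borel_measurable borel" using e by (simp add: regression_function_def)
  let ?C = "\<lambda>\<omega>. if discriminant (ln (p 1 / p 0)) (X \<omega>) \<ge> 0 then 1 else 0 :: nat"
  have sets: "{\<omega> \<in> space M. C \<omega> \<noteq> Y \<omega>} \<in> sets M" if C: "C \<in> M \<rightarrow>\<^sub>M count_space UNIV" for C
  proof -
    have "(\<lambda>\<omega>. real (C \<omega>)) \<in> borel_measurable M" "(\<lambda>\<omega>. real (Y \<omega>)) \<in> borel_measurable M"
      by (rule measurable_compose[OF C], simp, rule measurable_compose[OF Y_measurable], simp)
    from borel_measurable_neq[OF this] show ?thesis by simp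
  qed
  have "prob {\<omega> \<in> space M. bayes_classifier e (X \<omega>) \<noteq> Y \<omega>} = prob {\<omega> \<in> space M. ?C \<omega> \<noteq> Y \<omega>}"
  proof (rule finite_measure_eq_AE)
    show "AE \<omega> in M. (\<omega> \<in> {\<omega> \<in> space M. bayes_classifier e (X \<omega>) \<noteq> Y \<omega>}) = (\<omega> \<in> {\<omega> \<in> space M. ?C \<omega> \<noteq> Y \<omega>})"
      using regression_function_AE_unique[OF e regression_function_posterior]
    proof eventually_elim
      case (elim \<omega>)
      show ?case unfolding bayes_classifier_def elim mem_Collect_eq posterior_ge_half ..
    qed
    show "{\<omega> \<in> space M. bayes_classifier e (X \<omega>) \<noteq> Y \<omega>} \<in> events"
      by (rule sets) (unfold bayes_classifier_def, measurable)
    show "{\<omega> \<in> space M. ?C \<omega> \<noteq> Y \<omega>} \<in> events"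
      by (rule sets) measurable
  qed
  also have "\<dots> = threshold_risk (p 0) (p 1) D (ln (p 1 / p 0))" by (rule discriminant_risk[OF D])
  finally show ?thesis by (simp only: risk_def)
qed

end

section \<open>Models with prescribed priors and separation\<close>

lemma gaussian_modelI:
  assumes "gaussian_classes M X Y \<pi>\<^sub>0 \<pi>\<^sub>1 \<mu>\<^sub>0 \<mu>\<^sub>1 S" "pos_def_matrix S" "0 < \<pi>\<^sub>0" "0 < \<pi>\<^sub>1"
  shows "gaussian_model M X Y (\<lambda>r. if r = 1 then \<pi>\<^sub>1 else \<pi>\<^sub>0) (\<lambda>r. if r = 1 then \<mu>\<^sub>1 else \<mu>\<^sub>0) S"
  using assms unfolding gaussian_classes_def gaussian_model_def gaussian_model_axioms_def by auto

text \<open>Here no law is given from which the normalisation could be inherited, so it is computed: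
  for the identity covariance the density is a product of standard normal densities.\<close>

lemma mvn_total_identity:
  fixes m :: "real^'d"
  shows "(\<integral>\<^sup>+x. ennreal (mvn_density m (mat 1) x) \<partial>lborel) = 1"
proof -
  have inv: "matrix_inv (mat 1 :: real^'d^'d) = mat 1" by (rule matrix_inv_unique) simp
  have dens: "mvn_density m (mat 1) (m + z) = (\<Prod>b\<in>Basis. std_normal_density (z \<bullet> b))" for z
  proof -
    have "z \<bullet> z = (\<Sum>b\<in>Basis. (z \<bullet> b)\<^sup>2)"
      by (subst euclidean_inner) (simp add: power2_eq_square)
    hence "exp (- (z \<bullet> z) / 2) = (\<Prod>b\<in>Basis. exp (- (z \<bullet> b)\<^sup>2 / 2))"
      by (subst exp_sum[symmetric]) (simp_all add: sum_negf sum_divide_distrib)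
    thus ?thesis
      unfolding mvn_density_def std_normal_density_def inv real_sqrt_power
      by (simp add: prod_dividef real_sqrt_power[symmetric])
  qed
  have one: "(\<integral>\<^sup>+t. ennreal (std_normal_density t) \<partial>lborel) = 1"
    by (subst nn_integral_eq_integral) auto
  have "(\<integral>\<^sup>+x. ennreal (mvn_density m (mat 1) x) \<partial>lborel) = (\<integral>\<^sup>+z. ennreal (mvn_density m (mat 1) (m + z)) \<partial>lborel)"
    by (rule nn_integral_lborel_translate[symmetric]) measurable
  also have "\<dots> = (\<integral>\<^sup>+z. (\<Prod>b\<in>Basis. ennreal (std_normal_density (z \<bullet> b))) \<partial>(lborel :: (real^'d) measure))"
    by (simp add: dens prod_ennreal)
  also have "\<dots> = 1" by (subst nn_integral_lborel_prod) (simp_all add: one)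
  finally show ?thesis .
qed

text \<open>If no model had separation \<open>D\<close>, the equality clause would hold vacuously at
  that \<open>D\<close> and uniqueness would be lost. The model is a density on the product of
  Lebesgue measure and counting measure, with identity covariance and one mean at the
  origin.\<close>

lemma gaussian_classes_exist:
  fixes p\<^sub>0 p\<^sub>1 D :: real
  assumes p: "0 < p\<^sub>0" "0 < p\<^sub>1" "p\<^sub>0 + p\<^sub>1 = 1" and D: "D > 0"
  obtains N :: "((real^'d) \<times> nat) measure" and m\<^sub>0 m\<^sub>1 S
  where "gaussian_classes N fst snd p\<^sub>0 p\<^sub>1 m\<^sub>0 m\<^sub>1 S" "pos_def_matrix S" "m\<^sub>0 \<noteq> m\<^sub>1"
    "D\<^sup>2 = (m\<^sub>1 - m\<^sub>0) \<bullet> (matrix_inv S *v (m\<^sub>1 - m\<^sub>0))"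
proof -
  define S :: "real^'d^'d" where "S = mat 1"
  \<comment> \<open>Any coordinate axis will do; for the identity covariance the separation is the
    Euclidean distance, here \<open>D\<close>.\<close>
  define m\<^sub>1 :: "real^'d" where "m\<^sub>1 = axis undefined D"
  define p where "p r = (if r = 1 then p\<^sub>1 else p\<^sub>0)" for r :: nat
  define f where "f r = mvn_density (if r = 1 then m\<^sub>1 else 0) S" for r :: nat
  have f [measurable]: "f r \<in> borel_measurable borel" for r by (simp add: f_def)
  have S: "pos_def_matrix S" by (simp add: pos_def_matrix_def S_def transpose_mat)
  have inv: "matrix_inv S = mat 1" unfolding S_def by (rule matrix_inv_unique) simp
  have total: "(\<integral>\<^sup>+x. ennreal (f r x) \<partial>lborel) = 1" for r
    unfolding f_def S_def by (rule mvn_total_identity)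
  have ppos: "p r > 0" for r using p by (simp add: p_def)
  define h where "h = (\<lambda>z :: (real^'d) \<times> nat. ennreal (p (snd z)) * ennreal (f (snd z) (fst z)))"
  have lab [measurable]: "snd \<in> lborel \<Otimes>\<^sub>M labels \<rightarrow>\<^sub>M count_space UNIV"
    by (rule measurable_labels_count_space[OF measurable_snd])
  have 1: "(\<lambda>z. ennreal (p (snd z))) \<in> borel_measurable (lborel \<Otimes>\<^sub>M labels)"
    by (rule measurable_compose[OF lab]) simp
  have 2: "(\<lambda>z. if snd z = 1 then ennreal (f 1 (fst z)) else ennreal (f 0 (fst z))) \<in> borel_measurable (lborel \<Otimes>\<^sub>M labels)"
    by measurable
  have "h = (\<lambda>z. ennreal (p (snd z)) * (if snd z = 1 then ennreal (f 1 (fst z)) else ennreal (f 0 (fst z))))"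
    by (simp add: h_def f_def fun_eq_iff)
  hence h [measurable]: "h \<in> borel_measurable (lborel \<Otimes>\<^sub>M labels)"
    using borel_measurable_times_ennreal[OF 1 2] by (simp only:)
  interpret labels: sigma_finite_measure labels by (rule sigma_finite_measure_count_space_finite) simp
  interpret pair: pair_sigma_finite "lborel :: (real^'d) measure" labels ..
  define N where "N = density (lborel \<Otimes>\<^sub>M labels) h"
  have sets_N: "sets N = sets (borel \<Otimes>\<^sub>M labels)"
    unfolding N_def sets_density by (intro sets_pair_measure_cong) auto
  have space_N: "space N = UNIV \<times> {0, 1}" by (simp add: N_def space_pair_measure)
  have nnN: "(\<integral>\<^sup>+z. g z \<partial>N) = (\<Sum>y\<in>{0, 1}. ennreal (p y) * (\<integral>\<^sup>+x. ennreal (f y x) * g (x, y) \<partial>lborel))"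
    if g [measurable]: "g \<in> borel_measurable (lborel \<Otimes>\<^sub>M labels)" for g
  proof -
    have "(\<integral>\<^sup>+z. g z \<partial>N) = (\<integral>\<^sup>+z. h z * g z \<partial>(lborel \<Otimes>\<^sub>M labels))"
      unfolding N_def by (rule nn_integral_density) measurable
    also have "\<dots> = (\<integral>\<^sup>+y. (\<integral>\<^sup>+x. h (x, y) * g (x, y) \<partial>lborel) \<partial>labels)"
      by (rule pair.nn_integral_snd[symmetric]) measurable
    also have "\<dots> = (\<Sum>y\<in>{0, 1}. \<integral>\<^sup>+x. h (x, y) * g (x, y) \<partial>lborel)"
      by (rule nn_integral_count_space_finite) simp
    also have "\<dots> = (\<Sum>y\<in>{0, 1}. ennreal (p y) * (\<integral>\<^sup>+x. ennreal (f y x) * g (x, y) \<partial>lborel))"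
    proof (rule sum.cong[OF refl])
      fix y :: nat assume y: "y \<in> {0, 1}"
      have [measurable]: "(\<lambda>x. g (x, y)) \<in> borel_measurable lborel"
        using measurable_compose[OF measurable_Pair2'[of y labels lborel] g] y by simp
      show "(\<integral>\<^sup>+x. h (x, y) * g (x, y) \<partial>lborel) = ennreal (p y) * (\<integral>\<^sup>+x. ennreal (f y x) * g (x, y) \<partial>lborel)"
        unfolding h_def fst_conv snd_conv mult.assoc by (rule nn_integral_cmult) measurable
    qed
    finally show ?thesis .
  qed
  have class_N: "emeasure N {z \<in> space N. snd z = r \<and> fst z \<in> B} =
      ennreal (p r) * (\<integral>\<^sup>+x. ennreal (f r x) * indicator B x \<partial>lborel)"
    if r: "r \<in> {0, 1}" and B [measurable]: "B \<in> sets borel" for r B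
  proof -
    have sN [measurable_cong]: "sets N = sets (lborel \<Otimes>\<^sub>M labels)" unfolding N_def by (rule sets_density)
    have g [measurable]: "(\<lambda>z. of_bool (snd z = r) * indicator B (fst z) :: ennreal) \<in> borel_measurable (lborel \<Otimes>\<^sub>M labels)"
      by measurable
    have ms: "{z \<in> space N. snd z = r \<and> fst z \<in> B} \<in> sets N" by measurable
    have "emeasure N {z \<in> space N. snd z = r \<and> fst z \<in> B} = (\<integral>\<^sup>+z. of_bool (snd z = r) * indicator B (fst z) \<partial>N)"
      by (subst nn_integral_indicator[OF ms, symmetric], rule nn_integral_cong) (auto simp: indicator_def)
    also have "\<dots> = (\<Sum>y\<in>{0, 1}. ennreal (p y) * (\<integral>\<^sup>+x. ennreal (f y x) * (of_bool (y = r) * indicator B x) \<partial>lborel))"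
      by (subst nnN[OF g]) simp
    also have "\<dots> = (\<Sum>y\<in>{0, 1}. if y = r then ennreal (p r) * (\<integral>\<^sup>+x. ennreal (f r x) * indicator B x \<partial>lborel) else 0)"
      by (rule sum.cong) auto
    also have "\<dots> = ennreal (p r) * (\<integral>\<^sup>+x. ennreal (f r x) * indicator B x \<partial>lborel)"
      using r by auto
    finally show ?thesis .
  qed
  have class_total: "emeasure N {z \<in> space N. snd z = r} = ennreal (p r)" if "r \<in> {0, 1}" for r
    using class_N[OF that, of UNIV] total[of r] by simp
  have X: "fst \<in> N \<rightarrow>\<^sub>M borel" and Y: "snd \<in> N \<rightarrow>\<^sub>M labels"
    unfolding measurable_cong_sets[OF sets_N refl] by measurable
  have A: "{z \<in> space N. snd z = r} \<in> sets N" if "r \<in> {0, 1}" for r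
  proof -
    have "snd -` {r} \<inter> space N \<in> sets N" by (rule measurable_sets[OF Y]) (use that in simp)
    moreover have "snd -` {r} \<inter> space N = {z \<in> space N. snd z = r}" by auto
    ultimately show ?thesis by simp
  qed
  have prob: "prob_space N"
  proof
    have "emeasure N (space N) = (\<integral>\<^sup>+z. 1 \<partial>N)" by simp
    also have "\<dots> = ennreal (p 0) + ennreal (p 1)" by (subst nnN) (simp_all add: total)
    also have "\<dots> = 1" using p by (simp add: p_def ennreal_plus[symmetric] del: ennreal_plus)
    finally show "emeasure N (space N) = 1" .
  qed
  have law: "distributed (uniform_measure N {z \<in> space N. snd z = r}) lborel fst (\<lambda>x. ennreal (f r x))"
    if r: "r \<in> {0, 1}" for r
    unfolding distributed_def
  proof (intro conjI)
    let ?U = "uniform_measure N {z \<in> space N. snd z = r}"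
    have sU: "sets ?U = sets N" by simp
    show XU: "fst \<in> ?U \<rightarrow>\<^sub>M lborel"
      using X by (simp add: measurable_cong_sets[OF sU sets_lborel])
    show "(\<lambda>x. ennreal (f r x)) \<in> borel_measurable lborel" by measurable
    show "distr ?U lborel fst = density lborel (\<lambda>x. ennreal (f r x))"
    proof (rule measure_eqI)
      fix B assume "B \<in> sets (distr ?U lborel fst)"
      hence B [measurable]: "B \<in> sets borel" by simp
      have pre: "fst -` B \<inter> space N \<in> sets N" by (rule measurable_sets[OF X B])
      have "emeasure (distr ?U lborel fst) B = emeasure ?U (fst -` B \<inter> space N)"
        using XU by (subst emeasure_distr) auto
      also have "\<dots> = emeasure N ({z \<in> space N. snd z = r} \<inter> (fst -` B \<inter> space N)) / ennreal (p r)"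
        unfolding emeasure_uniform_measure[OF A[OF r] pre] class_total[OF r] ..
      also have "{z \<in> space N. snd z = r} \<inter> (fst -` B \<inter> space N) = {z \<in> space N. snd z = r \<and> fst z \<in> B}" by auto
      also have "emeasure N \<dots> / ennreal (p r) = (\<integral>\<^sup>+x. ennreal (f r x) * indicator B x \<partial>lborel)"
        unfolding class_N[OF r B] using ppos[of r] by (simp add: ennreal_mult_divide_eq mult.commute[of "ennreal (p r)"])
      also have "\<dots> = emeasure (density lborel (\<lambda>x. ennreal (f r x))) B" by (simp add: emeasure_density)
      finally show "emeasure (distr ?U lborel fst) B = emeasure (density lborel (\<lambda>x. ennreal (f r x))) B" .
    qed simp
  qed
  have "gaussian_classes N fst snd p\<^sub>0 p\<^sub>1 0 m\<^sub>1 S"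
    unfolding gaussian_classes_def
  proof (intro conjI prob X Y)
    show "measure N {\<omega> \<in> space N. snd \<omega> = 0} = p\<^sub>0" "measure N {\<omega> \<in> space N. snd \<omega> = 1} = p\<^sub>1"
      using class_total[of 0] class_total[of 1] p by (simp_all add: measure_def p_def)
    show "distributed (uniform_measure N {\<omega> \<in> space N. snd \<omega> = 0}) lborel fst (\<lambda>x. ennreal (mvn_density 0 S x))"
      "distributed (uniform_measure N {\<omega> \<in> space N. snd \<omega> = 1}) lborel fst (\<lambda>x. ennreal (mvn_density m\<^sub>1 S x))"
      using law[of 0] law[of 1] by (simp_all add: f_def)
  qed
  moreover have "0 \<noteq> m\<^sub>1" using D by (simp add: m\<^sub>1_def axis_eq_0_iff)
  moreover have "D\<^sup>2 = (m\<^sub>1 - 0) \<bullet> (matrix_inv S *v (m\<^sub>1 - 0))"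
    by (simp add: inv m\<^sub>1_def inner_axis_axis power2_eq_square)
  ultimately show ?thesis using that S by blast
qed

section \<open>Noisy LDA\<close>

lemma lda_limit_risk_threshold:
  "lda_limit_risk \<pi>\<^sub>0 \<pi>\<^sub>1 \<rho> D = threshold_risk \<pi>\<^sub>0 \<pi>\<^sub>1 D (lda_c0 \<pi>\<^sub>0 \<pi>\<^sub>1 \<rho> D)"
  by (simp add: lda_limit_risk_def threshold_risk_def)

text \<open>All models in question share one Bayes risk, the strict minimum of
  \<open>threshold_risk\<close>, so equality in any of them forces the minimising threshold. The
  forward direction draws on the constructed model and its posterior.\<close>

lemma lda_limit_risk_eq_bayes_iff:
  assumes p: "0 < p\<^sub>1" "p\<^sub>1 < 1" "p\<^sub>1 = 1 - p\<^sub>0" and D: "D > 0"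
  shows "(\<forall>(N :: ((real^'d) \<times> nat) measure) m\<^sub>0 m\<^sub>1 S e.
              gaussian_classes N fst snd p\<^sub>0 p\<^sub>1 m\<^sub>0 m\<^sub>1 S \<and> pos_def_matrix S \<and> m\<^sub>0 \<noteq> m\<^sub>1 \<and>
              D\<^sup>2 = (m\<^sub>1 - m\<^sub>0) \<bullet> (matrix_inv S *v (m\<^sub>1 - m\<^sub>0)) \<and>
              regression_function N fst snd e \<longrightarrow>
              lda_limit_risk p\<^sub>0 p\<^sub>1 r D = risk N fst snd (\<lambda>_. bayes_classifier e)) \<longleftrightarrow>
         lda_c0 p\<^sub>0 p\<^sub>1 r D = ln (p\<^sub>1 / p\<^sub>0)" (is "?L \<longleftrightarrow> ?R")
proof -
  have p0: "0 < p\<^sub>0" "p\<^sub>0 + p\<^sub>1 = 1" using p by auto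
  have bayes: "risk N fst snd (\<lambda>_. bayes_classifier e) = threshold_risk p\<^sub>0 p\<^sub>1 D (ln (p\<^sub>1 / p\<^sub>0))"
    if "gaussian_classes N fst snd p\<^sub>0 p\<^sub>1 m\<^sub>0 m\<^sub>1 S" "pos_def_matrix S"
      "D\<^sup>2 = (m\<^sub>1 - m\<^sub>0) \<bullet> (matrix_inv S *v (m\<^sub>1 - m\<^sub>0))" "regression_function N fst snd e"
    for N :: "((real^'d) \<times> nat) measure" and m\<^sub>0 m\<^sub>1 S e
  proof -
    interpret N: gaussian_model N fst snd "\<lambda>r. if r = 1 then p\<^sub>1 else p\<^sub>0" "\<lambda>r. if r = 1 then m\<^sub>1 else m\<^sub>0" S
      by (rule gaussian_modelI[OF that(1,2) p0(1) p(1)])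
    show ?thesis using N.bayes_risk[OF D _ that(4)] that(3) by simp
  qed
  have iff: "threshold_risk p\<^sub>0 p\<^sub>1 D (lda_c0 p\<^sub>0 p\<^sub>1 r D) = threshold_risk p\<^sub>0 p\<^sub>1 D (ln (p\<^sub>1 / p\<^sub>0)) \<longleftrightarrow> ?R"
    using threshold_risk_strict_min[OF D p0(1) p(1), of "lda_c0 p\<^sub>0 p\<^sub>1 r D"] by fastforce
  show ?thesis
  proof
    assume R: ?R
    show ?L
      unfolding lda_limit_risk_threshold R using bayes by metis
  next
    assume L: ?L
    obtain N :: "((real^'d) \<times> nat) measure" and m\<^sub>0 m\<^sub>1 S where N: "gaussian_classes N fst snd p\<^sub>0 p\<^sub>1 m\<^sub>0 m\<^sub>1 S"
      "pos_def_matrix S" "m\<^sub>0 \<noteq> m\<^sub>1" "D\<^sup>2 = (m\<^sub>1 - m\<^sub>0) \<bullet> (matrix_inv S *v (m\<^sub>1 - m\<^sub>0))"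
      using gaussian_classes_exist[OF p0(1) p(1) p0(2) D] by blast
    interpret N: gaussian_model N fst snd "\<lambda>r. if r = 1 then p\<^sub>1 else p\<^sub>0" "\<lambda>r. if r = 1 then m\<^sub>1 else m\<^sub>0" S
      by (rule gaussian_modelI[OF N(1,2) p0(1) p(1)])
    have "lda_limit_risk p\<^sub>0 p\<^sub>1 r D = risk N fst snd (\<lambda>_. bayes_classifier N.posterior)"
      using L N N.regression_function_posterior by blast
    also have "\<dots> = threshold_risk p\<^sub>0 p\<^sub>1 D (ln (p\<^sub>1 / p\<^sub>0))"
      by (rule bayes[OF N(1,2,4) N.regression_function_posterior])
    finally show ?R unfolding lda_limit_risk_threshold iff .
  qed
qed

theorem theorem6:
  fixes M :: "'w measure"
    and X :: "nat \<Rightarrow> 'w \<Rightarrow> real^'d"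
    and Y Yt :: "nat \<Rightarrow> 'w \<Rightarrow> nat"
    and \<mu>\<^sub>0 \<mu>\<^sub>1 :: "real^'d"
    and \<Sigma> :: "real^'d^'d"
    and \<pi>\<^sub>0 \<pi>\<^sub>1 \<rho> \<Delta> :: real
    and \<eta> :: "real^'d \<Rightarrow> real"
  assumes "prob_space M"
    and "iid_triples M X Y Yt"
    and "gaussian_classes M (X 0) (Y 0) \<pi>\<^sub>0 \<pi>\<^sub>1 \<mu>\<^sub>0 \<mu>\<^sub>1 \<Sigma>"
    and "pos_def_matrix \<Sigma>" and "\<mu>\<^sub>0 \<noteq> \<mu>\<^sub>1"
    and "\<pi>\<^sub>1 = 1 - \<pi>\<^sub>0" and "0 < \<pi>\<^sub>1" and "\<pi>\<^sub>1 < 1"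
    and "homogeneous_noise M (X 0) (Y 0) (Yt 0) \<rho>"
    and "0 \<le> \<rho>" and "\<rho> < 1 / 2"
    and "\<Delta> > 0" and "\<Delta>\<^sup>2 = (\<mu>\<^sub>1 - \<mu>\<^sub>0) \<bullet> (matrix_inv \<Sigma> *v (\<mu>\<^sub>1 - \<mu>\<^sub>0))"
    and "regression_function M (X 0) (Y 0) \<eta>"
  shows
    "(AE \<omega> in M. \<forall>x.
        (lda_c0 \<pi>\<^sub>0 \<pi>\<^sub>1 \<rho> \<Delta> + (x - (\<mu>\<^sub>1 + \<mu>\<^sub>0) /\<^sub>R 2) \<bullet> (matrix_inv \<Sigma> *v (\<mu>\<^sub>1 - \<mu>\<^sub>0)) > 0 \<longrightarrow>
           (\<lambda>n. lda_classifier (\<lambda>i. X i \<omega>) (\<lambda>i. Yt i \<omega>) n x) \<longlonglongrightarrow> 1) \<and>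
        (lda_c0 \<pi>\<^sub>0 \<pi>\<^sub>1 \<rho> \<Delta> + (x - (\<mu>\<^sub>1 + \<mu>\<^sub>0) /\<^sub>R 2) \<bullet> (matrix_inv \<Sigma> *v (\<mu>\<^sub>1 - \<mu>\<^sub>0)) < 0 \<longrightarrow>
           (\<lambda>n. lda_classifier (\<lambda>i. X i \<omega>) (\<lambda>i. Yt i \<omega>) n x) \<longlonglongrightarrow> 0)) \<and>
     (\<lambda>n. risk M (X 0) (Y 0) (\<lambda>\<omega>. lda_classifier (\<lambda>i. X i \<omega>) (\<lambda>i. Yt i \<omega>) n))
        \<longlonglongrightarrow> lda_limit_risk \<pi>\<^sub>0 \<pi>\<^sub>1 \<rho> \<Delta> \<and>
     lda_limit_risk \<pi>\<^sub>0 \<pi>\<^sub>1 \<rho> \<Delta> \<ge> risk M (X 0) (Y 0) (\<lambda>_. bayes_classifier \<eta>) \<and>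
     (\<forall>r p\<^sub>0 p\<^sub>1. 0 < r \<and> r < 1 / 2 \<and> 0 < p\<^sub>1 \<and> p\<^sub>1 < 1 \<and> p\<^sub>1 = 1 - p\<^sub>0 \<and> p\<^sub>0 \<noteq> p\<^sub>1 \<longrightarrow>
        (\<exists>!D. D > 0 \<and>
           (\<forall>(N :: ((real^'d) \<times> nat) measure) m\<^sub>0 m\<^sub>1 S e.
              gaussian_classes N fst snd p\<^sub>0 p\<^sub>1 m\<^sub>0 m\<^sub>1 S \<and> pos_def_matrix S \<and> m\<^sub>0 \<noteq> m\<^sub>1 \<and>
              D\<^sup>2 = (m\<^sub>1 - m\<^sub>0) \<bullet> (matrix_inv S *v (m\<^sub>1 - m\<^sub>0)) \<and>
              regression_function N fst snd e \<longrightarrow>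
              lda_limit_risk p\<^sub>0 p\<^sub>1 r D = risk N fst snd (\<lambda>_. bayes_classifier e))))"
proof -
  note asm = assms
  interpret prob_space M by fact
  have \<pi>0: "0 < \<pi>\<^sub>0" using asm(6,8) by simp
  define p where "p = (\<lambda>r :: nat. if r = 1 then \<pi>\<^sub>1 else \<pi>\<^sub>0)"
  define \<mu> where "\<mu> = (\<lambda>r :: nat. if r = 1 then \<mu>\<^sub>1 else \<mu>\<^sub>0)"
  have p [simp]: "p 0 = \<pi>\<^sub>0" "p 1 = \<pi>\<^sub>1" by (simp_all add: p_def)
  have \<mu> [simp]: "\<mu> 0 = \<mu>\<^sub>0" "\<mu> 1 = \<mu>\<^sub>1" by (simp_all add: \<mu>_def)
  have G: "gaussian_model M (X 0) (Y 0) p \<mu> \<Sigma>"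
    unfolding p_def \<mu>_def by (rule gaussian_modelI[OF asm(3,4) \<pi>0 asm(7)])
  interpret G: gaussian_model M "X 0" "Y 0" p \<mu> \<Sigma> by (rule G)
  have D: "\<Delta>\<^sup>2 = (\<mu> 1 - \<mu> 0) \<bullet> (matrix_inv \<Sigma> *v (\<mu> 1 - \<mu> 0))" using asm(13) by (simp only: \<mu>)
  let ?c = "lda_c0 \<pi>\<^sub>0 \<pi>\<^sub>1 \<rho> \<Delta>"
  let ?C = "\<lambda>\<omega>. lda_classifier (\<lambda>i. X i \<omega>) (\<lambda>i. Yt i \<omega>)"
  have disc: "?c + (x - (\<mu>\<^sub>1 + \<mu>\<^sub>0) /\<^sub>R 2) \<bullet> (matrix_inv \<Sigma> *v (\<mu>\<^sub>1 - \<mu>\<^sub>0)) = G.discriminant ?c x" for x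
    unfolding G.discriminant_def \<mu> ..
  have w: "p s * (if r = s then 1 - \<rho> else \<rho>) = (if s = 1 then \<pi>\<^sub>1 else \<pi>\<^sub>0) * (if r = s then 1 - \<rho> else \<rho>)"
    for r s :: nat by (simp add: p_def)
  have lim: "AE \<omega> in M. \<forall>x.
      (G.discriminant ?c x > 0 \<longrightarrow> (\<lambda>n. ?C \<omega> n x) \<longlonglongrightarrow> 1) \<and>
      (G.discriminant ?c x < 0 \<longrightarrow> (\<lambda>n. ?C \<omega> n x) \<longlonglongrightarrow> 0)"
    using lda_averages_AE[OF asm(1,2) G asm(9)]
  proof eventually_elim
    case (elim \<omega>)
    obtain k where k: "k > 0" "\<And>x. (\<lambda>n. lda_score (\<lambda>i. X i \<omega>) (\<lambda>i. Yt i \<omega>) n x) \<longlonglongrightarrow> k * G.discriminant ?c x"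
      using lda_score_limit[OF asm(6,7,8,10,11,4) D, of "\<lambda>i. Yt i \<omega>" "\<lambda>i. X i \<omega>"] elim
      unfolding w G.discriminant_def by blast
    show ?case using lda_classifier_limit[OF k(2,1)] by blast
  qed
  have V: "(\<lambda>\<omega>. (X i \<omega>, Y i \<omega>, Yt i \<omega>)) \<in> M \<rightarrow>\<^sub>M borel \<Otimes>\<^sub>M (labels \<Otimes>\<^sub>M labels)" for i
    using asm(2) unfolding iid_triples_def indep_vars_def2 by auto
  have X: "X i \<in> borel_measurable M" for i
    using measurable_compose[OF V measurable_fst, of i] by simp
  have Yt: "Yt i \<in> M \<rightarrow>\<^sub>M count_space UNIV" for i
    using measurable_labels_count_space[OF measurable_compose[OF V measurable_compose[OF measurable_snd measurable_snd], of i]]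
    by simp
  have C: "(\<lambda>\<omega>. ?C \<omega> n (X 0 \<omega>)) \<in> M \<rightarrow>\<^sub>M count_space UNIV" for n
  proof -
    note [measurable] = borel_measurable_lda_score[where xs = X and x = "X 0" and ys = Yt and n = n, OF X X Yt]
    show ?thesis unfolding lda_classifier_score by measurable
  qed
  have "(\<lambda>n. prob {\<omega> \<in> space M. ?C \<omega> n (X 0 \<omega>) \<noteq> Y 0 \<omega>}) \<longlonglongrightarrow> threshold_risk (p 0) (p 1) \<Delta> ?c"
  proof (rule G.risk_tendsto[OF asm(12) D C])
    \<comment> \<open>The null set in \<open>lim\<close> does not depend on \<open>x\<close>, so
      \<open>x\<close> may be replaced by the random point \<open>X 0 \<omega>\<close>.\<close>
    show "AE \<omega> in M. (G.discriminant ?c (X 0 \<omega>) > 0 \<longrightarrow> (\<lambda>n. ?C \<omega> n (X 0 \<omega>)) \<longlonglongrightarrow> 1) \<and>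
      (G.discriminant ?c (X 0 \<omega>) < 0 \<longrightarrow> (\<lambda>n. ?C \<omega> n (X 0 \<omega>)) \<longlonglongrightarrow> 0)"
      using lim by eventually_elim blast
  qed
  hence risk: "(\<lambda>n. risk M (X 0) (Y 0) (\<lambda>\<omega>. ?C \<omega> n)) \<longlonglongrightarrow> lda_limit_risk \<pi>\<^sub>0 \<pi>\<^sub>1 \<rho> \<Delta>"
    unfolding risk_def lda_limit_risk_threshold p .
  have "risk M (X 0) (Y 0) (\<lambda>_. bayes_classifier \<eta>) = threshold_risk \<pi>\<^sub>0 \<pi>\<^sub>1 \<Delta> (ln (\<pi>\<^sub>1 / \<pi>\<^sub>0))"
    using G.bayes_risk[OF asm(12) D asm(14)] unfolding p .
  hence bayes: "risk M (X 0) (Y 0) (\<lambda>_. bayes_classifier \<eta>) \<le> lda_limit_risk \<pi>\<^sub>0 \<pi>\<^sub>1 \<rho> \<Delta>"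
    unfolding lda_limit_risk_threshold
    using threshold_risk_strict_min[OF asm(12) \<pi>0 asm(7), of ?c] by (cases "?c = ln (\<pi>\<^sub>1 / \<pi>\<^sub>0)") auto
  have unique: "\<exists>!D. D > 0 \<and>
           (\<forall>(N :: ((real^'d) \<times> nat) measure) m\<^sub>0 m\<^sub>1 S e.
              gaussian_classes N fst snd p\<^sub>0 p\<^sub>1 m\<^sub>0 m\<^sub>1 S \<and> pos_def_matrix S \<and> m\<^sub>0 \<noteq> m\<^sub>1 \<and>
              D\<^sup>2 = (m\<^sub>1 - m\<^sub>0) \<bullet> (matrix_inv S *v (m\<^sub>1 - m\<^sub>0)) \<and>
              regression_function N fst snd e \<longrightarrow>
              lda_limit_risk p\<^sub>0 p\<^sub>1 r D = risk N fst snd (\<lambda>_. bayes_classifier e))"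
    if "0 < r \<and> r < 1 / 2 \<and> 0 < p\<^sub>1 \<and> p\<^sub>1 < 1 \<and> p\<^sub>1 = 1 - p\<^sub>0 \<and> p\<^sub>0 \<noteq> p\<^sub>1" for r p\<^sub>0 p\<^sub>1
  proof -
    have "\<exists>!D. D > 0 \<and> lda_c0 p\<^sub>0 p\<^sub>1 r D = ln (p\<^sub>1 / p\<^sub>0)"
      by (rule lda_c0_eq_log_odds_unique) (use that in auto)
    thus ?thesis
      using lda_limit_risk_eq_bayes_iff[where 'd = 'd, of p\<^sub>1 p\<^sub>0] that by (simp cong: conj_cong)
  qed
  show ?thesis
    unfolding disc by (intro conjI allI impI lim risk bayes unique) auto
qed

end
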